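(* Let $P=\prod_{i=1}^m p_i$ be a product distribution with all $p_i(a)>0$ on $K=\prod_{i=1}^m A_i$, $N=|K|$, and suppose the marginals are commensurate: there is $h>0$ with $-\ln p_i(a)\in h\mathbb{Z}$ for all $i$ and all $a\in A_i$. Then for $\rho>0$ $$f(\rho)=\rho\ln N+\ln\sum_t \pi(t)\,\frac{\mathcal{A}_\rho(t)}{N^\rho}$$ is a finite sum over the grid $h\mathbb{Z}$ in which every summand lies in $[0,1]$, and $s=f(1)/f(\tfrac12)$ is computed exactly in $\widetilde O(R/h+B_{\mathrm{in}})$ time, where $B_{\mathrm{in}}=\sum_i |A_i|$ and $R=\sum_i(\max_a s_i(a)-\min_a s_i(a))$; for extensive range $R=O(m)$ this is $\widetilde O(m/h)$. Moreover, at every level $t$ (every value taken by $S$), $$\frac1{1+\rho}\ \le\ \frac{\mathcal{A}_\rho(t)}{\big(N F_S(t)\big)^\rho}\ \le\ 1,$$ with equality on the right if and only if the level is a singleton, $n(t)=1$.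
   Context: $A_1,\dots,A_m$ finite nonempty sets, $K=\prod_iA_i$, $N=|K|$ ($N\ge2$, so that $s$ is defined); $p_i$ probability distributions on $A_i$ with $p_i(a)>0$; $P(x)=\prod_ip_i(x_i)$; $U$ uniform on $K$; $s_i(a)=-\ln p_i(a)$; surprisal $S(x)=-\ln P(x)=\sum_is_i(x_i)$. A guessing order is a bijection $G:K\to\{1,\dots,N\}$; it is optimal if it enumerates keys by non-decreasing surprisal (ties arbitrary; the value of $\mathbb{E}_P[G^\rho]$ does not depend on the tie-breaking). $f(\rho)=\ln\mathbb{E}_P[G^\rho]$ for an optimal $G$. $F_S(t)=\mathbb{P}_U[S\le t]$, $F_S(t^-)=\mathbb{P}_U[S<t]$, $n(t)=N\,\mathbb{P}_U[S=t]$, $\pi(t)=\mathbb{P}_P[S=t]$, $J_t=\{NF_S(t^-)+1,\dots,NF_S(t)\}$, $\mathcal{A}_\rho(t)=\frac1{n(t)}\sum_{r\in J_t}r^\rho$. $\widetilde O$ suppresses polylogarithmic factors. Running time counts elementary arithmetic operations on numbers at unit cost (word operations). "Exactly" means that $s$ is the ratio of the two finite level sums with no discretization error; the only numerical error is the finite-precision evaluation of these sums, where each $\mathcal{A}_\rho(t)$, $\rho\in\{\tfrac12,1\}$, is evaluated from the pair $(F_S(t^-),F_S(t))$ to a fixed target relative precision in time $O(1)$ (i.e. independent of $m$).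
   Formalization: The bound Õ(m/h) for extensive range R=O(m) is proved under the added condition B_in = O(m + m/h) (e.g. bounded alphabets); without such a condition it fails: m=1, p_1 uniform on 2^k letters, h=ln 2, R=0, where B_in=2^k is unbounded. *)

theory Defs
  imports "HOL-Probability.Probability"
begin

section \<open>Product sources, levels and guessing orders\<close>

text \<open>
  A source with \<open>m\<close> coordinates is given by \<open>p 0, \<dots>, p (m - 1)\<close>, where the alphabet \<open>A\<^sub>i\<close> is the
  support of \<open>p i\<close>: a distribution on a nonempty set that is positive everywhere is the same as a
  \<open>pmf\<close> with that set as its support.  The default value \<open>undefined\<close> in \<open>Pi_pmf\<close> makes the support
  of the product equal to the extensional product \<open>\<Pi>\<^sub>E\<close>.
\<close>

definition keys :: "nat \<Rightarrow> (nat \<Rightarrow> 'a pmf) \<Rightarrow> (nat \<Rightarrow> 'a) set" where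
  "keys m p = (\<Pi>\<^sub>E i\<in>{..<m}. set_pmf (p i))"

definition key_count :: "nat \<Rightarrow> (nat \<Rightarrow> 'a pmf) \<Rightarrow> nat" where
  "key_count m p = card (keys m p)"

definition key_pmf :: "nat \<Rightarrow> (nat \<Rightarrow> 'a pmf) \<Rightarrow> (nat \<Rightarrow> 'a) pmf" where
  "key_pmf m p = Pi_pmf {..<m} undefined p"

definition unif_pmf :: "nat \<Rightarrow> (nat \<Rightarrow> 'a pmf) \<Rightarrow> (nat \<Rightarrow> 'a) pmf" where
  "unif_pmf m p = pmf_of_set (keys m p)"

definition letter_surprisal :: "'a pmf \<Rightarrow> 'a \<Rightarrow> real" where
  "letter_surprisal q a = - ln (pmf q a)"

definition surprisal :: "nat \<Rightarrow> (nat \<Rightarrow> 'a pmf) \<Rightarrow> (nat \<Rightarrow> 'a) \<Rightarrow> real" where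
  "surprisal m p x = - ln (pmf (key_pmf m p) x)"

definition levels :: "nat \<Rightarrow> (nat \<Rightarrow> 'a pmf) \<Rightarrow> real set" where
  "levels m p = surprisal m p ` keys m p"

definition optimal_order :: "nat \<Rightarrow> (nat \<Rightarrow> 'a pmf) \<Rightarrow> ((nat \<Rightarrow> 'a) \<Rightarrow> nat) \<Rightarrow> bool" where
  "optimal_order m p G \<longleftrightarrow>
     bij_betw G (keys m p) {1..key_count m p} \<and>
     (\<forall>x\<in>keys m p. \<forall>y\<in>keys m p. G x \<le> G y \<longrightarrow> surprisal m p x \<le> surprisal m p y)"

definition guess_log_moment ::
    "nat \<Rightarrow> (nat \<Rightarrow> 'a pmf) \<Rightarrow> ((nat \<Rightarrow> 'a) \<Rightarrow> nat) \<Rightarrow> real \<Rightarrow> real" where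
  "guess_log_moment m p G \<rho> =
     ln (measure_pmf.expectation (key_pmf m p) (\<lambda>x. real (G x) powr \<rho>))"

definition cdf_S :: "nat \<Rightarrow> (nat \<Rightarrow> 'a pmf) \<Rightarrow> real \<Rightarrow> real" where
  "cdf_S m p t = measure_pmf.prob (unif_pmf m p) {x. surprisal m p x \<le> t}"

definition cdf_S_left :: "nat \<Rightarrow> (nat \<Rightarrow> 'a pmf) \<Rightarrow> real \<Rightarrow> real" where
  "cdf_S_left m p t = measure_pmf.prob (unif_pmf m p) {x. surprisal m p x < t}"

definition level_size :: "nat \<Rightarrow> (nat \<Rightarrow> 'a pmf) \<Rightarrow> real \<Rightarrow> real" where
  "level_size m p t =
     real (key_count m p) * measure_pmf.prob (unif_pmf m p) {x. surprisal m p x = t}"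

definition level_prob :: "nat \<Rightarrow> (nat \<Rightarrow> 'a pmf) \<Rightarrow> real \<Rightarrow> real" where
  "level_prob m p t = measure_pmf.prob (key_pmf m p) {x. surprisal m p x = t}"

definition level_ranks :: "nat \<Rightarrow> (nat \<Rightarrow> 'a pmf) \<Rightarrow> real \<Rightarrow> nat set" where
  "level_ranks m p t =
     {r. real (key_count m p) * cdf_S_left m p t + 1 \<le> real r \<and>
         real r \<le> real (key_count m p) * cdf_S m p t}"

definition level_avg :: "nat \<Rightarrow> (nat \<Rightarrow> 'a pmf) \<Rightarrow> real \<Rightarrow> real \<Rightarrow> real" where
  "level_avg m p \<rho> t = (1 / level_size m p t) * (\<Sum>r\<in>level_ranks m p t. real r powr \<rho>)"

text \<open>
  The level sum and the ratio \<open>s\<close> take the level averages \<open>Av \<rho> t\<close> as an argument, so that they can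
  be formed both with the true averages and with numerical approximations of them.
\<close>

definition level_log_moment ::
    "nat \<Rightarrow> (nat \<Rightarrow> 'a pmf) \<Rightarrow> (real \<Rightarrow> real \<Rightarrow> real) \<Rightarrow> real \<Rightarrow> real" where
  "level_log_moment m p Av \<rho> =
     \<rho> * ln (real (key_count m p)) +
     ln (\<Sum>t\<in>levels m p. level_prob m p t * (Av \<rho> t / real (key_count m p) powr \<rho>))"

definition level_ratio :: "nat \<Rightarrow> (nat \<Rightarrow> 'a pmf) \<Rightarrow> (real \<Rightarrow> real \<Rightarrow> real) \<Rightarrow> real" where
  "level_ratio m p Av = level_log_moment m p Av 1 / level_log_moment m p Av (1/2)"

definition grid :: "real \<Rightarrow> real set" where
  "grid h = range (\<lambda>k::int. h * of_int k)"

definition commensurate_source :: "nat \<Rightarrow> (nat \<Rightarrow> 'a pmf) \<Rightarrow> real \<Rightarrow> bool" where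
  "commensurate_source m p h \<longleftrightarrow>
     (\<forall>i<m. finite (set_pmf (p i))) \<and> key_count m p \<ge> 2 \<and> h > 0 \<and>
     (\<forall>i<m. \<forall>a\<in>set_pmf (p i). letter_surprisal (p i) a \<in> grid h)"

definition input_size :: "nat \<Rightarrow> (nat \<Rightarrow> 'a pmf) \<Rightarrow> nat" where
  "input_size m p = (\<Sum>i<m. card (set_pmf (p i)))"

definition surprisal_range :: "nat \<Rightarrow> (nat \<Rightarrow> 'a pmf) \<Rightarrow> real" where
  "surprisal_range m p =
     (\<Sum>i<m. Max (letter_surprisal (p i) ` set_pmf (p i)) -
            Min (letter_surprisal (p i) ` set_pmf (p i)))"


section \<open>The unit-cost machine\<close>

text \<open>
  Running time refers to programs of a random access machine with two kinds of memory cells: words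
  (natural numbers, used for counting and addressing) and real numbers.  Every memory access, every
  arithmetic operation and every test costs one unit, plus one unit per executed statement.

  The instruction set is kept small so that unit cost cannot be exploited.  Words are only added,
  subtracted and compared; a real number is never rounded to a word, so several numbers cannot be
  packed into one and unpacked at unit cost; and the only real constants are natural numbers.  Besides
  field operations there are just the two functions \<open>sqrt\<close> and \<open>ln\<close>, which occur in \<open>s\<close> itself.

  Scalars are arrays that are used at index 0 only.
\<close>

datatype iexp =
    ICon nat
  | IGet string iexp
  | IAdd iexp iexp
  | ISub iexp iexp

datatype rexp =
    ROf iexp
  | RGet string iexp
  | RAdd rexp rexp
  | RSub rexp rexp
  | RMul rexp rexp
  | RDiv rexp rexp
  | RSqrt rexp
  | RLn rexp

datatype bexp =
    ILess iexp iexp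
  | RLess rexp rexp
  | BNot bexp
  | BAnd bexp bexp

datatype com =
    Skip
  | ISet string iexp iexp
  | RSet string iexp rexp
  | Seq com com
  | Cond bexp com com
  | While bexp com

record store =
  words :: "string \<Rightarrow> nat \<Rightarrow> nat"
  reals :: "string \<Rightarrow> nat \<Rightarrow> real"

fun ival :: "iexp \<Rightarrow> store \<Rightarrow> nat" where
  "ival (ICon n) s = n"
| "ival (IGet x e) s = words s x (ival e s)"
| "ival (IAdd e1 e2) s = ival e1 s + ival e2 s"
| "ival (ISub e1 e2) s = ival e1 s - ival e2 s"

fun icost :: "iexp \<Rightarrow> nat" where
  "icost (ICon n) = 1"
| "icost (IGet x e) = 1 + icost e"
| "icost (IAdd e1 e2) = 1 + icost e1 + icost e2"
| "icost (ISub e1 e2) = 1 + icost e1 + icost e2"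

fun rval :: "rexp \<Rightarrow> store \<Rightarrow> real" where
  "rval (ROf e) s = real (ival e s)"
| "rval (RGet x e) s = reals s x (ival e s)"
| "rval (RAdd e1 e2) s = rval e1 s + rval e2 s"
| "rval (RSub e1 e2) s = rval e1 s - rval e2 s"
| "rval (RMul e1 e2) s = rval e1 s * rval e2 s"
| "rval (RDiv e1 e2) s = rval e1 s / rval e2 s"
| "rval (RSqrt e) s = sqrt (rval e s)"
| "rval (RLn e) s = ln (rval e s)"

fun rcost :: "rexp \<Rightarrow> nat" where
  "rcost (ROf e) = 1 + icost e"
| "rcost (RGet x e) = 1 + icost e"
| "rcost (RAdd e1 e2) = 1 + rcost e1 + rcost e2"
| "rcost (RSub e1 e2) = 1 + rcost e1 + rcost e2"
| "rcost (RMul e1 e2) = 1 + rcost e1 + rcost e2"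
| "rcost (RDiv e1 e2) = 1 + rcost e1 + rcost e2"
| "rcost (RSqrt e) = 1 + rcost e"
| "rcost (RLn e) = 1 + rcost e"

fun bval :: "bexp \<Rightarrow> store \<Rightarrow> bool" where
  "bval (ILess e1 e2) s \<longleftrightarrow> ival e1 s < ival e2 s"
| "bval (RLess e1 e2) s \<longleftrightarrow> rval e1 s < rval e2 s"
| "bval (BNot b) s \<longleftrightarrow> \<not> bval b s"
| "bval (BAnd b1 b2) s \<longleftrightarrow> bval b1 s \<and> bval b2 s"

fun bcost :: "bexp \<Rightarrow> nat" where
  "bcost (ILess e1 e2) = 1 + icost e1 + icost e2"
| "bcost (RLess e1 e2) = 1 + rcost e1 + rcost e2"
| "bcost (BNot b) = 1 + bcost b"
| "bcost (BAnd b1 b2) = 1 + bcost b1 + bcost b2"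

definition set_word :: "string \<Rightarrow> nat \<Rightarrow> nat \<Rightarrow> store \<Rightarrow> store" where
  "set_word x i v s = s\<lparr>words := (words s)(x := (words s x)(i := v))\<rparr>"

definition set_real :: "string \<Rightarrow> nat \<Rightarrow> real \<Rightarrow> store \<Rightarrow> store" where
  "set_real x i v s = s\<lparr>reals := (reals s)(x := (reals s x)(i := v))\<rparr>"

text \<open>\<open>exec c s n s'\<close>: started in \<open>s\<close>, the program \<open>c\<close> halts in \<open>s'\<close> after exactly \<open>n\<close> cost units.\<close>

inductive exec :: "com \<Rightarrow> store \<Rightarrow> nat \<Rightarrow> store \<Rightarrow> bool" where
  exec_Skip: "exec Skip s 1 s"
| exec_ISet: "exec (ISet x e1 e2) s (1 + icost e1 + icost e2) (set_word x (ival e1 s) (ival e2 s) s)"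
| exec_RSet: "exec (RSet x e1 e2) s (1 + icost e1 + rcost e2) (set_real x (ival e1 s) (rval e2 s) s)"
| exec_Seq: "exec c1 s n1 s1 \<Longrightarrow> exec c2 s1 n2 s2 \<Longrightarrow> exec (Seq c1 c2) s (1 + n1 + n2) s2"
| exec_Cond_True: "bval b s \<Longrightarrow> exec c1 s n s1 \<Longrightarrow> exec (Cond b c1 c2) s (1 + bcost b + n) s1"
| exec_Cond_False: "\<not> bval b s \<Longrightarrow> exec c2 s n s1 \<Longrightarrow> exec (Cond b c1 c2) s (1 + bcost b + n) s1"
| exec_While_False: "\<not> bval b s \<Longrightarrow> exec (While b c) s (1 + bcost b) s"
| exec_While_True: "bval b s \<Longrightarrow> exec c s n1 s1 \<Longrightarrow> exec (While b c) s1 n2 s2 \<Longrightarrow>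
    exec (While b c) s (1 + bcost b + n1 + n2) s2"

text \<open>The result of a program is the real scalar \<open>out\<close>.\<close>

definition outputs :: "com \<Rightarrow> store \<Rightarrow> nat \<Rightarrow> real \<Rightarrow> bool" where
  "outputs c s n v \<longleftrightarrow> (\<exists>s'. exec c s n s' \<and> reals s' ''out'' 0 = v)"


section \<open>The computational problem\<close>

text \<open>
  The alphabets are presented by listing the letters in an arbitrary order \<open>xs i\<close>.  The input
  consists of \<open>m\<close>, the alphabet sizes, the concatenated probability tables and the grid step \<open>h\<close>; in
  particular the integers \<open>s\<^sub>i(a) / h\<close> are not given.  All other cells are zero.
\<close>

definition enumerates :: "nat \<Rightarrow> (nat \<Rightarrow> 'a pmf) \<Rightarrow> (nat \<Rightarrow> 'a list) \<Rightarrow> bool" where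
  "enumerates m p xs \<longleftrightarrow> (\<forall>i<m. distinct (xs i) \<and> set (xs i) = set_pmf (p i))"

definition prob_table :: "nat \<Rightarrow> (nat \<Rightarrow> 'a pmf) \<Rightarrow> (nat \<Rightarrow> 'a list) \<Rightarrow> real list" where
  "prob_table m p xs = concat (map (\<lambda>i. map (pmf (p i)) (xs i)) [0..<m])"

definition source_input :: "nat \<Rightarrow> (nat \<Rightarrow> 'a pmf) \<Rightarrow> real \<Rightarrow> (nat \<Rightarrow> 'a list) \<Rightarrow> store" where
  "source_input m p h xs =
     \<lparr>words = (\<lambda>x j. if x = ''m'' \<and> j = 0 then m
                     else if x = ''size'' \<and> j < m then length (xs j)
                     else 0),
      reals = (\<lambda>x j. if x = ''h'' \<and> j = 0 then h
                     else if x = ''p'' \<and> j < length (prob_table m p xs) then prob_table m p xs ! j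
                     else 0)\<rparr>"

definition level_input :: "real \<Rightarrow> real \<Rightarrow> real \<Rightarrow> store" where
  "level_input N u v =
     \<lparr>words = (\<lambda>x j. 0),
      reals = (\<lambda>x j. if x = ''N'' \<and> j = 0 then N
                     else if x = ''lo'' \<and> j = 0 then u
                     else if x = ''hi'' \<and> j = 0 then v
                     else 0)\<rparr>"

text \<open>
  \<open>E N u v\<close> approximates the average of \<open>r\<^sup>\<rho>\<close> over the ranks \<open>a + 1, \<dots>, b\<close> with relative precision
  \<open>\<delta>\<close>, where \<open>u = a / N\<close> and \<open>v = b / N\<close> are the values of the distribution function below and at the
  level, and a program computes \<open>E N u v\<close> from \<open>N\<close>, \<open>u\<close>, \<open>v\<close> within a constant number of steps.
\<close>

definition level_evaluator :: "real \<Rightarrow> real \<Rightarrow> (real \<Rightarrow> real \<Rightarrow> real \<Rightarrow> real) \<Rightarrow> bool" where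
  "level_evaluator \<delta> \<rho> E \<longleftrightarrow>
     (\<forall>N a b :: nat. a < b \<and> b \<le> N \<longrightarrow>
        (let av = (\<Sum>r=a+1..b. real r powr \<rho>) / (real b - real a)
         in \<bar>E (real N) (real a / real N) (real b / real N) - av\<bar> \<le> \<delta> * av)) \<and>
     (\<exists>c (C::nat). \<forall>N a b :: nat. a < b \<and> b \<le> N \<longrightarrow>
        (\<exists>n\<le>C. outputs c (level_input (real N) (real a / real N) (real b / real N)) n
                 (E (real N) (real a / real N) (real b / real N))))"

text \<open>
  \<open>prog\<close> solves every commensurate source in the class \<open>Q\<close> in time soft-O of \<open>X\<close>.  Its output is the
  ratio of the two level sums, where the only approximation is that each level average is replaced
  by the value of \<open>E\<close>.  The polylogarithmic factor is \<open>(1 + ln (1 + X))\<^sup>k\<close>, which is at least 1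
  also for \<open>X < 1\<close>.
\<close>

definition solves_in_soft_O ::
    "com \<Rightarrow> (real \<Rightarrow> real \<Rightarrow> real \<Rightarrow> real \<Rightarrow> real) \<Rightarrow>
     (nat \<Rightarrow> (nat \<Rightarrow> 'a pmf) \<Rightarrow> real \<Rightarrow> bool) \<Rightarrow> (nat \<Rightarrow> (nat \<Rightarrow> 'a pmf) \<Rightarrow> real \<Rightarrow> real) \<Rightarrow> bool" where
  "solves_in_soft_O prog E Q X \<longleftrightarrow>
     (\<exists>(C::real) (k::nat). \<forall>m p h xs.
        commensurate_source m p h \<and> enumerates m p xs \<and> Q m p h \<longrightarrow>
        (\<exists>n. outputs prog (source_input m p h xs) n
               (level_ratio m p
                  (\<lambda>\<rho> t. E \<rho> (real (key_count m p)) (cdf_S_left m p t) (cdf_S m p t))) \<and>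
             real n \<le> C * X m p h * (1 + ln (1 + X m p h)) ^ k))"

end

theory Submission
  imports Defs
begin

text \<open>
  On every level all keys are equally likely and an optimal order assigns to them the ranks in \<open>J\<^sub>t\<close>,
  which gives the level sum; the bounds on \<open>\<A>\<^sub>\<rho>(t)\<close> compare the sum of \<open>r\<^sup>\<rho>\<close> with a telescoping sum of
  \<open>r\<^sup>\<rho>\<^sup>+\<^sup>1\<close>.

  For the algorithm, let \<open>k\<^sub>i(a) = (s\<^sub>i(a) - min s\<^sub>i) / h\<close>.  The coefficients of
  \<open>\<Prod>\<^sub>i \<Sum>\<^sub>a X\<^bsup>k\<^sub>i(a)\<^esup>\<close> count the keys on each level, and those of \<open>\<Prod>\<^sub>i \<Sum>\<^sub>a p\<^sub>i(a) X\<^bsup>k\<^sub>i(a)\<^esup>\<close> are the level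
  probabilities; the second product is needed because the machine has no exponential function.  Both
  products have degree \<open>R / h\<close> and are formed by merging the factors pairwise with an exact fast Fourier
  transform: a chain of square roots of unity is available through \<open>sqrt\<close>, and the transform is only
  used through the fact that each step splits the residue modulo \<open>X\<^sup>2\<^sup>L - w\<^sup>2\<close> into those modulo
  \<open>X\<^sup>L - w\<close> and \<open>X\<^sup>L + w\<close>, which is invertible.

  For extensive range, \<open>h\<close> is at most the logarithm of the input size, so that replacing
  \<open>m\<close> by \<open>m / h\<close> costs a logarithmic factor only.
\<close>

section \<open>Reasoning about programs\<close>

text \<open>The small instruction set shapes the construction. Reals are never rounded, so each
  exponent, found exactly as a difference of logarithms divided by \<open>h\<close>, must be turned
  into an index by reading off its binary digits. Words are only added and subtracted, so powers of
  two, residues and table offsets are carried along in counters and tables. The number of keys may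
  be exponential in \<open>m\<close>, but it enters only as a real. Two logarithms appear in the
  time: one from the transform length, one from the number of passes over the queue. The total block
  length \<open>D + m\<close> never grows during merging, because a block is one longer than its
  degree bound. A level average must be found in time independent of the length of the level. For
  \<rho> = 1 it is an arithmetic mean. For \<rho> = 1/2 a number of leading terms depending only on
  the precision \<delta> is summed and an integral replaces the rest; the error is at most sqrt b,
  while the sum over the ranks a+1, ..., b is at least 2/3 (b - a) sqrt b. One program thus serves
  all sources once \<delta> is fixed.\<close>

abbreviation wv :: "string \<Rightarrow> iexp" where "wv x \<equiv> IGet x (ICon 0)"
abbreviation rv :: "string \<Rightarrow> rexp" where "rv x \<equiv> RGet x (ICon 0)"
abbreviation setw :: "string \<Rightarrow> iexp \<Rightarrow> com" where "setw x e \<equiv> ISet x (ICon 0) e"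
abbreviation setr :: "string \<Rightarrow> rexp \<Rightarrow> com" where "setr x e \<equiv> RSet x (ICon 0) e"
notation Seq (infixr ";;" 60)

lemma words_set_word [simp]: "words (set_word x i v s) = (words s)(x := (words s x)(i := v))"
  and reals_set_word [simp]: "reals (set_word x i v s) = reals s"
  and words_set_real [simp]: "words (set_real x i a s) = words s"
  and reals_set_real [simp]: "reals (set_real x i a s) = (reals s)(x := (reals s x)(i := a))"
  by (simp_all add: set_word_def set_real_def)

text \<open>Halting is part of the judgement, so one derivation yields termination, the result and
  the time bound together. The bound is an upper bound, which lets branches and loops be estimated
  instead of counted exactly.\<close>

definition run :: "com \<Rightarrow> store \<Rightarrow> nat \<Rightarrow> (store \<Rightarrow> bool) \<Rightarrow> bool" where
  "run c s B Q \<longleftrightarrow> (\<exists>n s'. exec c s n s' \<and> n \<le> B \<and> Q s')"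

lemma run_mono:
  assumes "run c s B Q" "B \<le> B'" "\<And>s'. Q s' \<Longrightarrow> Q' s'"
  shows "run c s B' Q'"
  using assms unfolding run_def by (meson le_trans)

fun word_names :: "com \<Rightarrow> string set" where
  "word_names Skip = {}"
| "word_names (ISet x _ _) = {x}"
| "word_names (RSet _ _ _) = {}"
| "word_names (Seq c1 c2) = word_names c1 \<union> word_names c2"
| "word_names (Cond _ c1 c2) = word_names c1 \<union> word_names c2"
| "word_names (While _ c) = word_names c"

fun real_names :: "com \<Rightarrow> string set" where
  "real_names Skip = {}"
| "real_names (ISet _ _ _) = {}"
| "real_names (RSet x _ _) = {x}"
| "real_names (Seq c1 c2) = real_names c1 \<union> real_names c2"
| "real_names (Cond _ c1 c2) = real_names c1 \<union> real_names c2"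
| "real_names (While _ c) = real_names c"

lemma exec_words_frame: "exec c s n s' \<Longrightarrow> x \<notin> word_names c \<Longrightarrow> words s' x = words s x"
  by (induction rule: exec.induct) auto

lemma exec_reals_frame: "exec c s n s' \<Longrightarrow> x \<notin> real_names c \<Longrightarrow> reals s' x = reals s x"
  by (induction rule: exec.induct) auto

text \<open>A purely syntactic frame condition: an array that is never assigned keeps its contents.
  Loop invariants then mention only what changes, and the rest is recovered from the names occurring
  in the body.\<close>

definition frame :: "com \<Rightarrow> store \<Rightarrow> store \<Rightarrow> bool" where
  "frame c s s' \<longleftrightarrow> (\<forall>x. x \<notin> word_names c \<longrightarrow> words s' x = words s x) \<and>
                   (\<forall>x. x \<notin> real_names c \<longrightarrow> reals s' x = reals s x)"

lemma frame_words: "frame c s s' \<Longrightarrow> x \<notin> word_names c \<Longrightarrow> words s' x = words s x"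
  and frame_reals: "frame c s s' \<Longrightarrow> x \<notin> real_names c \<Longrightarrow> reals s' x = reals s x"
  by (auto simp: frame_def)

lemma run_frame:
  assumes "run c s B Q"
  shows "run c s B (\<lambda>s'. Q s' \<and> frame c s s')"
  using assms exec_words_frame exec_reals_frame unfolding run_def frame_def by blast

lemma run_weaken:
  assumes "run c s B Q" "B \<le> B'" "\<And>s'. Q s' \<Longrightarrow> frame c s s' \<Longrightarrow> Q' s'"
  shows "run c s B' Q'"
  using run_mono[OF run_frame[OF assms(1)] assms(2)] assms(3) by blast

section \<open>Straight-line programs as functions on stores\<close>

fun loopfree :: "com \<Rightarrow> bool" where
  "loopfree (Seq c1 c2) \<longleftrightarrow> loopfree c1 \<and> loopfree c2"
| "loopfree (Cond _ c1 c2) \<longleftrightarrow> loopfree c1 \<and> loopfree c2"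
| "loopfree (While _ _) \<longleftrightarrow> False"
| "loopfree _ \<longleftrightarrow> True"

fun effect :: "com \<Rightarrow> store \<Rightarrow> store" where
  "effect (Seq c1 c2) s = effect c2 (effect c1 s)"
| "effect (Cond b c1 c2) s = (if bval b s then effect c1 s else effect c2 s)"
| "effect (ISet x e1 e2) s = set_word x (ival e1 s) (ival e2 s) s"
| "effect (RSet x e1 e2) s = set_real x (ival e1 s) (rval e2 s) s"
| "effect _ s = s"

fun cost :: "com \<Rightarrow> nat" where
  "cost (Seq c1 c2) = 1 + cost c1 + cost c2"
| "cost (Cond b c1 c2) = 1 + bcost b + max (cost c1) (cost c2)"
| "cost (ISet x e1 e2) = 1 + icost e1 + icost e2"
| "cost (RSet x e1 e2) = 1 + icost e1 + rcost e2"
| "cost _ = 1"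

lemma exec_loopfree: "loopfree c \<Longrightarrow> \<exists>n. exec c s n (effect c s) \<and> n \<le> cost c"
proof (induction c arbitrary: s)
  case (Seq c1 c2)
  then obtain n1 n2 where "exec c1 s n1 (effect c1 s)" "n1 \<le> cost c1"
    "exec c2 (effect c1 s) n2 (effect (c1 ;; c2) s)" "n2 \<le> cost c2"
    by fastforce
  then show ?case
    using exec_Seq by (intro exI[of _ "1 + n1 + n2"]) fastforce
next
  case (Cond b c1 c2)
  show ?case
  proof (cases "bval b s")
    case True
    obtain n where "exec c1 s n (effect c1 s)" "n \<le> cost c1" using Cond by fastforce
    with True show ?thesis
      using exec_Cond_True by (intro exI[of _ "1 + bcost b + n"]) fastforce
  next
    case False
    obtain n where "exec c2 s n (effect c2 s)" "n \<le> cost c2" using Cond by fastforce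
    with False show ?thesis
      using exec_Cond_False by (intro exI[of _ "1 + bcost b + n"]) fastforce
  qed
next
  case Skip
  show ?case using exec_Skip[of s] by auto
next
  case (ISet x e1 e2)
  show ?case using exec_ISet[of x e1 e2 s] by auto
next
  case (RSet x e1 e2)
  show ?case using exec_RSet[of x e1 e2 s] by auto
qed auto

lemma run_loopfree:
  assumes "loopfree c" "cost c \<le> B" "Q (effect c s)"
  shows "run c s B Q"
  using exec_loopfree[OF assms(1), of s] assms(2,3) unfolding run_def by (meson le_trans)

section \<open>Sequential composition and loops\<close>

lemma run_Seq:
  assumes "run c1 s B1 (\<lambda>s'. run c2 s' B2 Q)"
  shows "run (c1 ;; c2) s (1 + B1 + B2) Q"
proof -
  obtain n1 s1 n2 s2 where *: "exec c1 s n1 s1" "n1 \<le> B1" "exec c2 s1 n2 s2" "n2 \<le> B2" "Q s2"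
    using assms unfolding run_def by blast
  then show ?thesis unfolding run_def
    by (intro exI[of _ "1 + n1 + n2"] exI[of _ s2] conjI exec.intros) auto
qed

lemma run_loopfree_Seq:
  assumes "loopfree c1" "run c2 (effect c1 s) B Q" "1 + cost c1 + B \<le> B'"
  shows "run (c1 ;; c2) s B' Q"
  by (rule run_mono[OF run_Seq[OF run_loopfree[where Q = "\<lambda>s'. run c2 s' B Q",
        OF assms(1) order_refl assms(2)]] assms(3)])

lemma run_then:
  assumes "run c1 s B1 P" "\<And>s'. P s' \<Longrightarrow> frame c1 s s' \<Longrightarrow> run c2 s' B2 Q" "1 + B1 + B2 \<le> B"
  shows "run (c1 ;; c2) s B Q"
  by (rule run_mono[OF run_Seq[OF run_weaken[OF assms(1) order_refl assms(2)]] assms(3)])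

lemma run_While_end:
  assumes "\<not> bval b s" "1 + bcost b \<le> B" "Q s"
  shows "run (While b c) s B Q"
  using assms unfolding run_def by (blast intro: exec_While_False)

lemma run_While_step:
  assumes "bval b s" "run c s B1 P" "\<And>s'. P s' \<Longrightarrow> frame c s s' \<Longrightarrow> run (While b c) s' B2 Q"
    and "1 + bcost b + B1 + B2 \<le> B"
  shows "run (While b c) s B Q"
proof -
  obtain n1 s1 where 1: "exec c s n1 s1" "n1 \<le> B1" "P s1" "frame c s s1"
    using run_frame[OF assms(2)] unfolding run_def by blast
  then obtain n2 s2 where 2: "exec (While b c) s1 n2 s2" "n2 \<le> B2" "Q s2"
    using assms(3) unfolding run_def by blast
  show ?thesis unfolding run_def
    by (intro exI[of _ "1 + bcost b + n1 + n2"] exI[of _ s2] conjI exec_While_True[OF assms(1) 1(1) 2(1)])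
       (use 1 2 assms(4) in auto)
qed

lemma run_While_count:
  assumes "P 0 s"
    and "\<And>i s'. i < k \<Longrightarrow> P i s' \<Longrightarrow> frame c s s' \<Longrightarrow> bval b s' \<and> run c s' (B i) (P (Suc i))"
    and "\<And>s'. P k s' \<Longrightarrow> frame c s s' \<Longrightarrow> \<not> bval b s'"
    and "(\<Sum>i<k. B i + (1 + bcost b)) + (1 + bcost b) \<le> B'"
  shows "run (While b c) s B' (P k)"
proof -
  \<comment> \<open>Induction on the number \<open>j\<close> of iterations still to be made, so that
    the hypothesis speaks of the remainder of the loop; the invariant index is therefore
    \<open>k - j\<close>.\<close>
  have "run (While b c) s' ((\<Sum>i=k-j..<k. B i + (1 + bcost b)) + (1 + bcost b)) (P k)"
    if "j \<le> k" "P (k - j) s'" "frame c s s'" for j s'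
    using that
  proof (induction j arbitrary: s')
    case 0
    then show ?case using assms(3) by (intro run_While_end) auto
  next
    case (Suc j)
    have lt: "k - Suc j < k" and eq: "Suc (k - Suc j) = k - j" using Suc.prems by auto
    from assms(2)[OF lt Suc.prems(2,3)]
    have b: "bval b s'" and r: "run c s' (B (k - Suc j)) (P (k - j))" by (auto simp: eq)
    have sum: "(\<Sum>i=k-Suc j..<k. B i + (1 + bcost b)) =
        B (k - Suc j) + (1 + bcost b) + (\<Sum>i=k-j..<k. B i + (1 + bcost b))"
      using sum.atLeast_Suc_lessThan[OF lt, of "\<lambda>i. B i + (1 + bcost b)"] by (simp add: eq)
    show ?case
      by (rule run_While_step[OF b r Suc.IH])
         (use Suc.prems sum in \<open>auto simp: frame_def\<close>)
  qed
  from this[of k s] assms(1,4) show ?thesis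
    by (auto simp: frame_def atLeast0LessThan intro: run_mono)
qed

text \<open>The bound \<open>e\<close> is evaluated anew at every test. A proof about such a loop
  therefore has to show that the body leaves the value of \<open>e\<close> unchanged, and that it
  does not assign the counter.\<close>

definition For :: "string \<Rightarrow> iexp \<Rightarrow> com \<Rightarrow> com" where
  "For x e c = (setw x (ICon 0) ;; While (ILess (wv x) e) (c ;; setw x (IAdd (wv x) (ICon 1))))"

lemma word_names_For [simp]: "word_names (For x e c) = insert x (word_names c)"
  and real_names_For [simp]: "real_names (For x e c) = real_names c"
  by (auto simp: For_def)

text \<open>The invariant \<open>P i\<close> holds at the head of the loop when the counter has the value \<open>i\<close>.\<close>

lemma run_For:
  assumes init: "P 0 (set_word x 0 0 s)"
    and x: "x \<notin> word_names c"
    and step: "\<And>i s'. i < k \<Longrightarrow> P i s' \<Longrightarrow> words s' x 0 = i \<Longrightarrow> frame (For x e c) s s' \<Longrightarrow>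
        run c s' (B i) (\<lambda>s''. P (Suc i) (set_word x 0 (Suc i) s''))"
    and e: "\<And>i s'. i \<le> k \<Longrightarrow> P i s' \<Longrightarrow> frame (For x e c) s s' \<Longrightarrow> ival e s' = k"
    and B: "(\<Sum>i<k. B i + (11 + icost e)) + (11 + icost e) \<le> B'"
  shows "run (For x e c) s B' (P k)"
proof -
  let ?c = "c ;; setw x (IAdd (wv x) (ICon 1))"
  have fr: "frame (For x e c) s s'" if "frame ?c (set_word x 0 0 s) s'" for s'
    using that by (auto simp: frame_def)
  have 1: "run (While (ILess (wv x) e) ?c) (set_word x 0 0 s)
     ((\<Sum>i<k. (B i + 7) + (1 + bcost (ILess (wv x) e))) + (1 + bcost (ILess (wv x) e)))
     (\<lambda>s'. P k s' \<and> words s' x 0 = k)"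
  proof (rule run_While_count[where P = "\<lambda>i s'. P i s' \<and> words s' x 0 = i" and k = k and B = "\<lambda>i. B i + 7"], goal_cases)
    case 1
    then show ?case using init by simp
  next
    case (2 i s')
    have P: "P i s'" "words s' x 0 = i" using 2 by auto
    have "run ?c s' (B i + 7) (\<lambda>s'. P (Suc i) s' \<and> words s' x 0 = Suc i)"
    proof (rule run_then[OF step[OF 2(1) P fr[OF 2(3)]]])
      fix s2 assume s2: "P (Suc i) (set_word x 0 (Suc i) s2)" "frame c s' s2"
      then have "words s2 x 0 = i" using x P by (simp add: frame_words)
      then show "run (setw x (IAdd (wv x) (ICon 1))) s2 6 (\<lambda>s'. P (Suc i) s' \<and> words s' x 0 = Suc i)"
        using s2 by (intro run_loopfree) simp_all
    qed simp
    moreover have "bval (ILess (wv x) e) s'"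
      using e[OF _ P(1) fr[OF 2(3)]] P 2 by simp
    ultimately show ?case by blast
  next
    case (3 s')
    then show ?case using e[of k s'] fr by auto
  qed simp
  have le: "1 + cost (setw x (ICon 0)) + ((\<Sum>i<k. (B i + 7) + (1 + bcost (ILess (wv x) e))) + (1 + bcost (ILess (wv x) e))) \<le> B'"
    using B by (simp add: algebra_simps)
  show ?thesis unfolding For_def
    by (rule run_loopfree_Seq[OF _ _ le]) (use run_mono[OF 1 order_refl] in auto)
qed

section \<open>Fast Fourier transform over a heap of square roots\<close>

text \<open>Binary heap indexing: the children \<open>2 * v\<close> and \<open>2 * v + 1\<close> of
  a node carry the two square roots of its entry. With 1 at the root, level d lists the 2^d-th roots
  of unity. Modulus one makes conjugation the inverse.\<close>

definition sqrt_heap :: "(nat \<Rightarrow> complex) \<Rightarrow> nat \<Rightarrow> bool" where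
  "sqrt_heap w M \<longleftrightarrow> (\<forall>v. 1 \<le> v \<and> v < M \<longrightarrow>
     (w (2 * v))\<^sup>2 = w v \<and> w (2 * v+1) = - w (2 * v) \<and> cmod (w (2 * v)) = 1)"

text \<open>A butterfly of constant geometry: with \<open>g\<close> half the length, every stage
  reads k and k + g and writes 2k and 2k + 1, so the addressing never changes and uses additions
  only. The low d bits of an index name the modulus, the remaining bits the coefficient of the
  residue, and the parity of \<open>i\<close> chooses between the two square roots.\<close>

definition fft_step :: "(nat \<Rightarrow> complex) \<Rightarrow> nat \<Rightarrow> nat \<Rightarrow> (nat \<Rightarrow> complex) \<Rightarrow> nat \<Rightarrow> complex" where
  "fft_step w g d A i =
     A (i div 2) + (-1)^i * (w (2 * (2^d + (i div 2) mod 2^d)) * A (i div 2 + g))"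

fun fft :: "(nat \<Rightarrow> complex) \<Rightarrow> nat \<Rightarrow> nat \<Rightarrow> (nat \<Rightarrow> complex) \<Rightarrow> nat \<Rightarrow> complex" where
  "fft w g 0 A = A"
| "fft w g (Suc d) A = fft_step w g d (fft w g d A)"

lemma sqrt_heap_square:
  assumes "sqrt_heap w M" "2 \<le> v" "v < 2 * M"
  shows "(w v)\<^sup>2 = w (v div 2)" "w v = (-1)^v * w (2 * (v div 2))" "cmod (w v) = 1"
proof -
  have v: "1 \<le> v div 2" "v div 2 < M" using assms by auto
  have "v = 2 * (v div 2) \<or> v = 2 * (v div 2) + 1" by arith
  then show "(w v)\<^sup>2 = w (v div 2)" "w v = (-1)^v * w (2 * (v div 2))" "cmod (w v) = 1"
    using assms(1) v unfolding sqrt_heap_def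
    by (metis norm_minus_cancel power2_minus,
        metis (no_types, opaque_lifting) dvd_triv_left even_plus_one_iff minus_one_power_iff mult_1 mult_minus1,
        metis norm_minus_cancel)
qed

lemma sum_lessThan_add:
  fixes f :: "nat \<Rightarrow> 'b::comm_monoid_add"
  shows "(\<Sum>k<a+b. f k) = (\<Sum>k<a. f k) + (\<Sum>k<b. f (k+a))"
  by (induction b) (simp_all add: add_ac)

text \<open>
  After \<open>d\<close> steps the array holds, interleaved, the residues of the polynomial modulo
  \<open>X\<^sup>L - w (2\<^sup>d + j)\<close> for \<open>j < 2\<^sup>d\<close>, where \<open>L = 2\<^sup>K\<^sup>-\<^sup>d\<close>.
\<close>

lemma fft_residues:
  assumes w: "sqrt_heap w (2^K)" and d: "d \<le> K" and g: "g = 2^K div 2" and j: "j < 2^d"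
    and x: "x ^ (2^(K-d)) = w (2^d + j)"
  shows "(\<Sum>k<2^(K-d). fft w g d A (k * 2^d + j) * x^k) = (\<Sum>k<2^K. A k * x^k)"
  using d j x
proof (induction d arbitrary: j)
  case 0
  then show ?case by simp
next
  case (Suc d)
  let ?L = "2^(K - Suc d) :: nat" and ?i = "j div 2"
  have L: "2^(K-d) = 2 * ?L"
    using Suc.prems(1) by (metis Suc_diff_Suc Suc_le_lessD power_Suc)
  have gL: "g = ?L * 2^d"
    using Suc.prems(1) unfolding g
    by (metis Suc_le_lessD L add.commute le_add_diff_inverse2 less_imp_le mult.assoc
        nonzero_mult_div_cancel_left power_add zero_neq_numeral)
  have i: "?i < 2^d" using Suc.prems(2) by auto
  have pw: "(2::nat)^Suc d + j < 2 * 2^K"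
  proof -
    have "(2::nat)^Suc d + j < 2 * 2^Suc d" using Suc.prems by simp
    also have "\<dots> \<le> 2 * 2^K" using Suc.prems(1) by (intro mult_left_mono power_increasing) auto
    finally show ?thesis .
  qed
  have v: "2 \<le> 2^Suc d + j" by (metis add_leE le_add1 le_trans power_Suc one_le_numeral one_le_power mult_le_mono2 mult.right_neutral)
  have h: "((2::nat)^Suc d + j) div 2 = 2^d + ?i" by simp
  note sq = sqrt_heap_square[OF w v pw, unfolded h]
  let ?c = "w (2^Suc d + j)"
  have "x ^ (2^(K-d)) = w (2^d + ?i)"
    using sq(1) Suc.prems(3) by (simp add: L power_mult mult.commute[of 2])
  from Suc.IH[OF _ i this] Suc.prems(1)
  have "(\<Sum>k<2^K. A k * x^k) = (\<Sum>k<?L + ?L. fft w g d A (k * 2^d + ?i) * x^k)"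
    by (simp add: L mult_2)
  also have "\<dots> = (\<Sum>k<?L. fft w g d A (k * 2^d + ?i) * x^k)
              + (\<Sum>k<?L. fft w g d A ((k + ?L) * 2^d + ?i) * x^(k + ?L))"
    by (rule sum_lessThan_add)
  \<comment> \<open>Since x^L is the twiddle factor \<open>?c\<close>, the upper half of the
    coefficients folds onto the lower half. The upper half sits exactly \<open>g\<close> cells
    further on, because \<open>g = ?L * 2^d\<close>.\<close>
  also have "\<dots> = (\<Sum>k<?L. (fft w g d A (k * 2^d + ?i) + ?c * fft w g d A (k * 2^d + ?i + g)) * x^k)"
    by (simp add: sum.distrib[symmetric] power_add Suc.prems(3) gL algebra_simps)
  also have "\<dots> = (\<Sum>k<?L. fft w g (Suc d) A (k * 2^Suc d + j) * x^k)"
  proof (intro sum.cong refl arg_cong2[of _ _ _ _ "(*)"])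
    fix k
    have 1: "(k * 2^Suc d + j) div 2 = k * 2^d + ?i"
      by simp
    have 2: "(k * 2^d + ?i) mod 2^d = ?i" using i by simp
    have 3: "(-1::complex)^(k * 2^Suc d + j) = (-1)^(2^Suc d + j)"
      by (simp add: minus_one_power_iff)
    show "fft w g d A (k * 2^d + ?i) + ?c * fft w g d A (k * 2^d + ?i + g)
        = fft w g (Suc d) A (k * 2^Suc d + j)"
      using sq(2) unfolding fft.simps fft_step_def 1 2 3 by (simp add: mult.assoc)
  qed
  finally show ?case by simp
qed

text \<open>After all \<open>K\<close> stages the moduli are linear, so each residue is the value at
  a root of unity.\<close>

lemma fft_eval:
  assumes "sqrt_heap w (2^K)" "g = 2^K div 2" "j < 2^K"
  shows "fft w g K A j = (\<Sum>k<2^K. A k * w (2^K + j)^k)"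
  using fft_residues[OF assms(1) order_refl assms(2,3), of "w (2^K + j)" A] by simp

text \<open>The entries are values of the polynomial, hence squaring them pointwise gives the
  transform of the square. The degree bound rules out wrap-around. Undoing the stages one by one
  then recovers the coefficients of \<open>Z * Z\<close>, with no separate inversion formula for the
  whole transform.\<close>

lemma fft_square:
  assumes w: "sqrt_heap w (2^K)" "g = 2^K div 2" "j < 2^K"
    and "degree (Z * Z) < 2^K"
  shows "(fft w g K (coeff Z) j)\<^sup>2 = fft w g K (coeff (Z * Z)) j"
proof -
  have *: "(\<Sum>k<2^K. coeff p k * x^k) = poly p x" if "degree p < 2^K" for p :: "complex poly" and x
  proof -
    have "(\<Sum>k<2^K. coeff p k * x^k) = (\<Sum>k\<le>degree p. coeff p k * x^k)"
      using that by (intro sum.mono_neutral_right) (auto simp: coeff_eq_0)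
    then show ?thesis by (simp add: poly_altdef)
  qed
  have "degree Z < 2^K"
    using assms(4) by (cases "Z = 0") (auto simp: degree_mult_eq)
  then show ?thesis
    by (simp only: fft_eval[OF w] * assms(4) poly_mult power2_eq_square)
qed

text \<open>Half the sum and half the difference of a pair undo the butterfly; the twiddle factor is
  divided out by multiplying with its conjugate.\<close>

lemma fft_step_inverse:
  assumes "i < g" "cmod (w (2 * (2^d + i mod 2^d))) = 1"
  shows "(fft_step w g d A (2*i) + fft_step w g d A (2*i+1)) / 2 = A i"
    and "(fft_step w g d A (2*i) - fft_step w g d A (2*i+1)) / 2 * cnj (w (2 * (2^d + i mod 2^d))) = A (i + g)"
proof -
  let ?w = "w (2 * (2^d + i mod 2^d))"
  have "?w * cnj ?w = 1"
    using assms(2) by (simp add: complex_norm_square[symmetric])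
  then show "(fft_step w g d A (2*i) - fft_step w g d A (2*i+1)) / 2 * cnj ?w = A (i + g)"
    by (simp add: fft_step_def)
  show "(fft_step w g d A (2*i) + fft_step w g d A (2*i+1)) / 2 = A i"
    by (simp add: fft_step_def)
qed

section \<open>The transform on the machine, with real and imaginary parts in separate
  arrays\<close>

definition cx :: "store \<Rightarrow> nat \<Rightarrow> complex" where
  "cx s i = Complex (reals s ''x'' i) (reals s ''y'' i)"

definition tw :: "store \<Rightarrow> nat \<Rightarrow> complex" where
  "tw s i = Complex (reals s ''u'' i) (reals s ''v'' i)"

text \<open>Keeps \<open>j\<close> equal to \<open>z mod 2^d\<close> by counting with reset, as
  words can be neither divided nor reduced.\<close>

definition next_j :: com where
  "next_j = Cond (ILess (IAdd (wv ''j'') (ICon 1)) (IGet ''e'' (wv ''d'')))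
     (setw ''j'' (IAdd (wv ''j'') (ICon 1))) (setw ''j'' (ICon 0))"

text \<open>The stages are out of place: the layer starting at \<open>B\<close> is read and the
  layer starting at \<open>B + n\<close> is written. A butterfly thus never destroys an entry that a
  later one reads, at the price of \<open>K + 1\<close> layers of length \<open>n\<close>.\<close>

definition fwd_body :: com where
  "fwd_body =
     (let t = IAdd (IGet ''e'' (wv ''d'')) (wv ''j''); w = IAdd t t;
          lo = IAdd (wv ''B'') (wv ''z''); hi = IAdd lo (wv ''g'');
          to = IAdd (IAdd (wv ''B'') (wv ''n'')) (IAdd (wv ''z'') (wv ''z''));
          to1 = IAdd to (ICon 1)
      in setr ''a'' (RSub (RMul (RGet ''u'' w) (RGet ''x'' hi)) (RMul (RGet ''v'' w) (RGet ''y'' hi))) ;;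
         setr ''b'' (RAdd (RMul (RGet ''u'' w) (RGet ''y'' hi)) (RMul (RGet ''v'' w) (RGet ''x'' hi))) ;;
         RSet ''x'' to (RAdd (RGet ''x'' lo) (rv ''a'')) ;;
         RSet ''y'' to (RAdd (RGet ''y'' lo) (rv ''b'')) ;;
         RSet ''x'' to1 (RSub (RGet ''x'' lo) (rv ''a'')) ;;
         RSet ''y'' to1 (RSub (RGet ''y'' lo) (rv ''b'')) ;;
         next_j)"

definition inv_body :: com where
  "inv_body =
     (let t = IAdd (IGet ''e'' (wv ''d'')) (wv ''j''); w = IAdd t t;
          lo = IAdd (wv ''B'') (wv ''z''); hi = IAdd lo (wv ''g'');
          fr = IAdd (IAdd (wv ''B'') (wv ''n'')) (IAdd (wv ''z'') (wv ''z''));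
          fr1 = IAdd fr (ICon 1); two = ROf (ICon 2)
      in setr ''a'' (RDiv (RSub (RGet ''x'' fr) (RGet ''x'' fr1)) two) ;;
         setr ''b'' (RDiv (RSub (RGet ''y'' fr) (RGet ''y'' fr1)) two) ;;
         RSet ''x'' lo (RDiv (RAdd (RGet ''x'' fr) (RGet ''x'' fr1)) two) ;;
         RSet ''y'' lo (RDiv (RAdd (RGet ''y'' fr) (RGet ''y'' fr1)) two) ;;
         RSet ''x'' hi (RAdd (RMul (rv ''a'') (RGet ''u'' w)) (RMul (rv ''b'') (RGet ''v'' w))) ;;
         RSet ''y'' hi (RSub (RMul (rv ''b'') (RGet ''u'' w)) (RMul (rv ''a'') (RGet ''v'' w))) ;;
         next_j)"

lemma loopfree_bodies [simp]: "loopfree next_j" "loopfree fwd_body" "loopfree inv_body"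
  and cost_bodies: "cost fwd_body \<le> 400" "cost inv_body \<le> 400"
  and word_names_bodies [simp]: "word_names next_j = {''j''}" "word_names fwd_body = {''j''}" "word_names inv_body = {''j''}"
  and real_names_bodies [simp]: "real_names next_j = {}" "real_names fwd_body = {''a'',''b'',''x'',''y''}"
    "real_names inv_body = {''a'',''b'',''x'',''y''}"
  by (auto simp: fwd_body_def inv_body_def next_j_def Let_def)

lemma effect_next_j:
  assumes "words s ''e'' (words s ''d'' 0) = e" "words s ''j'' 0 = z mod e" "e > 0"
  shows "effect next_j s = set_word ''j'' 0 (Suc z mod e) s"
proof -
  have "Suc (z mod e) < e \<or> Suc (z mod e) = e"
    using mod_less_divisor[OF assms(3), of z] by linarith
  then show ?thesis using assms by (elim disjE) (simp_all add: next_j_def mod_Suc)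
qed

lemma cx_set_word [simp]: "cx (set_word x i v s) = cx s"
  by (simp add: cx_def fun_eq_iff)

lemma cx_set_real [simp]:
  "cx (set_real ''y'' i b (set_real ''x'' i a s)) = (cx s)(i := Complex a b)"
  "z \<notin> {''x'', ''y''} \<Longrightarrow> cx (set_real z i a s) = cx s"
  by (auto simp: cx_def fun_eq_iff)

lemma fwd_body_effect:
  assumes "words s ''e'' (words s ''d'' 0) = e" "words s ''j'' 0 = z mod e" "e > 0"
    and "words s ''z'' 0 = z" "words s ''B'' 0 = B" "words s ''g'' 0 = g" "words s ''n'' 0 = n" "n > 0"
  shows "cx (effect fwd_body s) =
      (cx s)(B + n + (z + z) := cx s (B + z) + tw s (e + z mod e + (e + z mod e)) * cx s (B + z + g),
             B + n + (z + z) + 1 := cx s (B + z) - tw s (e + z mod e + (e + z mod e)) * cx s (B + z + g))"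
    and "words (effect fwd_body s) = words (set_word ''j'' 0 (Suc z mod e) s)"
  using assms
  by (simp_all add: fwd_body_def Let_def effect_next_j[where e = e and z = z],
      simp add: cx_def tw_def complex_mult complex_add complex_diff)

lemma inv_body_effect:
  assumes "words s ''e'' (words s ''d'' 0) = e" "words s ''j'' 0 = z mod e" "e > 0"
    and "words s ''z'' 0 = z" "words s ''B'' 0 = B" "words s ''g'' 0 = g" "words s ''n'' 0 = n" "n = g + g" "z < g"
  shows "cx (effect inv_body s) =
      (cx s)(B + z := (cx s (B + n + (z + z)) + cx s (B + n + (z + z) + 1)) / 2,
             B + z + g := (cx s (B + n + (z + z)) - cx s (B + n + (z + z) + 1)) / 2 * cnj (tw s (e + z mod e + (e + z mod e))))"
    and "words (effect inv_body s) = words (set_word ''j'' 0 (Suc z mod e) s)"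
proof -
  have half: "Complex a b / 2 = Complex (a / 2) (b / 2)" for a b by (simp add: complex_eq_iff)
  show "words (effect inv_body s) = words (set_word ''j'' 0 (Suc z mod e) s)"
    using assms by (simp add: inv_body_def Let_def effect_next_j[where e = e and z = z])
  show "cx (effect inv_body s) =
      (cx s)(B + z := (cx s (B + n + (z + z)) + cx s (B + n + (z + z) + 1)) / 2,
             B + z + g := (cx s (B + n + (z + z)) - cx s (B + n + (z + z) + 1)) / 2 * cnj (tw s (e + z mod e + (e + z mod e))))"
    using assms
    by (simp add: inv_body_def Let_def effect_next_j[where e = e and z = z],
        simp add: cx_def tw_def complex_mult complex_add complex_diff half complex_cnj,
        simp add: add_divide_distrib diff_divide_distrib)
qed

lemma tw_frame: "frame c s s' \<Longrightarrow> ''u'' \<notin> real_names c \<Longrightarrow> ''v'' \<notin> real_names c \<Longrightarrow> tw s' = tw s"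
  by (simp add: tw_def fun_eq_iff frame_reals)

lemma cx_frame: "frame c s s' \<Longrightarrow> ''x'' \<notin> real_names c \<Longrightarrow> ''y'' \<notin> real_names c \<Longrightarrow> cx s' = cx s"
  by (simp add: cx_def fun_eq_iff frame_reals)

lemma tw_set_word [simp]: "tw (set_word x i v s) = tw s"
  by (simp add: tw_def fun_eq_iff)

lemma fft_step_even_odd:
  "fft_step w g d A (i + i) = A i + w (2^d + i mod 2^d + (2^d + i mod 2^d)) * A (i + g)"
  "fft_step w g d A (Suc (i + i)) = A i - w (2^d + i mod 2^d + (2^d + i mod 2^d)) * A (i + g)"
  by (simp_all add: fft_step_def add_ac flip: mult_2)

lemma fwd_stage:
  assumes "words s ''d'' 0 = d" "words s ''e'' d = 2^d" "words s ''j'' 0 = 0" "words s ''B'' 0 = B"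
    and "words s ''g'' 0 = g" "words s ''n'' 0 = n" "n = g + g"
    and A: "\<forall>i<n. cx s (B + i) = A i"
  shows "run (For ''z'' (wv ''g'') fwd_body) s (500 * (g + 1))
     (\<lambda>s'. \<forall>i<n. cx s' (B + n + i) = fft_step (tw s) g d A i)"
proof (rule run_mono[where B = "500 * (g + 1)"])
  let ?P = "\<lambda>z s'. words s' ''j'' 0 = z mod 2^d \<and> (\<forall>i<n. cx s' (B + i) = A i) \<and>
     (\<forall>i<2*z. cx s' (B + n + i) = fft_step (tw s) g d A i)"
  show "run (For ''z'' (wv ''g'') fwd_body) s (500 * (g + 1)) (?P g)"
  proof (rule run_For[where P = ?P and k = g and B = "\<lambda>_. 400"])
    fix z s'
    assume z: "z < g" and P: "?P z s'" and zz: "words s' ''z'' 0 = z"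
      and fr: "frame (For ''z'' (wv ''g'') fwd_body) s s'"
    note f = frame_words[OF fr] frame_reals[OF fr]
    have w: "words s' ''d'' 0 = d" "words s' ''e'' (words s' ''d'' 0) = 2^d" "words s' ''B'' 0 = B"
       "words s' ''g'' 0 = g" "words s' ''n'' 0 = n" "tw s' = tw s"
      using assms tw_frame[OF fr] by (simp_all add: f)
    have n: "n > 0" using z assms(7) by simp
    have j: "words s' ''j'' 0 = z mod 2^d" using P by simp
    note eff = fwd_body_effect[OF w(2) j _ zz w(3-5) n, simplified]
    have zg: "z + g < n" "z < n" using z assms(7) by auto
    have A': "cx s' (B + z) = A z" "cx s' (B + z + g) = A (z + g)"
      using P zg by (auto simp: add.assoc)
    have "?P (Suc z) (set_word ''z'' 0 (Suc z) (effect fwd_body s'))"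
    proof (intro conjI allI impI)
      show "words (set_word ''z'' 0 (Suc z) (effect fwd_body s')) ''j'' 0 = Suc z mod 2^d"
        by (simp add: eff)
    next
      fix i assume "i < n"
      then show "cx (set_word ''z'' 0 (Suc z) (effect fwd_body s')) (B + i) = A i"
        using P by (simp add: eff)
    next
      fix i assume "i < 2 * Suc z"
      then have "i = 2*z \<or> i = Suc (2*z) \<or> i < 2*z" by arith
      then consider "i = 2*z" | "i = Suc (2*z)" | "i < 2*z" by blast
      then show "cx (set_word ''z'' 0 (Suc z) (effect fwd_body s')) (B + n + i) = fft_step (tw s) g d A i"
        using P A' by cases (simp_all add: eff fft_step_even_odd w(6) mult_2)
    qed
    then show "run fwd_body s' 400 (\<lambda>s''. ?P (Suc z) (set_word ''z'' 0 (Suc z) s''))"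
      using cost_bodies by (intro run_loopfree) simp_all
  next
    fix i s' assume "frame (For ''z'' (wv ''g'') fwd_body) s s'"
    from frame_words[OF this] show "ival (wv ''g'') s' = g" using assms by simp
  qed (use assms in auto)
qed (use assms(7) in auto)

text \<open>The upper layer may be the image under \<open>fft_step\<close> of any array
  \<open>A\<close>. This freedom is essential: the lower layers still contain transforms of
  \<open>Z\<close> from the forward pass, and they are overwritten by those of
  \<open>Z * Z\<close>.\<close>

lemma inv_stage:
  assumes "words s ''d'' 0 = d" "words s ''e'' d = 2^d" "words s ''j'' 0 = 0" "words s ''B'' 0 = B"
    and "words s ''g'' 0 = g" "words s ''n'' 0 = n" "n = g + g"
    and A: "\<forall>i<n. cx s (B + n + i) = fft_step (tw s) g d A i"
    and unit: "\<And>i. cmod (tw s (2 * (2^d + i mod 2^d))) = 1"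
  shows "run (For ''z'' (wv ''g'') inv_body) s (500 * (g + 1)) (\<lambda>s'. \<forall>i<n. cx s' (B + i) = A i)"
proof (rule run_mono[where B = "500 * (g + 1)"])
  let ?P = "\<lambda>z s'. words s' ''j'' 0 = z mod 2^d \<and> (\<forall>i<n. cx s' (B + n + i) = fft_step (tw s) g d A i) \<and>
     (\<forall>i<z. cx s' (B + i) = A i \<and> cx s' (B + i + g) = A (i + g))"
  show "run (For ''z'' (wv ''g'') inv_body) s (500 * (g + 1)) (?P g)"
  proof (rule run_For[where P = ?P and k = g and B = "\<lambda>_. 400"])
    fix z s'
    assume z: "z < g" and P: "?P z s'" and zz: "words s' ''z'' 0 = z"
      and fr: "frame (For ''z'' (wv ''g'') inv_body) s s'"
    note f = frame_words[OF fr] frame_reals[OF fr]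
    have w: "words s' ''d'' 0 = d" "words s' ''e'' (words s' ''d'' 0) = 2^d" "words s' ''B'' 0 = B"
       "words s' ''g'' 0 = g" "words s' ''n'' 0 = n" "tw s' = tw s"
      using assms tw_frame[OF fr] by (simp_all add: f)
    have j: "words s' ''j'' 0 = z mod 2^d" using P by simp
    note eff = inv_body_effect[OF w(2) j _ zz w(3-5) assms(7) z, simplified]
    have zn: "z + z < n" "Suc (z + z) < n" using z assms(7) by auto
    have A': "cx s' (B + n + (z + z)) = fft_step (tw s) g d A (2*z)"
       "cx s' (Suc (B + n + (z + z))) = fft_step (tw s) g d A (2*z+1)"
      using P[THEN conjunct2, THEN conjunct1, rule_format, OF zn(1)]
        P[THEN conjunct2, THEN conjunct1, rule_format, OF zn(2)] by (simp_all add: mult_2)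
    note inv = fft_step_inverse[where w = "tw s" and d = d and A = A, OF z unit[of z], unfolded mult_2]
    have "?P (Suc z) (set_word ''z'' 0 (Suc z) (effect inv_body s'))"
    proof (intro conjI allI impI)
      show "words (set_word ''z'' 0 (Suc z) (effect inv_body s')) ''j'' 0 = Suc z mod 2^d"
        by (simp add: eff)
    next
      fix i assume "i < n"
      then show "cx (set_word ''z'' 0 (Suc z) (effect inv_body s')) (B + n + i) = fft_step (tw s) g d A i"
        using P z assms(7) by (simp add: eff)
    next
      fix i assume i: "i < Suc z"
      then show "cx (set_word ''z'' 0 (Suc z) (effect inv_body s')) (B + i) = A i"
        using P A' inv z by (cases "i = z") (simp_all add: eff w(6) mult_2 fft_step_inverse)
      show "cx (set_word ''z'' 0 (Suc z) (effect inv_body s')) (B + i + g) = A (i + g)"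
        using P A' inv z i by (cases "i = z") (simp_all add: eff w(6) mult_2)
    qed
    then show "run inv_body s' 400 (\<lambda>s''. ?P (Suc z) (set_word ''z'' 0 (Suc z) s''))"
      using cost_bodies by (intro run_loopfree) simp_all
  next
    fix i s' assume "frame (For ''z'' (wv ''g'') inv_body) s s'"
    from frame_words[OF this] show "ival (wv ''g'') s' = g" using assms by simp
  qed (use assms in auto)
next
  fix s' assume P: "words s' ''j'' 0 = g mod 2^d \<and> (\<forall>i<n. cx s' (B + n + i) = fft_step (tw s) g d A i) \<and>
     (\<forall>i<g. cx s' (B + i) = A i \<and> cx s' (B + i + g) = A (i + g))"
  show "\<forall>i<n. cx s' (B + i) = A i"
  proof (intro allI impI)
    fix i assume i: "i < n"
    show "cx s' (B + i) = A i"
    proof (cases "i < g")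
      case False
      then have "i - g < g" "i = (i - g) + g" using i assms(7) by auto
      then show ?thesis using P by (metis add.assoc)
    qed (use P in auto)
  qed
qed auto

text \<open>The table \<open>e\<close> of powers of two grows by doubling as the stages advance. It
  is kept for the inverse pass, which also starts from the final value of \<open>B\<close>, the last
  layer.\<close>

definition fwd_prog :: com where
  "fwd_prog = ((setw ''B'' (ICon 0) ;; ISet ''e'' (ICon 0) (ICon 1)) ;;
     For ''d'' (wv ''K'') (setw ''j'' (ICon 0) ;; For ''z'' (wv ''g'') fwd_body ;;
       (setw ''B'' (IAdd (wv ''B'') (wv ''n'')) ;;
        ISet ''e'' (IAdd (wv ''d'') (ICon 1)) (IAdd (IGet ''e'' (wv ''d'')) (IGet ''e'' (wv ''d''))))))"

definition inv_prog :: com where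
  "inv_prog = For ''k'' (wv ''K'')
     ((setw ''d'' (ISub (ISub (wv ''K'') (wv ''k'')) (ICon 1)) ;;
       setw ''B'' (ISub (wv ''B'') (wv ''n'')) ;; setw ''j'' (ICon 0)) ;;
      For ''z'' (wv ''g'') inv_body)"

lemma names_fft_progs [simp]:
  "word_names fwd_prog = {''B'', ''e'', ''d'', ''j'', ''z''}" "real_names fwd_prog = {''a'',''b'',''x'',''y''}"
  "word_names inv_prog = {''B'', ''d'', ''j'', ''k'', ''z''}" "real_names inv_prog = {''a'',''b'',''x'',''y''}"
  by (auto simp: fwd_prog_def inv_prog_def)

lemma run_fwd:
  assumes K: "words s ''K'' 0 = K" "words s ''g'' 0 = g" "words s ''n'' 0 = 2^K" "g = 2^K div 2"
    and A: "\<forall>i<2^K. cx s i = A i"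
  shows "run fwd_prog s (600 * (K + 1) * (g + 1)) (\<lambda>s'. words s' ''B'' 0 = K * 2^K \<and>
     (\<forall>i\<le>K. words s' ''e'' i = 2^i) \<and> (\<forall>i<2^K. cx s' (K * 2^K + i) = fft (tw s) g K A i))"
proof -
  let ?c = "setw ''j'' (ICon 0) ;; For ''z'' (wv ''g'') fwd_body ;;
       (setw ''B'' (IAdd (wv ''B'') (wv ''n'')) ;;
        ISet ''e'' (IAdd (wv ''d'') (ICon 1)) (IAdd (IGet ''e'' (wv ''d'')) (IGet ''e'' (wv ''d''))))"
  let ?P = "\<lambda>d s'. words s' ''B'' 0 = d * 2^K \<and> (\<forall>i\<le>d. words s' ''e'' i = 2^i) \<and>
     (\<forall>i<2^K. cx s' (d * 2^K + i) = fft (tw s) g d A i)"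
  let ?s0 = "effect (setw ''B'' (ICon 0) ;; ISet ''e'' (ICon 0) (ICon 1)) s"
  have "run (For ''d'' (wv ''K'') ?c) ?s0 (550 * (K + 1) * (g + 1)) (?P K)"
  proof (rule run_For[where P = ?P and k = K and B = "\<lambda>_. 500 * (g + 1) + 30"])
    show "?P 0 (set_word ''d'' 0 0 ?s0)" using A by simp
  next
    fix d s'
    assume d: "d < K" and P: "?P d s'" and dd: "words s' ''d'' 0 = d" and fr: "frame (For ''d'' (wv ''K'') ?c) ?s0 s'"
    note f = frame_words[OF fr] frame_reals[OF fr]
    \<comment> \<open>For \<open>K = 0\<close> the half length rounds down to 0 and this fails; the
      existence of a stage \<open>d < K\<close> excludes that case.\<close>
    have g: "(2::nat)^K = g + g" unfolding assms(4) using d by (cases K) auto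
    have w: "words s' ''g'' 0 = g" "words s' ''n'' 0 = 2^K" "tw s' = tw s"
      using K tw_frame[OF fr] by (simp_all add: f)
    let ?s1 = "effect (setw ''j'' (ICon 0)) s'"
    have 1: "run (For ''z'' (wv ''g'') fwd_body) ?s1 (500 * (g + 1))
       (\<lambda>s'. \<forall>i<2^K. cx s' (d * 2^K + 2^K + i) = fft_step (tw ?s1) g d (fft (tw s) g d A) i)"
      by (rule fwd_stage) (use P dd w g in auto)
    show "run ?c s' (500 * (g + 1) + 30) (\<lambda>s''. ?P (Suc d) (set_word ''d'' 0 (Suc d) s''))"
    proof (rule run_loopfree_Seq[where B = "500 * (g + 1) + 23", OF _ run_then[OF 1]])
      fix s2
      assume s2: "\<forall>i<2^K. cx s2 (d * 2^K + 2^K + i) = fft_step (tw ?s1) g d (fft (tw s) g d A) i"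
        and fr2: "frame (For ''z'' (wv ''g'') fwd_body) (effect (setw ''j'' (ICon 0)) s') s2"
      note f2 = frame_words[OF fr2]
      have w2: "words s2 ''B'' 0 = d * 2^K" "words s2 ''n'' 0 = 2^K" "words s2 ''d'' 0 = d"
         "\<forall>i\<le>d. words s2 ''e'' i = 2^i"
        using P w dd by (simp_all add: f2)
      show "run (setw ''B'' (IAdd (wv ''B'') (wv ''n'')) ;;
        ISet ''e'' (IAdd (wv ''d'') (ICon 1)) (IAdd (IGet ''e'' (wv ''d'')) (IGet ''e'' (wv ''d'')))) s2 20
        (\<lambda>s''. ?P (Suc d) (set_word ''d'' 0 (Suc d) s''))"
        by (rule run_loopfree) (use w2 s2 w in \<open>auto simp: le_Suc_eq add.commute\<close>)
    qed simp_all
  next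
    fix i s' assume "frame (For ''d'' (wv ''K'') ?c) ?s0 s'"
    from frame_words[OF this] show "ival (wv ''K'') s' = K" using assms by simp
  qed (auto simp: algebra_simps)
  note main = this
  have "1 \<le> (K + 1) * (g + 1)" by simp
  then have le: "550 * (K + 1) * (g + 1) + 40 \<le> 600 * (K + 1) * (g + 1)"
    unfolding mult.assoc by linarith
  show ?thesis unfolding fwd_prog_def
    by (rule run_mono[OF run_loopfree_Seq[where B' = "550 * (K + 1) * (g + 1) + 40", OF _ main] le]) simp_all
qed

lemma run_inv:
  assumes K: "words s ''K'' 0 = K" "words s ''g'' 0 = g" "words s ''n'' 0 = 2^K" "g = 2^K div 2"
    and e: "\<forall>i\<le>K. words s ''e'' i = 2^i" and B: "words s ''B'' 0 = K * 2^K"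
    and A: "\<forall>i<2^K. cx s (K * 2^K + i) = fft (tw s) g K A i"
    and w: "sqrt_heap (tw s) (2^K)"
  shows "run inv_prog s (600 * (K + 1) * (g + 1)) (\<lambda>s'. \<forall>i<2^K. cx s' i = A i)"
proof -
  let ?b = "setw ''d'' (ISub (ISub (wv ''K'') (wv ''k'')) (ICon 1)) ;;
       setw ''B'' (ISub (wv ''B'') (wv ''n'')) ;; setw ''j'' (ICon 0)"
  let ?c = "?b ;; For ''z'' (wv ''g'') inv_body"
  let ?P = "\<lambda>k s'. words s' ''B'' 0 = (K - k) * 2^K \<and>
     (\<forall>i<2^K. cx s' ((K - k) * 2^K + i) = fft (tw s) g (K - k) A i)"
  have "run (For ''k'' (wv ''K'') ?c) s (600 * (K + 1) * (g + 1)) (?P K)"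
  proof (rule run_For[where P = ?P and k = K and B = "\<lambda>_. 500 * (g + 1) + 30"])
    show "?P 0 (set_word ''k'' 0 0 s)" using A B by simp
  next
    fix k s'
    assume k: "k < K" and P: "?P k s'" and kk: "words s' ''k'' 0 = k" and fr: "frame (For ''k'' (wv ''K'') ?c) s s'"
    note f = frame_words[OF fr] frame_reals[OF fr]
    have g: "(2::nat)^K = g + g" unfolding assms(4) using k by (cases K) auto
    have t: "tw s' = tw s" using tw_frame[OF fr] by simp
    have w': "words s' ''g'' 0 = g" "words s' ''n'' 0 = 2^K" "words s' ''K'' 0 = K" "\<forall>i\<le>K. words s' ''e'' i = 2^i"
      using K e by (simp_all add: f)
    define d where "d = K - Suc k"
    have d: "K - k = Suc d" "d < K" using k by (auto simp: d_def)
    let ?s1 = "effect ?b s'"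
    have s1: "cx ?s1 = cx s'" "tw ?s1 = tw s'" by simp_all
    have 1: "run (For ''z'' (wv ''g'') inv_body) ?s1 (500 * (g + 1))
       (\<lambda>s'. \<forall>i<2^K. cx s' (d * 2^K + i) = fft (tw s) g d A i)"
    proof (rule inv_stage)
      show "words ?s1 ''d'' 0 = d" using w' kk by (simp add: d_def)
      show "words ?s1 ''B'' 0 = d * 2^K" using P w' d by simp
      show "\<forall>i<2^K. cx ?s1 (d * 2^K + 2^K + i) = fft_step (tw ?s1) g d (fft (tw s) g d A) i"
        using P d unfolding s1 by (simp add: t add.commute)
      fix i :: nat
      have "1 \<le> 2^d + i mod 2^d" by (simp add: Suc_le_eq)
      moreover have "2^d + i mod 2^d < (2::nat)^K"
      proof -
        have "2^d + i mod 2^d < (2::nat)^Suc d" by simp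
        also have "\<dots> \<le> 2^K" using d by (intro power_increasing) auto
        finally show ?thesis .
      qed
      ultimately show "cmod (tw ?s1 (2 * (2^d + i mod 2^d))) = 1"
        using w unfolding s1 t sqrt_heap_def by blast
    qed (use w' kk d g in auto)
    show "run ?c s' (500 * (g + 1) + 30) (\<lambda>s''. ?P (Suc k) (set_word ''k'' 0 (Suc k) s''))"
    proof (rule run_loopfree_Seq[OF _ run_weaken[OF 1 order_refl]])
      fix s2
      assume s2: "\<forall>i<2^K. cx s2 (d * 2^K + i) = fft (tw s) g d A i"
        and fr2: "frame (For ''z'' (wv ''g'') inv_body) ?s1 s2"
      have "words s2 ''B'' 0 = d * 2^K"
        using frame_words[OF fr2, of "''B''"] P w' d by simp
      then show "?P (Suc k) (set_word ''k'' 0 (Suc k) s2)" using s2 by (simp add: d_def)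
    qed simp_all
  next
    fix i s' assume "frame (For ''k'' (wv ''K'') ?c) s s'"
    from frame_words[OF this] show "ival (wv ''K'') s' = K" using assms by simp
  qed (auto simp: algebra_simps)
  from run_mono[OF this order_refl] show ?thesis unfolding inv_prog_def by simp
qed

section \<open>Multiplication of polynomials\<close>

definition complex_poly :: "real poly \<Rightarrow> real poly \<Rightarrow> complex poly" where
  "complex_poly F H = map_poly of_real F + smult \<i> (map_poly of_real H)"

lemma coeff_complex_poly [simp]: "coeff (complex_poly F H) i = Complex (coeff F i) (coeff H i)"
  by (simp add: complex_poly_def coeff_map_poly complex_eq_iff)

text \<open>A single transform multiplies two real polynomials, since \<open>Im ((F + \<i> H)\<^sup>2) = 2 F H\<close>.\<close>

lemma Im_complex_poly_square:
  "Im (coeff (complex_poly F H * complex_poly F H) i) = 2 * coeff (F * H) i"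
proof -
  have "Im (coeff (complex_poly F H * complex_poly F H) i) =
      (\<Sum>k\<le>i. coeff F k * coeff H (i - k)) + (\<Sum>k\<le>i. coeff H k * coeff F (i - k))"
    by (simp add: coeff_mult Im_sum sum.distrib)
  also have "(\<Sum>k\<le>i. coeff H k * coeff F (i - k)) = coeff (F * H) i"
    by (simp add: coeff_mult mult.commute[of F])
  finally show ?thesis by (simp add: coeff_mult)
qed

lemma degree_complex_poly: "degree (complex_poly F H) \<le> max (degree F) (degree H)"
  by (rule degree_le) (auto simp: coeff_eq_0 complex_eq_iff)

section \<open>The multiplication program\<close>

definition size_prog :: com where
  "size_prog = ((setw ''n'' (ICon 1) ;; setw ''g'' (ICon 0) ;; setw ''K'' (ICon 0)) ;;
     While (ILess (wv ''n'') (IAdd (IAdd (wv ''a'') (wv ''b'')) (IAdd (wv ''a'') (wv ''b''))))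
       (setw ''g'' (wv ''n'') ;; setw ''n'' (IAdd (wv ''n'') (wv ''n'')) ;; setw ''K'' (IAdd (wv ''K'') (ICon 1))))"

definition load_body :: com where
  "load_body = (Cond (ILess (wv ''z'') (wv ''a''))
        (RSet ''x'' (wv ''z'') (RGet ''f'' (IAdd (wv ''o'') (wv ''z'')))) (RSet ''x'' (wv ''z'') (ROf (ICon 0))) ;;
     Cond (ILess (wv ''z'') (wv ''b''))
        (RSet ''y'' (wv ''z'') (RGet ''f'' (IAdd (IAdd (wv ''o'') (wv ''a'')) (wv ''z'')))) (RSet ''y'' (wv ''z'') (ROf (ICon 0))))"

definition square_body :: com where
  "square_body = (let i = IAdd (wv ''B'') (wv ''z''); x = RGet ''x'' i; y = RGet ''y'' i
     in setr ''a'' (RSub (RMul x x) (RMul y y)) ;; setr ''b'' (RAdd (RMul x y) (RMul x y)) ;;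
        RSet ''x'' i (rv ''a'') ;; RSet ''y'' i (rv ''b''))"

definition store_body :: com where
  "store_body = RSet ''f'' (IAdd (wv ''q'') (wv ''z'')) (RDiv (RGet ''y'' (wv ''z'')) (ROf (ICon 2)))"

definition mul_prog :: com where
  "mul_prog = (size_prog ;; For ''z'' (wv ''n'') load_body ;; fwd_prog ;; For ''z'' (wv ''n'') square_body ;;
     inv_prog ;; For ''z'' (ISub (IAdd (wv ''a'') (wv ''b'')) (ICon 1)) store_body)"

lemma mul_bodies [simp]: "loopfree load_body" "loopfree square_body" "loopfree store_body"
  "cost load_body \<le> 80" "cost square_body \<le> 80" "cost store_body \<le> 80"
  "word_names load_body = {}" "word_names square_body = {}" "word_names store_body = {}"
  "real_names load_body = {''x'', ''y''}" "real_names square_body = {''a'', ''b'', ''x'', ''y''}" "real_names store_body = {''f''}"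
  "word_names size_prog = {''n'', ''g'', ''K''}" "real_names size_prog = {}"
  by (auto simp: load_body_def square_body_def store_body_def size_prog_def Let_def)

lemma mul_prog_names [simp]:
  "word_names mul_prog = {''n'', ''g'', ''K'', ''B'', ''e'', ''d'', ''j'', ''k'', ''z''}"
  "real_names mul_prog = {''a'', ''b'', ''x'', ''y'', ''f''}"
  by (auto simp: mul_prog_def)

lemma cx_load_body:
  assumes "words s ''z'' 0 = z"
  shows "cx (effect load_body s) = (cx s)(z :=
     Complex (if z < words s ''a'' 0 then reals s ''f'' (words s ''o'' 0 + z) else 0)
             (if z < words s ''b'' 0 then reals s ''f'' (words s ''o'' 0 + words s ''a'' 0 + z) else 0))"
  using assms by (auto simp: load_body_def cx_def)

lemma cx_square_body:
  assumes "words s ''z'' 0 = z" "words s ''B'' 0 = B"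
  shows "cx (effect square_body s) = (cx s)(B + z := (cx s (B + z))\<^sup>2)"
  using assms by (simp add: square_body_def Let_def fun_eq_iff cx_def power2_eq_square complex_mult)

lemma run_size:
  assumes "words s ''a'' 0 = a" "words s ''b'' 0 = b"
  defines "K \<equiv> (LEAST K. 2 * (a + b) \<le> 2^K)"
  shows "run size_prog s (100 * (K + 1)) (\<lambda>s'. words s' ''K'' 0 = K \<and> words s' ''n'' 0 = 2^K \<and> words s' ''g'' 0 = 2^K div 2)"
proof -
  let ?c = "setw ''g'' (wv ''n'') ;; setw ''n'' (IAdd (wv ''n'') (wv ''n'')) ;; setw ''K'' (IAdd (wv ''K'') (ICon 1))"
  let ?b = "ILess (wv ''n'') (IAdd (IAdd (wv ''a'') (wv ''b'')) (IAdd (wv ''a'') (wv ''b'')))"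
  let ?P = "\<lambda>i s'. words s' ''K'' 0 = i \<and> words s' ''n'' 0 = 2^i \<and> words s' ''g'' 0 = 2^i div 2"
  let ?s0 = "effect (setw ''n'' (ICon 1) ;; setw ''g'' (ICon 0) ;; setw ''K'' (ICon 0)) s"
  have K: "2 * (a + b) \<le> 2^K"
    unfolding K_def by (rule LeastI[of _ "2 * (a + b)"]) (simp add: less_imp_le)
  have less: "2^i < 2 * (a + b)" if "i < K" for i
    using not_less_Least[OF that[unfolded K_def]] by simp
  have "run (While ?b ?c) ?s0 (60 * (K + 1)) (?P K)"
  proof (rule run_While_count[where P = ?P and k = K and B = "\<lambda>_. 30"])
    fix i s' assume i: "i < K" and P: "?P i s'" and fr: "frame ?c ?s0 s'"
    have "bval ?b s'" using P less[OF i] frame_words[OF fr] assms(1,2) by (simp add: mult_2)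
    moreover have "run ?c s' 30 (?P (Suc i))" by (rule run_loopfree) (use P in auto)
    ultimately show "bval ?b s' \<and> run ?c s' 30 (?P (Suc i))" by blast
  next
    fix s' assume P: "?P K s'" and fr: "frame ?c ?s0 s'"
    show "\<not> bval ?b s'" using P K frame_words[OF fr] assms(1,2) by (simp add: mult_2)
  qed simp_all
  note 1 = this
  show ?thesis unfolding size_prog_def
    by (rule run_loopfree_Seq[OF _ 1]) simp_all
qed

text \<open>The length is the least power of two that is at least \<open>2 * (a + b)\<close>: it
  exceeds the degree of the square and stays below \<open>4 * (a + b)\<close>, where the heap
  supplies the roots. \<open>L\<close> is any common bound on the logarithm, so that one value can
  serve all multiplications of a tree. Leaving the cells below \<open>q\<close> intact protects the
  blocks still waiting in the queue.\<close>

lemma run_mul: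
  fixes F H :: "real poly"
  assumes ab: "words s ''a'' 0 = a" "words s ''b'' 0 = b" "words s ''o'' 0 = o1" "words s ''q'' 0 = q"
    and F: "degree F < a" "\<forall>i<a. reals s ''f'' (o1 + i) = coeff F i"
    and H: "degree H < b" "\<forall>i<b. reals s ''f'' (o1 + a + i) = coeff H i"
    and w: "sqrt_heap (tw s) M" "4 * (a + b) \<le> M"
    and L: "2 * (a + b) \<le> 2^L"
  shows "run mul_prog s (10000 * (L + 1) * (a + b)) (\<lambda>s'.
     (\<forall>i<a+b-1. reals s' ''f'' (q + i) = coeff (F * H) i) \<and>
     (\<forall>i<q. reals s' ''f'' i = reals s ''f'' i))" (is "run _ _ _ ?Q")
proof -
  let ?store = "For ''z'' (ISub (IAdd (wv ''a'') (wv ''b'')) (ICon 1)) store_body"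
  define K where "K = (LEAST K. 2 * (a + b) \<le> 2^K)"
  define g where "g = (2::nat)^K div 2"
  define Z where "Z = complex_poly F H"
  have K: "2 * (a + b) \<le> 2^K" and KL: "K \<le> L"
    unfolding K_def using L by (rule LeastI, rule Least_le)
  have K0: "K > 0" using K F by (cases K) auto
  \<comment> \<open>Minimality of \<open>K\<close> bounds the length from above, which gives both
    the near-linear cost and the fit into the heap.\<close>
  have "\<not> 2 * (a + b) \<le> 2^(K-1)"
    unfolding K_def using K0 by (intro not_less_Least) (simp add: K_def)
  then have K4: "2^K < 4 * (a + b)" using K0 by (cases K) auto
  have g: "g + 1 \<le> 2 * (a + b)" using K4 F unfolding g_def by auto
  have heap: "sqrt_heap (tw s) (2^K)" using w K4 unfolding sqrt_heap_def by auto
  have deg: "degree (Z * Z) < 2^K"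
  proof -
    have "degree (Z * Z) \<le> degree Z + degree Z" by (rule degree_mult_le)
    also have "\<dots> < 2 * (a + b)" using degree_complex_poly[of F H] F H by (auto simp: Z_def)
    finally show ?thesis using K by simp
  qed
  \<comment> \<open>Every stage costs a constant multiple of \<open>T\<close>; as an opaque quantity
    it turns the remaining cost comparisons into linear ones.\<close>
  define T where "T = (L + 1) * (a + b)"
  have T: "(K + 1) * (g + 1) \<le> 2 * T" "K + 1 \<le> T" "2^K \<le> 4 * T" "a + b \<le> T" "T > 0"
  proof -
    show "(K + 1) * (g + 1) \<le> 2 * T"
      using mult_le_mono[of "K + 1" "L + 1" "g + 1" "2 * (a + b)"] KL g by (simp add: algebra_simps T_def)
    show "K + 1 \<le> T" using mult_le_mono[of "K + 1" "L + 1" 1 "a + b"] KL F by (simp add: T_def)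
    show "a + b \<le> T" by (simp add: T_def)
    then show "2^K \<le> 4 * T" "T > 0" using K4 F by simp_all
  qed
  have b1: "run size_prog s (100 * T) (\<lambda>s'. words s' ''K'' 0 = K \<and> words s' ''n'' 0 = 2^K \<and> words s' ''g'' 0 = g)"
    using run_size[OF ab(1,2)] by (rule run_mono) (use T(2) in \<open>simp_all add: K_def g_def\<close>)
  have b2: "run (For ''z'' (wv ''n'') load_body) s' (500 * T) (\<lambda>s'. \<forall>i<2^K. cx s' i = coeff Z i)"
    if "words s' ''n'' 0 = 2^K" and fr: "frame size_prog s s'" for s'
  proof (rule run_For[where k = "2^K" and B = "\<lambda>_. 80" and P = "\<lambda>k s'. \<forall>i<k. cx s' i = coeff Z i"])
    fix z s2
    assume P: "\<forall>i<z. cx s2 i = coeff Z i" and z: "words s2 ''z'' 0 = z"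
      and fr2: "frame (For ''z'' (wv ''n'') load_body) s' s2"
    have f: "reals s2 ''f'' = reals s ''f''" "words s2 ''a'' 0 = a" "words s2 ''b'' 0 = b" "words s2 ''o'' 0 = o1"
      using frame_reals[OF fr2] frame_reals[OF fr] frame_words[OF fr2] frame_words[OF fr] ab by simp_all
    have "cx (effect load_body s2) = (cx s2)(z := coeff Z z)"
      unfolding cx_load_body[OF z] using F H by (auto simp: f Z_def coeff_eq_0)
    then show "run load_body s2 80 (\<lambda>s2. \<forall>i<Suc z. cx (set_word ''z'' 0 (Suc z) s2) i = coeff Z i)"
      using P by (intro run_loopfree) (auto simp: less_Suc_eq)
  next
    fix i s2 assume "frame (For ''z'' (wv ''n'') load_body) s' s2"
    from frame_words[OF this] that(1) show "ival (wv ''n'') s2 = 2^K" by simp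
  qed (use T in auto)
  have b4: "run (For ''z'' (wv ''n'') square_body) s' (500 * T) (\<lambda>s'. \<forall>i<2^K. cx s' (B + i) = (A i)\<^sup>2)"
    if "words s' ''n'' 0 = 2^K" "words s' ''B'' 0 = B" "\<forall>i<2^K. cx s' (B + i) = A i" for s' A B
  proof (rule run_mono[where B = "500 * T"])
    let ?P = "\<lambda>k s'. \<forall>i<2^K. cx s' (B + i) = (if i < k then (A i)\<^sup>2 else A i)"
    show "run (For ''z'' (wv ''n'') square_body) s' (500 * T) (?P (2^K))"
    proof (rule run_For[where k = "2^K" and B = "\<lambda>_. 80" and P = ?P])
      fix z s2
      assume P: "?P z s2" and z: "words s2 ''z'' 0 = z" and zK: "z < 2^K"
        and fr2: "frame (For ''z'' (wv ''n'') square_body) s' s2"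
      have f: "words s2 ''B'' 0 = B"
        using frame_words[OF fr2] that by simp
      have "cx (effect square_body s2) = (cx s2)(B + z := (A z)\<^sup>2)"
        unfolding cx_square_body[OF z f] using P zK by auto
      then show "run square_body s2 80 (\<lambda>s2. ?P (Suc z) (set_word ''z'' 0 (Suc z) s2))"
        using P by (intro run_loopfree) (auto simp: less_Suc_eq)
    next
      fix i s2 assume "frame (For ''z'' (wv ''n'') square_body) s' s2"
      from frame_words[OF this] that(1) show "ival (wv ''n'') s2 = 2^K" by simp
    qed (use T that in auto)
  qed auto
  have b6: "run (?store) s' (500 * T) ?Q"
    if w: "words s' ''a'' 0 = a" "words s' ''b'' 0 = b" "words s' ''q'' 0 = q"
      and A: "\<forall>i<2^K. cx s' i = coeff (Z * Z) i" and rf: "reals s' ''f'' = reals s ''f''" for s'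
  proof (rule run_For[where k = "a+b-1" and B = "\<lambda>_. 80" and P = "\<lambda>k s'.
     (\<forall>i<k. reals s' ''f'' (q + i) = coeff (F * H) i) \<and> (\<forall>i<q. reals s' ''f'' i = reals s ''f'' i)"])
    fix z s2
    assume P: "(\<forall>i<z. reals s2 ''f'' (q + i) = coeff (F * H) i) \<and> (\<forall>i<q. reals s2 ''f'' i = reals s ''f'' i)"
      and z: "words s2 ''z'' 0 = z" and zK: "z < a+b-1"
      and fr2: "frame (?store) s' s2"
    have f: "words s2 ''q'' 0 = q"
      using frame_words[OF fr2] that by simp
    have "reals s2 ''y'' z = Im (cx s2 z)" by (simp add: cx_def)
    also have "cx s2 z = coeff (Z * Z) z" using A zK K cx_frame[OF fr2] by simp
    finally have "reals s2 ''y'' z = 2 * coeff (F * H) z" unfolding Z_def Im_complex_poly_square .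
    then show "run store_body s2 80 (\<lambda>s2.
      (\<forall>i<Suc z. reals (set_word ''z'' 0 (Suc z) s2) ''f'' (q + i) = coeff (F * H) i) \<and>
      (\<forall>i<q. reals (set_word ''z'' 0 (Suc z) s2) ''f'' i = reals s ''f'' i))"
      using P z f by (intro run_loopfree) (auto simp: less_Suc_eq store_body_def)
  next
    fix i s2 assume "frame (?store) s' s2"
    from frame_words[OF this] that(1,2)
    show "ival (ISub (IAdd (wv ''a'') (wv ''b'')) (ICon 1)) s2 = a + b - 1" by simp
  qed (use T rf in auto)
  have le: "600 * (K + 1) * (g + 1) \<le> 1200 * T" unfolding mult.assoc using T(1) by linarith
  have big: "10000 * (L + 1) * (a + b) = 10000 * T" by (simp add: T_def algebra_simps)
  show ?thesis unfolding mul_prog_def big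
  proof (rule run_then[OF b1])
    fix s1 assume 1: "words s1 ''K'' 0 = K \<and> words s1 ''n'' 0 = 2^K \<and> words s1 ''g'' 0 = g"
      and fr1: "frame size_prog s s1"
    note f1 = frame_words[OF fr1] frame_reals[OF fr1] tw_frame[OF fr1]
    from 1 have 1: "words s1 ''K'' 0 = K" "words s1 ''n'' 0 = 2^K" "words s1 ''g'' 0 = g" by auto
    show "run (For ''z'' (wv ''n'') load_body ;; fwd_prog ;; For ''z'' (wv ''n'') square_body ;;
       inv_prog ;; ?store) s1 (4800 * T) ?Q"
    proof (rule run_then[OF b2[OF 1(2) fr1]])
      fix s2 assume 2: "\<forall>i<2^K. cx s2 i = coeff Z i" and fr2: "frame (For ''z'' (wv ''n'') load_body) s1 s2"
      note f2 = frame_words[OF fr2] frame_reals[OF fr2] tw_frame[OF fr2]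
      have w2: "words s2 ''K'' 0 = K" "words s2 ''g'' 0 = g" "words s2 ''n'' 0 = 2^K" "tw s2 = tw s"
        using 1 by (simp_all add: f2 f1)
      show "run (fwd_prog ;; For ''z'' (wv ''n'') square_body ;;
         inv_prog ;; ?store) s2 (4000 * T) ?Q"
      proof (rule run_then[OF run_mono[OF run_fwd[OF w2(1-3) g_def 2] le]])
        fix s3 assume "words s3 ''B'' 0 = K * 2^K \<and> (\<forall>i\<le>K. words s3 ''e'' i = 2^i) \<and>
           (\<forall>i<2^K. cx s3 (K * 2^K + i) = fft (tw s2) g K (coeff Z) i)"
          and fr3: "frame fwd_prog s2 s3"
        then have 3: "words s3 ''B'' 0 = K * 2^K" "\<forall>i\<le>K. words s3 ''e'' i = 2^i"
          "\<forall>i<2^K. cx s3 (K * 2^K + i) = fft (tw s2) g K (coeff Z) i" by auto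
        note f3 = frame_words[OF fr3] frame_reals[OF fr3] tw_frame[OF fr3]
        have w3: "words s3 ''n'' 0 = 2^K" using w2 by (simp add: f3)
        show "run (For ''z'' (wv ''n'') square_body ;;
         inv_prog ;; ?store) s3 (2500 * T) ?Q"
        proof (rule run_then[OF b4[OF w3 3(1) 3(3)]])
          fix s4 assume 4: "\<forall>i<2^K. cx s4 (K * 2^K + i) = (fft (tw s2) g K (coeff Z) i)\<^sup>2"
            and fr4: "frame (For ''z'' (wv ''n'') square_body) s3 s4"
          note f4 = frame_words[OF fr4] frame_reals[OF fr4] tw_frame[OF fr4]
          have w4: "words s4 ''K'' 0 = K" "words s4 ''g'' 0 = g" "words s4 ''n'' 0 = 2^K" "tw s4 = tw s"
            "\<forall>i\<le>K. words s4 ''e'' i = 2^i" "words s4 ''B'' 0 = K * 2^K"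
            using w2 3 by (simp_all add: f4 f3)
          have sq: "\<forall>i<2^K. cx s4 (K * 2^K + i) = fft (tw s4) g K (coeff (Z * Z)) i"
            using 4 fft_square[OF heap g_def _ deg] w2 w4 by simp
          note inv = run_inv[OF w4(1-3) g_def w4(5,6) sq]
          show "run (inv_prog ;; ?store) s4 (1800 * T) ?Q"
          proof (rule run_then[OF run_mono[OF inv le]])
            show "sqrt_heap (tw s4) (2^K)" using heap w4 by simp
          next
            fix s5 assume 5: "\<forall>i<2^K. cx s5 i = coeff (Z * Z) i" and fr5: "frame inv_prog s4 s5"
            note f5 = frame_words[OF fr5] frame_reals[OF fr5]
            have "words s5 ''a'' 0 = a" "words s5 ''b'' 0 = b" "words s5 ''q'' 0 = q" "reals s5 ''f'' = reals s ''f''"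
              using ab by (simp_all add: f5 f4 f3 f2 f1)
            note b6[OF this(1-3) 5 this(4)]
            then show "run (?store) s5 (500 * T) ?Q" .
          qed (use T F in \<open>simp_all del: mult_Suc mult_Suc_right\<close>)
        qed (use T F in \<open>simp_all del: mult_Suc mult_Suc_right\<close>)
      qed (use T F in \<open>simp_all del: mult_Suc mult_Suc_right\<close>)
    qed (use T F in \<open>simp_all del: mult_Suc mult_Suc_right\<close>)
  qed (use T F in \<open>simp_all del: mult_Suc mult_Suc_right\<close>)
qed

section \<open>The square roots of unity\<close>

definition heap_body :: com where
  "heap_body = (let v = IAdd (wv ''z'') (ICon 1); l = IAdd v v; l1 = IAdd l (ICon 1);
       one = ROf (ICon 1); two = ROf (ICon 2); zero = ROf (ICon 0)
     in setr ''a'' (RSqrt (RDiv (RAdd one (RGet ''u'' v)) two)) ;;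
        setr ''b'' (RSqrt (RDiv (RSub one (RGet ''u'' v)) two)) ;;
        Cond (RLess (RGet ''v'' v) zero) (setr ''b'' (RSub zero (rv ''b''))) Skip ;;
        RSet ''u'' l (rv ''a'') ;; RSet ''v'' l (rv ''b'') ;;
        RSet ''u'' l1 (RSub zero (rv ''a'')) ;; RSet ''v'' l1 (RSub zero (rv ''b'')))"

definition heap_prog :: com where
  "heap_prog = ((RSet ''u'' (ICon 1) (ROf (ICon 1)) ;; RSet ''v'' (ICon 1) (ROf (ICon 0))) ;;
     For ''z'' (wv ''r'') heap_body)"

lemma heap_names [simp]: "loopfree heap_body" "cost heap_body \<le> 150" "word_names heap_body = {}"
  "real_names heap_body = {''a'', ''b'', ''u'', ''v''}"
  "word_names heap_prog = {''z''}" "real_names heap_prog = {''a'', ''b'', ''u'', ''v''}"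
  by (auto simp: heap_body_def heap_prog_def Let_def)

text \<open>Half-angle formulas: for u + iv on the unit circle the principal square root has parts
  sqrt((1 + u)/2) and sqrt((1 - u)/2), the second one taken with negative sign exactly when v is
  negative. Hence real square roots suffice.\<close>

lemma tw_heap_body:
  assumes "words s ''z'' 0 = z" "cmod (tw s (Suc z)) = 1"
  shows "tw (effect heap_body s) = (tw s)(2 * Suc z := csqrt (tw s (Suc z)), Suc (2 * Suc z) := - csqrt (tw s (Suc z)))"
proof -
  have "Im (tw s (Suc z)) = reals s ''v'' (Suc z)" "Re (tw s (Suc z)) = reals s ''u'' (Suc z)"
    by (simp_all add: tw_def)
  then have "csqrt (tw s (Suc z)) = Complex (sqrt ((1 + reals s ''u'' (Suc z)) / 2))
     ((if reals s ''v'' (Suc z) < 0 then -1 else 1) * sqrt ((1 - reals s ''u'' (Suc z)) / 2))"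
    using assms(2) by (auto simp: complex_eq_iff sgn_if)
  then show ?thesis using assms(1)
    by (auto simp: heap_body_def Let_def tw_def fun_eq_iff complex_eq_iff)
qed

lemma run_heap:
  assumes M: "words s ''r'' 0 = M"
  shows "run heap_prog s (200 * (M + 1)) (\<lambda>s'. sqrt_heap (tw s') M)"
proof -
  let ?s0 = "effect (RSet ''u'' (ICon 1) (ROf (ICon 1)) ;; RSet ''v'' (ICon 1) (ROf (ICon 0))) s"
  \<comment> \<open>The half-angle formulas hold on the unit circle only, so modulus one is recorded
    for all entries created so far, which reach up to index 2k + 1.\<close>
  let ?P = "\<lambda>k s'. sqrt_heap (tw s') (Suc k) \<and> (\<forall>v. 1 \<le> v \<and> v < 2 * Suc k \<longrightarrow> cmod (tw s' v) = 1)"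
  have "run (For ''z'' (wv ''r'') heap_body) ?s0 (180 * (M + 1)) (?P M)"
  proof (rule run_For[where P = ?P and k = M and B = "\<lambda>_. 150"])
    have "cmod (tw ?s0 1) = 1" by (simp add: tw_def cmod_def)
    then have "cmod (tw ?s0 v) = 1" if "1 \<le> v" "v < 2" for v
      using that by (metis One_nat_def le_antisym less_2_cases_iff not_one_le_zero)
    then show "?P 0 (set_word ''z'' 0 0 ?s0)"
      unfolding sqrt_heap_def by auto
  next
    fix z s' assume P: "?P z s'" and z: "words s' ''z'' 0 = z"
    let ?w = "csqrt (tw s' (Suc z))"
    have c: "cmod (tw s' (Suc z)) = 1" using P by simp
    have w: "?w\<^sup>2 = tw s' (Suc z)" "cmod ?w = 1" using c by simp_all
    have eff: "tw (set_word ''z'' 0 (Suc z) (effect heap_body s')) = (tw s')(2 * Suc z := ?w, Suc (2 * Suc z) := - ?w)"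
      unfolding tw_set_word tw_heap_body[OF z c] ..
    have "?P (Suc z) (set_word ''z'' 0 (Suc z) (effect heap_body s'))"
      unfolding eff sqrt_heap_def
    proof (intro conjI allI impI; elim conjE)
      fix v assume v: "1 \<le> v" "v < Suc (Suc z)"
      \<comment> \<open>The two fresh cells lie beyond every node under consideration, so the entry
        at \<open>v\<close> itself is an old one.\<close>
      have ne: "v \<noteq> 2 * Suc z" "v \<noteq> Suc (2 * Suc z)" using v by auto
      let ?t = "(tw s')(2 * Suc z := ?w, Suc (2 * Suc z) := - ?w)"
      show "(?t (2 * v))\<^sup>2 = ?t v" "?t (2 * v + 1) = - ?t (2 * v)" "cmod (?t (2 * v)) = 1"
        using v ne w P unfolding sqrt_heap_def by (cases "v = Suc z"; auto; presburger)+
    next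
      fix v assume "1 \<le> v" "v < 2 * Suc (Suc z)"
      then show "cmod (((tw s')(2 * Suc z := ?w, Suc (2 * Suc z) := - ?w)) v) = 1"
        using w P by auto
    qed
    then show "run heap_body s' 150 (\<lambda>s''. ?P (Suc z) (set_word ''z'' 0 (Suc z) s''))"
      by (intro run_loopfree) auto
  next
    fix i s' assume "frame (For ''z'' (wv ''r'') heap_body) ?s0 s'"
    from frame_words[OF this] show "ival (wv ''r'') s' = M" using M by simp
  qed auto
  then have 1: "run (For ''z'' (wv ''r'') heap_body) ?s0 (180 * (M + 1)) (\<lambda>s'. sqrt_heap (tw s') M)"
    by (rule run_mono) (auto simp: sqrt_heap_def)
  show ?thesis unfolding heap_prog_def
    by (rule run_loopfree_Seq[OF _ 1]) simp_all
qed

section \<open>Products of many polynomials\<close>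

text \<open>
  The polynomials wait in a queue; the product of the first two is appended at the end.  The
  lengths of the coefficient blocks are the entries \<open>i, \<dots>, t - 1\<close> of \<open>l\<close>, and the blocks
  themselves occupy the entries \<open>o, \<dots>, q - 1\<close> of \<open>f\<close>.
\<close>

fun queue :: "store \<Rightarrow> nat \<Rightarrow> nat \<Rightarrow> (real poly \<times> nat) list \<Rightarrow> nat \<Rightarrow> nat \<Rightarrow> bool" where
  "queue s i b [] t q \<longleftrightarrow> i = t \<and> b = q"
| "queue s i b ((P, l) # ps) t q \<longleftrightarrow> words s ''l'' i = l \<and> degree P < l \<and>
     (\<forall>j<l. reals s ''f'' (b + j) = coeff P j) \<and> queue s (Suc i) (b + l) ps t q"

lemma queue_le: "queue s i b ps t q \<Longrightarrow> i \<le> t \<and> b \<le> q"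
  by (induction s i b ps t q rule: queue.induct) auto

lemma queue_cong:
  "queue s i b ps t q \<Longrightarrow> (\<And>j. i \<le> j \<Longrightarrow> j < t \<Longrightarrow> words s' ''l'' j = words s ''l'' j) \<Longrightarrow>
   (\<And>j. b \<le> j \<Longrightarrow> j < q \<Longrightarrow> reals s' ''f'' j = reals s ''f'' j) \<Longrightarrow> queue s' i b ps t q"
proof (induction s i b ps t q rule: queue.induct)
  case (2 s i b P l ps t q)
  then have q: "queue s (Suc i) (b + l) ps t q" by simp
  from queue_le[OF q] 2 show ?case by auto
qed simp

lemma queue_append:
  "queue s i b ps t q \<Longrightarrow> words s ''l'' t = l \<Longrightarrow> degree P < l \<Longrightarrow>
   (\<forall>j<l. reals s ''f'' (q + j) = coeff P j) \<Longrightarrow> queue s i b (ps @ [(P, l)]) (Suc t) (q + l)"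
  by (induction s i b ps t q rule: queue.induct) auto

definition tree_prog :: com where
  "tree_prog = While (ILess (IAdd (wv ''i'') (ICon 1)) (wv ''t''))
     ((setw ''a'' (IGet ''l'' (wv ''i'')) ;; setw ''b'' (IGet ''l'' (IAdd (wv ''i'') (ICon 1)))) ;;
      mul_prog ;;
      (ISet ''l'' (wv ''t'') (ISub (IAdd (wv ''a'') (wv ''b'')) (ICon 1)) ;;
       setw ''i'' (IAdd (wv ''i'') (ICon 2)) ;; setw ''t'' (IAdd (wv ''t'') (ICon 1)) ;;
       setw ''o'' (IAdd (wv ''o'') (IAdd (wv ''a'') (wv ''b''))) ;;
       setw ''q'' (ISub (IAdd (wv ''q'') (IAdd (wv ''a'') (wv ''b''))) (ICon 1))))"

lemma tree_prog_names [simp]: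
  "word_names tree_prog = {''a'', ''b'', ''i'', ''t'', ''o'', ''q'', ''l'', ''n'', ''g'', ''K'', ''B'', ''e'', ''d'', ''j'', ''k'', ''z''}"
  "real_names tree_prog = {''a'', ''b'', ''x'', ''y'', ''f''}"
  by (auto simp: tree_prog_def)

section \<open>The total length handled by merging in queue order\<close>

function merge_cost :: "nat list \<Rightarrow> nat" where
  "merge_cost (a # b # ls) = a + b + merge_cost (ls @ [a + b - 1])"
| "merge_cost [] = 0"
| "merge_cost [a] = 0"
  by pat_completeness auto
termination by (relation "Wellfounded.measure length") auto

text \<open>One complete pass over the queue, that is, one level of the multiplication tree.\<close>

fun merge_pairs :: "nat list \<Rightarrow> nat list" where
  "merge_pairs (a # b # ls) = (a + b - 1) # merge_pairs ls"
| "merge_pairs ls = ls"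

lemma merge_cost_pairs:
  "even (length xs) \<Longrightarrow> merge_cost (xs @ ys) = sum_list xs + merge_cost (ys @ merge_pairs xs)"
  by (induction xs arbitrary: ys rule: merge_pairs.induct) auto

lemma length_merge_pairs: "even (length xs) \<Longrightarrow> 2 * length (merge_pairs xs) = length xs"
  by (induction xs rule: merge_pairs.induct) auto

lemma sum_merge_pairs: "sum_list (merge_pairs xs) \<le> sum_list xs"
  by (induction xs rule: merge_pairs.induct) auto

text \<open>A pass costs at most the total length, which does not grow, and halves the number of
  blocks up to rounding. If the number is odd, the last block sits out the pass and then stands in
  front of the new products, which is why the next round concerns
  \<open>x # merge_pairs xs\<close>.\<close>

lemma merge_cost_le: "length ls \<le> 2^k \<Longrightarrow> merge_cost ls \<le> k * sum_list ls"
proof (induction k arbitrary: ls)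
  case 0
  then show ?case by (cases ls rule: merge_cost.cases) auto
next
  case (Suc k)
  show ?case
  proof (cases "even (length ls)")
    case True
    have "merge_cost ls = sum_list ls + merge_cost (merge_pairs ls)"
      using merge_cost_pairs[OF True, of "[]"] by simp
    also have "merge_cost (merge_pairs ls) \<le> k * sum_list (merge_pairs ls)"
      using length_merge_pairs[OF True] Suc.prems by (intro Suc.IH) auto
    also have "\<dots> \<le> k * sum_list ls" using sum_merge_pairs by simp
    finally show ?thesis by simp
  next
    case False
    then obtain xs x where ls: "ls = xs @ [x]" by (cases ls rule: rev_cases) auto
    with False have ev: "even (length xs)" by simp
    have "merge_cost ls = sum_list xs + merge_cost (x # merge_pairs xs)"
      using merge_cost_pairs[OF ev, of "[x]"] ls by simp
    also have "merge_cost (x # merge_pairs xs) \<le> k * sum_list (x # merge_pairs xs)"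
    proof (rule Suc.IH)
      \<comment> \<open>The surplus 1 is harmless by parity: an even number below
        \<open>2 * 2^k + 1\<close> is at most \<open>2 * 2^k\<close>.\<close>
      have "2 * Suc (length (merge_pairs xs)) \<le> 2 * 2^k + 1"
        using length_merge_pairs[OF ev] Suc.prems ls by simp
      then show "length (x # merge_pairs xs) \<le> 2^k" by simp
    qed
    also have "\<dots> \<le> k * sum_list ls" using sum_merge_pairs[of xs] ls by (intro mult_le_mono) auto
    finally show ?thesis using ls by simp
  qed
qed

text \<open>The sum of the lengths minus one is invariant, since (a + c - 1) - 1 = (a - 1) + (c -
  1); at the end it is the degree bound of the single remaining block. The first \<open>t\<close>
  lengths survive because new ones are appended, and the second product reads them again.\<close>

lemma run_tree:
  assumes "queue s i b ps t q" "ps \<noteq> []"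
    and "words s ''i'' 0 = i" "words s ''o'' 0 = b" "words s ''t'' 0 = t" "words s ''q'' 0 = q"
    and "sqrt_heap (tw s) M" "4 * sum_list (map snd ps) \<le> M" "2 * sum_list (map snd ps) \<le> 2^L"
  shows "run tree_prog s (11000 * (L + 1) * merge_cost (map snd ps) + 20) (\<lambda>s'.
     (\<forall>j \<le> (\<Sum>l\<leftarrow>map snd ps. l - 1). reals s' ''f'' (words s' ''o'' 0 + j) = coeff (prod_list (map fst ps)) j) \<and>
     (\<forall>j<t. words s' ''l'' j = words s ''l'' j))"
  using assms
proof (induction "length ps" arbitrary: s i b ps t q rule: less_induct)
  case less
  have tree: "tree_prog = While (ILess (IAdd (wv ''i'') (ICon 1)) (wv ''t''))
     ((setw ''a'' (IGet ''l'' (wv ''i'')) ;; setw ''b'' (IGet ''l'' (IAdd (wv ''i'') (ICon 1)))) ;;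
      mul_prog ;;
      (ISet ''l'' (wv ''t'') (ISub (IAdd (wv ''a'') (wv ''b'')) (ICon 1)) ;;
       setw ''i'' (IAdd (wv ''i'') (ICon 2)) ;; setw ''t'' (IAdd (wv ''t'') (ICon 1)) ;;
       setw ''o'' (IAdd (wv ''o'') (IAdd (wv ''a'') (wv ''b''))) ;;
       setw ''q'' (ISub (IAdd (wv ''q'') (IAdd (wv ''a'') (wv ''b''))) (ICon 1))))"
    (is "_ = While ?b (?c1 ;; mul_prog ;; ?c2)") by (rule tree_prog_def)
  show ?case
  proof (cases ps)
    case Nil then show ?thesis using less.prems by simp
  next
    case (Cons p ps')
    obtain F a where "p = (F, a)" by fastforce
    with Cons have ps: "ps = (F, a) # ps'" by simp
    show ?thesis
    proof (cases ps')
      case Nil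
      with less.prems ps have "t = Suc i" "degree F < a" "\<forall>j<a. reals s ''f'' (b + j) = coeff F j" by auto
      then show ?thesis using less.prems Nil ps unfolding tree
        by (intro run_While_end) auto
    next
      case (Cons Hc rest)
      obtain H c where Hc: "Hc = (H, c)" by fastforce
      note ps = ps[unfolded Cons Hc]
      have q: "words s ''l'' i = a" "degree F < a" "\<forall>j<a. reals s ''f'' (b + j) = coeff F j"
        "words s ''l'' (Suc i) = c" "degree H < c" "\<forall>j<c. reals s ''f'' (b + a + j) = coeff H j"
        and rest: "queue s (i + 2) (b + a + c) rest t q"
        using less.prems(1) unfolding ps by simp_all
      have le: "i + 2 \<le> t" "b + a + c \<le> q" using queue_le[OF rest] by auto
      let ?s1 = "effect ?c1 s"
      let ?ps = "rest @ [(F * H, a + c - 1)]"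
      have s1: "words ?s1 = (words s)(''a'' := (words s ''a'')(0 := a), ''b'' := (words s ''b'')(0 := c))"
        "reals ?s1 = reals s" "tw ?s1 = tw s"
        using q less.prems by simp_all
      have mul: "run mul_prog ?s1 (10000 * (L + 1) * (a + c)) (\<lambda>s'.
         (\<forall>i<a+c-1. reals s' ''f'' (q + i) = coeff (F * H) i) \<and>
         (\<forall>i<q. reals s' ''f'' i = reals ?s1 ''f'' i))"
        by (rule run_mul[where M = M and ?o1.0 = b]) (use q less.prems in \<open>simp_all add: s1 ps\<close>)
      have fin: "run tree_prog s' (11000 * (L + 1) * merge_cost (map snd ?ps) + 20) (\<lambda>s'.
          (\<forall>j \<le> (\<Sum>l\<leftarrow>map snd ?ps. l - 1). reals s' ''f'' (words s' ''o'' 0 + j) = coeff (prod_list (map fst ?ps)) j) \<and>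
          (\<forall>j<t. words s' ''l'' j = words s ''l'' j))"
        if "queue s' (i + 2) (b + a + c) ?ps (t + 1) (q + (a + c - 1))"
          "words s' ''i'' 0 = i + 2" "words s' ''o'' 0 = b + a + c" "words s' ''t'' 0 = t + 1"
          "words s' ''q'' 0 = q + (a + c - 1)" "tw s' = tw s" "\<forall>j<t. words s' ''l'' j = words s ''l'' j" for s'
        by (rule run_mono[OF less.hyps[OF _ that(1) _ that(2-5)]]) (use less.prems ps that(6,7) in auto)
      have body: "run (?c1 ;; mul_prog ;; ?c2) s (10000 * (L + 1) * (a + c) + 70) (\<lambda>s'.
          queue s' (i + 2) (b + a + c) ?ps (t + 1) (q + (a + c - 1)) \<and>
          words s' ''i'' 0 = i + 2 \<and> words s' ''o'' 0 = b + a + c \<and> words s' ''t'' 0 = t + 1 \<and>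
          words s' ''q'' 0 = q + (a + c - 1) \<and> tw s' = tw s \<and> (\<forall>j<t. words s' ''l'' j = words s ''l'' j))" (is "run _ _ _ ?Q")
      proof (rule run_loopfree_Seq[where B = "10000 * (L + 1) * (a + c) + 55", OF _ run_then[OF mul]])
        fix s2 assume s2: "(\<forall>i<a+c-1. reals s2 ''f'' (q + i) = coeff (F * H) i) \<and>
            (\<forall>i<q. reals s2 ''f'' i = reals ?s1 ''f'' i)" and fr: "frame mul_prog ?s1 s2"
        note f = frame_words[OF fr]
        have w2: "words s2 ''a'' 0 = a" "words s2 ''b'' 0 = c" "words s2 ''i'' 0 = i" "words s2 ''o'' 0 = b"
           "words s2 ''t'' 0 = t" "words s2 ''q'' 0 = q" "words s2 ''l'' = words s ''l''" "tw s2 = tw s"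
          using less.prems s1 tw_frame[OF fr] by (simp_all add: f)
        let ?s3 = "effect ?c2 s2"
        have l3: "words ?s3 ''l'' = (words s ''l'')(t := a + c - 1)" and r3: "reals ?s3 = reals s2"
          using w2 by simp_all
        have deg: "degree (F * H) < a + c - 1"
          using degree_mult_le[of F H] q by simp
        have "queue ?s3 (i + 2) (b + a + c) ?ps (Suc t) (q + (a + c - 1))"
        proof (rule queue_append)
          show "queue ?s3 (i + 2) (b + a + c) rest t q"
            by (rule queue_cong[OF rest]) (use s2 w2 in simp_all)
          show "\<forall>j<a + c - 1. reals ?s3 ''f'' (q + j) = coeff (F * H) j"
            unfolding r3 using s2 by simp
        qed (use l3 deg in simp_all)
        moreover have "words ?s3 ''q'' 0 = q + (a + c - 1)" using w2 q by simp
        moreover have "words ?s3 ''i'' 0 = i + 2" "words ?s3 ''o'' 0 = b + a + c" "words ?s3 ''t'' 0 = t + 1"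
          using w2 by simp_all
        moreover have "tw ?s3 = tw s" "\<forall>j<t. words ?s3 ''l'' j = words s ''l'' j"
          using w2(5,7,8) by simp_all
        ultimately show "run ?c2 s2 50 ?Q"
          by (intro run_loopfree) (simp_all only: Suc_eq_plus1 simp_thms, simp_all)
      qed simp_all
      have b: "bval ?b s" using le less.prems by simp
      have ac: "1 \<le> (L + 1) * (a + c)" using q by simp
      have "run tree_prog s (11000 * (L + 1) * merge_cost (map snd ps) + 20) (\<lambda>s'.
          (\<forall>j \<le> (\<Sum>l\<leftarrow>map snd ?ps. l - 1). reals s' ''f'' (words s' ''o'' 0 + j) = coeff (prod_list (map fst ?ps)) j) \<and>
          (\<forall>j<t. words s' ''l'' j = words s ''l'' j))"
        unfolding tree
      proof (rule run_While_step[OF b body])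
        fix s' assume "?Q s'"
        then have *: "queue s' (i + 2) (b + a + c) ?ps (t + 1) (q + (a + c - 1))"
          "words s' ''i'' 0 = i + 2" "words s' ''o'' 0 = b + a + c" "words s' ''t'' 0 = t + 1"
          "words s' ''q'' 0 = q + (a + c - 1)" "tw s' = tw s" "\<forall>j<t. words s' ''l'' j = words s ''l'' j" by blast+
        show "run (While ?b (?c1 ;; mul_prog ;; ?c2)) s' (11000 * (L + 1) * merge_cost (map snd ?ps) + 20) (\<lambda>s'.
          (\<forall>j \<le> (\<Sum>l\<leftarrow>map snd ?ps. l - 1). reals s' ''f'' (words s' ''o'' 0 + j) = coeff (prod_list (map fst ?ps)) j) \<and>
          (\<forall>j<t. words s' ''l'' j = words s ''l'' j))"
          using fin[OF *] unfolding tree .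
      next
        define T where "T = (L + 1) * (a + c)"
        define U where "U = (L + 1) * merge_cost (map snd ?ps)"
        have "11000 * (L + 1) * merge_cost (map snd ps) = 11000 * T + 11000 * U"
          by (simp add: ps T_def U_def algebra_simps)
        moreover have "10000 * (L + 1) * (a + c) = 10000 * T" "11000 * (L + 1) * merge_cost (map snd ?ps) = 11000 * U"
          by (simp_all add: T_def U_def algebra_simps)
        ultimately show "1 + bcost ?b + (10000 * (L + 1) * (a + c) + 70) + (11000 * (L + 1) * merge_cost (map snd ?ps) + 20)
            \<le> 11000 * (L + 1) * merge_cost (map snd ps) + 20"
          using ac[folded T_def] by simp
      qed
      moreover have "prod_list (map fst ?ps) = prod_list (map fst ps)" by (simp add: ps mult_ac)
      moreover have "(\<Sum>l\<leftarrow>map snd ?ps. l - 1) = (\<Sum>l\<leftarrow>map snd ps. l - 1)" using q by (simp add: ps)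
      ultimately show ?thesis by simp
    qed
  qed
qed

section \<open>Reading the input\<close>

definition conv_prog :: com where
  "conv_prog = ((ISet ''T'' (ICon 0) (ICon 1) ;; setw ''Y'' (ICon 0)) ;;
     While (BNot (RLess (rv ''t'') (ROf (IGet ''T'' (wv ''Y'')))))
       (ISet ''T'' (IAdd (wv ''Y'') (ICon 1)) (IAdd (IGet ''T'' (wv ''Y'')) (IGet ''T'' (wv ''Y''))) ;;
        setw ''Y'' (IAdd (wv ''Y'') (ICon 1))) ;;
     setw ''A'' (ICon 0) ;;
     While (ILess (ICon 0) (wv ''Y''))
       (setw ''Y'' (ISub (wv ''Y'') (ICon 1)) ;;
        Cond (RLess (rv ''t'') (ROf (IAdd (wv ''A'') (IGet ''T'' (wv ''Y''))))) Skip
          (setw ''A'' (IAdd (wv ''A'') (IGet ''T'' (wv ''Y''))))))"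

lemma conv_names [simp]: "word_names conv_prog = {''T'', ''Y'', ''A''}" "real_names conv_prog = {}"
  by (auto simp: conv_prog_def)

text \<open>In place of rounding, powers of two are doubled until they exceed the number, and its
  binary digits are then fixed greedily from the top. This costs one logarithmic factor per
  letter.\<close>

lemma run_conv:
  assumes t: "reals s ''t'' 0 = real k" and k: "k < 2^L"
  shows "run conv_prog s (200 * (L + 1)) (\<lambda>s'. words s' ''A'' 0 = k)"
proof -
  define e where "e = (LEAST e. k < 2^e)"
  have e: "k < 2^e" and eL: "e \<le> L" unfolding e_def using k by (rule LeastI, rule Least_le)
  have less: "2^i \<le> k" if "i < e" for i
    using not_less_Least[OF that[unfolded e_def]] by simp
  let ?b1 = "BNot (RLess (rv ''t'') (ROf (IGet ''T'' (wv ''Y''))))"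
  let ?c1 = "ISet ''T'' (IAdd (wv ''Y'') (ICon 1)) (IAdd (IGet ''T'' (wv ''Y'')) (IGet ''T'' (wv ''Y''))) ;;
        setw ''Y'' (IAdd (wv ''Y'') (ICon 1))"
  let ?b2 = "ILess (ICon 0) (wv ''Y'')"
  let ?c2 = "setw ''Y'' (ISub (wv ''Y'') (ICon 1)) ;;
        Cond (RLess (rv ''t'') (ROf (IAdd (wv ''A'') (IGet ''T'' (wv ''Y''))))) Skip
          (setw ''A'' (IAdd (wv ''A'') (IGet ''T'' (wv ''Y''))))"
  let ?s0 = "effect (ISet ''T'' (ICon 0) (ICon 1) ;; setw ''Y'' (ICon 0)) s"
  let ?P1 = "\<lambda>i s'. words s' ''Y'' 0 = i \<and> (\<forall>j\<le>i. words s' ''T'' j = 2^j)"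
  have 1: "run (While ?b1 ?c1) ?s0 (60 * (e + 1)) (?P1 e)"
  proof (rule run_While_count[where P = ?P1 and k = e and B = "\<lambda>_. 30"])
    fix i s' assume i: "i < e" and P: "?P1 i s'" and fr: "frame ?c1 ?s0 s'"
    have "bval ?b1 s'" using P less[OF i] frame_reals[OF fr] t by (simp flip: of_nat_power)
    moreover have "run ?c1 s' 30 (?P1 (Suc i))"
      by (rule run_loopfree) (use P in \<open>auto simp: le_Suc_eq\<close>)
    ultimately show "bval ?b1 s' \<and> run ?c1 s' 30 (?P1 (Suc i))" by blast
  next
    fix s' assume P: "?P1 e s'" and fr: "frame ?c1 ?s0 s'"
    have "real k < real (2^e)" using e by (simp only: of_nat_less_iff)
    then show "\<not> bval ?b1 s'" using P frame_reals[OF fr] t by simp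
  qed simp_all
  have 2: "run (While ?b2 ?c2) s' (60 * (e + 1)) (\<lambda>s'. words s' ''A'' 0 = k)"
    if "?P1 e s'" "words s' ''A'' 0 = 0" "reals s' ''t'' 0 = real k" for s'
  proof (rule run_mono[where B = "60 * (e + 1)"])
    \<comment> \<open>The window [A, A + 2^(e - i)) around \<open>k\<close> shrinks by half in each
      step and ends as a single point.\<close>
    let ?P = "\<lambda>i s'. words s' ''Y'' 0 = e - i \<and> words s' ''A'' 0 \<le> k \<and> k < words s' ''A'' 0 + 2^(e - i)"
    show "run (While ?b2 ?c2) s' (60 * (e + 1)) (?P e)"
    proof (rule run_While_count[where P = ?P and k = e and B = "\<lambda>_. 45"])
      fix i s2 assume i: "i < e" and P: "?P i s2" and fr: "frame ?c2 s' s2"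
      have t2: "reals s2 ''t'' 0 = real k" using frame_reals[OF fr] that by simp
      define y where "y = e - Suc i"
      have y: "e - i = Suc y" "y \<le> e" using i by (auto simp: y_def)
      have T: "words s2 ''T'' y = 2^y" using frame_words[OF fr] that(1) y by simp
      have A: "words s2 ''A'' 0 \<le> k" "k < words s2 ''A'' 0 + (2^y + 2^y)" using P y by auto
      have lt: "(real k < real (words s2 ''A'' 0) + 2^y) = (k < words s2 ''A'' 0 + 2^y)"
        by (metis of_nat_add of_nat_less_iff of_nat_numeral of_nat_power)
      have "bval ?b2 s2" using P i by simp
      moreover have "run ?c2 s2 45 (?P (Suc i))"
        by (rule run_loopfree) (use P y t2 T A lt in \<open>auto simp: y_def[symmetric]\<close>)
      ultimately show "bval ?b2 s2 \<and> run ?c2 s2 45 (?P (Suc i))" by blast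
    qed (use that e in auto)
  qed auto
  show ?thesis unfolding conv_prog_def
  proof (rule run_loopfree_Seq[where B = "130 * (e + 1)"])
    show "run (While ?b1 ?c1 ;; setw ''A'' (ICon 0) ;; While ?b2 ?c2) ?s0 (130 * (e + 1)) (\<lambda>s'. words s' ''A'' 0 = k)"
    proof (rule run_then[OF 1])
      fix s1 assume P: "?P1 e s1" and fr: "frame (While ?b1 ?c1) ?s0 s1"
      have "reals s1 ''t'' 0 = real k" using frame_reals[OF fr] t by simp
      then show "run (setw ''A'' (ICon 0) ;; While ?b2 ?c2) s1 (60 * (e + 1) + 7) (\<lambda>s'. words s' ''A'' 0 = k)"
        by (intro run_loopfree_Seq[OF _ 2]) (use P in auto)
    qed simp
  qed (use eL in auto)
qed

fun running_max :: "'b::linorder \<Rightarrow> (nat \<Rightarrow> 'b) \<Rightarrow> nat \<Rightarrow> 'b" where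
  "running_max z f 0 = z"
| "running_max z f (Suc n) = max (running_max z f n) (f n)"

lemma running_max_ge: "j < n \<Longrightarrow> f j \<le> running_max z f n"
  by (induction n) (auto simp: less_Suc_eq le_max_iff_disj)

lemma running_max_eq: "running_max z f n = Max (insert z (f ` {..<n}))"
proof (induction n)
  case (Suc n)
  have "insert z (f ` {..<Suc n}) = insert (f n) (insert z (f ` {..<n}))" by (auto simp: lessThan_Suc)
  then show ?case using Suc by (simp add: max.commute)
qed simp

text \<open>
  \<open>sz i\<close> is the size of the \<open>i\<close>th alphabet, \<open>pt\<close> the concatenated probability table, and
  \<open>ex\<close> the concatenated table of the numbers \<open>(s\<^sub>i(a) - min s\<^sub>i) / h\<close>.
\<close>

locale level_data =
  fixes m :: nat and sz :: "nat \<Rightarrow> nat" and pt :: "nat \<Rightarrow> real" and h :: real and ex :: "nat \<Rightarrow> nat"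
  assumes h: "h > 0"
    and sz: "\<And>i. i < m \<Longrightarrow> sz i > 0"
    and ex: "\<And>i j. i < m \<Longrightarrow> j < sz i \<Longrightarrow>
      ln (running_max 0 (\<lambda>j. pt ((\<Sum>a<i. sz a) + j)) (sz i)) - ln (pt ((\<Sum>a<i. sz a) + j)) = h * real (ex ((\<Sum>a<i. sz a) + j))"
begin

definition off :: "nat \<Rightarrow> nat" where "off i = (\<Sum>a<i. sz a)"
definition deg :: "nat \<Rightarrow> nat" where "deg i = running_max 0 (\<lambda>j. ex (off i + j)) (sz i)"
definition D :: nat where "D = (\<Sum>i<m. deg i)"
text \<open>The generating polynomial of one coordinate. With all weights 1 the product over the
  coordinates counts keys by level, with the weights \<open>pt\<close> it collects their
  probabilities. Letters of equal surprisal add up in one coefficient.\<close>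

definition factor :: "(nat \<Rightarrow> real) \<Rightarrow> nat \<Rightarrow> real poly" where
  "factor wt i = (\<Sum>j<sz i. monom (wt (off i + j)) (ex (off i + j)))"

lemma deg_ge: "j < sz i \<Longrightarrow> ex (off i + j) \<le> deg i"
  unfolding deg_def by (rule running_max_ge)

lemma deg_le: "i < m \<Longrightarrow> deg i \<le> D"
  unfolding D_def by (rule member_le_sum) auto

lemma degree_factor: "degree (factor wt i) \<le> deg i"
  unfolding factor_def
  by (rule degree_sum_le) (auto intro: order.trans[OF degree_monom_le] deg_ge)

definition input :: "store \<Rightarrow> bool" where
  "input s \<longleftrightarrow> words s ''m'' 0 = m \<and> (\<forall>i<m. words s ''size'' i = sz i) \<and>
     reals s ''h'' 0 = h \<and> (\<forall>i<off m. reals s ''p'' i = pt i)"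

lemma off_Suc: "off (Suc i) = off i + sz i"
  by (simp add: off_def)

lemma off_le: "i < m \<Longrightarrow> off i + sz i \<le> off m"
  unfolding off_Suc[symmetric] unfolding off_def by (rule sum_mono2) auto

end

definition pre_body :: com where
  "pre_body = (setr ''M'' (ROf (ICon 0)) ;;
     For ''j'' (IGet ''size'' (wv ''i''))
       (Cond (RLess (rv ''M'') (RGet ''p'' (IAdd (wv ''o'') (wv ''j'')))) (setr ''M'' (RGet ''p'' (IAdd (wv ''o'') (wv ''j'')))) Skip) ;;
     setw ''c'' (ICon 0) ;;
     For ''j'' (IGet ''size'' (wv ''i''))
       (setr ''t'' (RDiv (RSub (RLn (rv ''M'')) (RLn (RGet ''p'' (IAdd (wv ''o'') (wv ''j''))))) (rv ''h'')) ;;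
        conv_prog ;;
        (ISet ''X'' (IAdd (wv ''o'') (wv ''j'')) (wv ''A'') ;;
         Cond (ILess (wv ''c'') (wv ''A'')) (setw ''c'' (wv ''A'')) Skip)) ;;
     (ISet ''l'' (wv ''i'') (IAdd (wv ''c'') (ICon 1)) ;;
      setw ''D'' (IAdd (wv ''D'') (wv ''c'')) ;;
      setw ''o'' (IAdd (wv ''o'') (IGet ''size'' (wv ''i'')))))"

definition pre_prog :: com where
  "pre_prog = ((setw ''o'' (ICon 0) ;; setw ''D'' (ICon 0)) ;; For ''i'' (wv ''m'') pre_body)"

lemma pre_names [simp]:
  "word_names pre_body = {''j'', ''c'', ''X'', ''l'', ''D'', ''o'', ''T'', ''Y'', ''A''}" "real_names pre_body = {''M'', ''t''}"
  "word_names pre_prog = {''i'', ''j'', ''c'', ''X'', ''l'', ''D'', ''o'', ''T'', ''Y'', ''A''}" "real_names pre_prog = {''M'', ''t''}"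
  by (auto simp: pre_body_def pre_prog_def)

text \<open>The block is cleared before use, because \<open>f\<close> may hold remains of the
  earlier product, and it is then filled by addition, because several letters may share an exponent.
  The weight is an expression, so one program text serves both products.\<close>

definition fill_body :: "rexp \<Rightarrow> com" where
  "fill_body w = (For ''j'' (IGet ''l'' (wv ''i'')) (RSet ''f'' (IAdd (wv ''q'') (wv ''j'')) (ROf (ICon 0))) ;;
     For ''j'' (IGet ''size'' (wv ''i''))
       (let x = IAdd (wv ''q'') (IGet ''X'' (IAdd (wv ''o'') (wv ''j''))) in RSet ''f'' x (RAdd (RGet ''f'' x) w)) ;;
     (setw ''q'' (IAdd (wv ''q'') (IGet ''l'' (wv ''i''))) ;;
      setw ''o'' (IAdd (wv ''o'') (IGet ''size'' (wv ''i'')))))"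

definition fill_prog :: "rexp \<Rightarrow> com" where
  "fill_prog w = ((setw ''o'' (ICon 0) ;; setw ''q'' (ICon 0)) ;; For ''i'' (wv ''m'') (fill_body w) ;;
     (setw ''i'' (ICon 0) ;; setw ''t'' (wv ''m'') ;; setw ''o'' (ICon 0)))"

lemma fill_names [simp]:
  "word_names (fill_body w) = {''j'', ''q'', ''o''}" "real_names (fill_body w) = {''f''}"
  "word_names (fill_prog w) = {''i'', ''j'', ''q'', ''o'', ''t''}" "real_names (fill_prog w) = {''f''}"
  by (auto simp: fill_body_def fill_prog_def Let_def)

context level_data
begin

text \<open>Two passes over an alphabet: the first finds the largest probability, whose logarithm is
  minus the least surprisal; the second converts the differences of logarithms into exponents and
  tracks their maximum. The block length is one more than that maximum.\<close>

lemma run_pre_body: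
  assumes inp: "input s" and i: "i < m" "words s ''i'' 0 = i" "words s ''o'' 0 = off i" and L: "D < 2^L"
  shows "run pre_body s (400 * (L + 1) * (sz i + 1)) (\<lambda>s'.
     (\<forall>j<sz i. words s' ''X'' (off i + j) = ex (off i + j)) \<and> (\<forall>j<off i. words s' ''X'' j = words s ''X'' j) \<and>
     words s' ''l'' = (words s ''l'')(i := deg i + 1) \<and> words s' ''D'' 0 = words s ''D'' 0 + deg i \<and>
     words s' ''o'' 0 = off (Suc i))" (is "run _ _ _ ?Q")
proof -
  let ?pt = "\<lambda>j. pt (off i + j)" and ?ex = "\<lambda>j. ex (off i + j)"
  let ?c1 = "Cond (RLess (rv ''M'') (RGet ''p'' (IAdd (wv ''o'') (wv ''j'')))) (setr ''M'' (RGet ''p'' (IAdd (wv ''o'') (wv ''j'')))) Skip"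
  let ?conv = "conv_prog ;;
        (ISet ''X'' (IAdd (wv ''o'') (wv ''j'')) (wv ''A'') ;;
         Cond (ILess (wv ''c'') (wv ''A'')) (setw ''c'' (wv ''A'')) Skip)"
  let ?c2 = "setr ''t'' (RDiv (RSub (RLn (rv ''M'')) (RLn (RGet ''p'' (IAdd (wv ''o'') (wv ''j''))))) (rv ''h'')) ;; ?conv"
  let ?tail = "ISet ''l'' (wv ''i'') (IAdd (wv ''c'') (ICon 1)) ;;
      setw ''D'' (IAdd (wv ''D'') (wv ''c'')) ;;
      setw ''o'' (IAdd (wv ''o'') (IGet ''size'' (wv ''i'')))"
  let ?n = "IGet ''size'' (wv ''i'')"
  have s: "words s ''size'' i = sz i" "\<And>j. j < sz i \<Longrightarrow> reals s ''p'' (off i + j) = ?pt j" "reals s ''h'' 0 = h"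
    using inp i off_le[OF i(1)] unfolding input_def by auto
  let ?s0 = "effect (setr ''M'' (ROf (ICon 0))) s"
  have 1: "run (For ''j'' ?n ?c1) ?s0 (60 * (sz i + 1)) (\<lambda>s'. reals s' ''M'' 0 = running_max 0 ?pt (sz i))"
  proof (rule run_For[where k = "sz i" and B = "\<lambda>_. 40" and P = "\<lambda>k s'. reals s' ''M'' 0 = running_max 0 ?pt k"])
    fix k s' assume k: "k < sz i" "words s' ''j'' 0 = k" and P: "reals s' ''M'' 0 = running_max 0 ?pt k"
      and fr: "frame (For ''j'' ?n ?c1) ?s0 s'"
    have "reals s' ''p'' (off i + k) = ?pt k" "words s' ''o'' 0 = off i"
      using frame_words[OF fr] frame_reals[OF fr] s(2)[OF k(1)] i by simp_all
    then show "run ?c1 s' 40 (\<lambda>s''. reals (set_word ''j'' 0 (Suc k) s'') ''M'' 0 = running_max 0 ?pt (Suc k))"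
      using k P by (intro run_loopfree) (auto simp: max_def)
  next
    fix k s' assume "frame (For ''j'' ?n ?c1) ?s0 s'"
    from frame_words[OF this] s i show "ival ?n s' = sz i" by simp
  qed simp_all
  let ?P = "\<lambda>k s'. words s' ''c'' 0 = running_max 0 ?ex k \<and> (\<forall>j<k. words s' ''X'' (off i + j) = ?ex j) \<and>
      (\<forall>j<off i. words s' ''X'' j = words s ''X'' j)"
  have 2: "run (For ''j'' ?n ?c2) s1 (300 * (L + 1) * (sz i + 1)) (?P (sz i))"
    if s1: "reals s1 ''M'' 0 = running_max 0 ?pt (sz i)" "reals s1 ''p'' = reals s ''p''" "reals s1 ''h'' = reals s ''h''"
      "words s1 ''size'' = words s ''size''" "words s1 ''i'' = words s ''i''" "words s1 ''o'' = words s ''o''"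
      "words s1 ''X'' = words s ''X''" "words s1 ''c'' 0 = 0" for s1
  proof (rule run_For[where k = "sz i" and B = "\<lambda>_. 200 * (L + 1) + 60" and P = ?P])
    fix k s2 assume k: "k < sz i" "words s2 ''j'' 0 = k" and P: "?P k s2"
      and fr: "frame (For ''j'' ?n ?c2) s1 s2"
    let ?s3 = "effect (setr ''t'' (RDiv (RSub (RLn (rv ''M'')) (RLn (RGet ''p'' (IAdd (wv ''o'') (wv ''j''))))) (rv ''h''))) s2"
    have w: "reals s2 ''p'' (off i + k) = ?pt k" "words s2 ''o'' 0 = off i" "reals s2 ''M'' 0 = running_max 0 ?pt (sz i)" "reals s2 ''h'' 0 = h"
      using frame_words[OF fr] frame_reals[OF fr] s(2)[OF k(1)] s(3) i s1 by simp_all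
    have t: "reals ?s3 ''t'' 0 = real (?ex k)"
      using w k h ex[OF i(1) k(1)] by (simp add: off_def)
    have less: "?ex k < 2^L" using deg_ge[OF k(1)] deg_le[OF i(1)] L by linarith
    show "run ?c2 s2 (200 * (L + 1) + 60) (\<lambda>s''. ?P (Suc k) (set_word ''j'' 0 (Suc k) s''))"
    proof (rule run_loopfree_Seq[where B = "200 * (L + 1) + 42", OF _ run_then[OF run_conv[OF t less]]])
      fix s4 assume A: "words s4 ''A'' 0 = ?ex k" and fr4: "frame conv_prog ?s3 s4"
      have w4: "words s4 ''o'' 0 = off i" "words s4 ''j'' 0 = k" "words s4 ''X'' = words s2 ''X''"
         "words s4 ''c'' = words s2 ''c''"
        using frame_words[OF fr4] w k by simp_all
      show "run (ISet ''X'' (IAdd (wv ''o'') (wv ''j'')) (wv ''A'') ;;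
         Cond (ILess (wv ''c'') (wv ''A'')) (setw ''c'' (wv ''A'')) Skip) s4 40
          (\<lambda>s''. ?P (Suc k) (set_word ''j'' 0 (Suc k) s''))"
        by (rule run_loopfree) (use w4 A P k in \<open>auto simp: max_def less_Suc_eq\<close>)
    qed simp_all
  next
    fix k s' assume "frame (For ''j'' ?n ?c2) s1 s'"
    from frame_words[OF this] s i s1 show "ival ?n s' = sz i" by simp
  qed (use s1 in \<open>simp_all add: algebra_simps\<close>)
  show ?thesis unfolding pre_body_def
  proof (rule run_loopfree_Seq[where B = "60 * (sz i + 1) + 300 * (L + 1) * (sz i + 1) + 50", OF _ run_then[OF 1]])
    fix s1 assume M: "reals s1 ''M'' 0 = running_max 0 ?pt (sz i)" and fr1: "frame (For ''j'' ?n ?c1) ?s0 s1"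
    note f1 = frame_words[OF fr1] frame_reals[OF fr1]
    let ?s2 = "effect (setw ''c'' (ICon 0)) s1"
    have "run (For ''j'' ?n ?c2) ?s2 (300 * (L + 1) * (sz i + 1)) (?P (sz i))"
      by (rule 2) (use M in \<open>simp_all add: f1\<close>)
    note 3 = this
    show "run (setw ''c'' (ICon 0) ;; For ''j'' ?n ?c2 ;; ?tail) s1 (300 * (L + 1) * (sz i + 1) + 49) ?Q"
    proof (rule run_loopfree_Seq[where B = "300 * (L + 1) * (sz i + 1) + 43", OF _ run_then[OF 3]])
      fix s3 assume P: "?P (sz i) s3" and fr3: "frame (For ''j'' ?n ?c2) ?s2 s3"
      have w3: "words s3 ''i'' 0 = i" "words s3 ''l'' = words s ''l''" "words s3 ''D'' = words s ''D''" "words s3 ''o'' 0 = off i"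
        "words s3 ''size'' i = sz i"
        using frame_words[OF fr3] s i by (simp_all add: f1)
      show "run ?tail s3 42 ?Q"
        by (rule run_loopfree) (use w3 P in \<open>auto simp: off_Suc deg_def\<close>)
    qed simp_all
  qed (use sz[OF i(1)] in \<open>simp_all add: algebra_simps\<close>)
qed

text \<open>The tables that both product computations read and that must outlive the first
  one.\<close>

definition prepared :: "store \<Rightarrow> bool" where
  "prepared s \<longleftrightarrow> input s \<and> (\<forall>j<off m. words s ''X'' j = ex j) \<and> (\<forall>i<m. words s ''l'' i = deg i + 1) \<and> words s ''D'' 0 = D"

lemma sum_sz: "(\<Sum>i<m. c * (sz i + 1)) = c * (off m + m)"
  unfolding sum_distrib_left[symmetric] sum.distrib off_def by simp

lemma input_cong: "input s \<Longrightarrow> words s' ''m'' = words s ''m'' \<Longrightarrow> words s' ''size'' = words s ''size'' \<Longrightarrow>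
    reals s' ''h'' = reals s ''h'' \<Longrightarrow> reals s' ''p'' = reals s ''p'' \<Longrightarrow> input s'"
  by (simp add: input_def)

lemma run_pre:
  assumes inp: "input s" and L: "D < 2^L"
  shows "run pre_prog s (500 * (L + 1) * (off m + m + 1)) prepared"
proof -
  let ?s0 = "effect (setw ''o'' (ICon 0) ;; setw ''D'' (ICon 0)) s"
  let ?P = "\<lambda>i s'. words s' ''o'' 0 = off i \<and> words s' ''D'' 0 = (\<Sum>a<i. deg a) \<and>
     (\<forall>j<off i. words s' ''X'' j = ex j) \<and> (\<forall>a<i. words s' ''l'' a = deg a + 1)"
  have "run (For ''i'' (wv ''m'') pre_body) ?s0 (450 * (L + 1) * (off m + m + 1)) (?P m)"
  proof (rule run_For[where P = ?P and k = m and B = "\<lambda>i. 400 * (L + 1) * (sz i + 1)"])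
    show "?P 0 (set_word ''i'' 0 0 ?s0)" by (simp add: off_def)
  next
    fix i s' assume i: "i < m" "words s' ''i'' 0 = i" and P: "?P i s'" and fr: "frame (For ''i'' (wv ''m'') pre_body) ?s0 s'"
    have inp': "input s'"
      by (rule input_cong[OF inp]) (use frame_words[OF fr] frame_reals[OF fr] in simp_all)
    show "run pre_body s' (400 * (L + 1) * (sz i + 1)) (\<lambda>s''. ?P (Suc i) (set_word ''i'' 0 (Suc i) s''))"
    proof (rule run_mono[OF run_pre_body[OF inp' i _ L] order_refl])
      show "words s' ''o'' 0 = off i" using P by simp
    next
      fix s2 :: store assume Q: "(\<forall>j<sz i. words s2 ''X'' (off i + j) = ex (off i + j)) \<and> (\<forall>j<off i. words s2 ''X'' j = words s' ''X'' j) \<and>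
         words s2 ''l'' = (words s' ''l'')(i := deg i + 1) \<and> words s2 ''D'' 0 = words s' ''D'' 0 + deg i \<and>
         words s2 ''o'' 0 = off (Suc i)"
      have "words s2 ''X'' j = ex j" if "j < off (Suc i)" for j
      proof (cases "j < off i")
        case False
        then have "j - off i < sz i" "j = off i + (j - off i)" using that by (auto simp: off_Suc)
        then show ?thesis using Q by metis
      qed (use P Q in auto)
      then show "?P (Suc i) (set_word ''i'' 0 (Suc i) s2)" using P Q by (auto simp: less_Suc_eq)
    qed
  next
    fix i s' assume "frame (For ''i'' (wv ''m'') pre_body) ?s0 s'"
    from frame_words[OF this] inp show "ival (wv ''m'') s' = m" by (simp add: input_def)
  next
    have "(\<Sum>i<m. 400 * (L + 1) * (sz i + 1) + (11 + icost (wv ''m''))) + (11 + icost (wv ''m''))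
        = 400 * (L + 1) * (off m + m) + 13 * m + 13"
      unfolding sum.distrib sum_sz by simp
    also have "\<dots> \<le> 450 * (L + 1) * (off m + m + 1)" by (simp add: algebra_simps)
    finally show "(\<Sum>i<m. 400 * (L + 1) * (sz i + 1) + (11 + icost (wv ''m''))) + (11 + icost (wv ''m'')) \<le> 450 * (L + 1) * (off m + m + 1)" .
  qed simp_all
  note main = this
  have 1: "run (For ''i'' (wv ''m'') pre_body) ?s0 (450 * (L + 1) * (off m + m + 1)) prepared"
  proof (rule run_weaken[OF main order_refl])
    fix s' assume P: "?P m s'" and fr: "frame (For ''i'' (wv ''m'') pre_body) ?s0 s'"
    have "input s'"
      by (rule input_cong[OF inp]) (use frame_words[OF fr] frame_reals[OF fr] in simp_all)
    with P show "prepared s'" by (simp add: prepared_def D_def)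
  qed
  show ?thesis unfolding pre_prog_def
    by (rule run_loopfree_Seq[OF _ 1]) (simp_all add: algebra_simps)
qed

definition leaves :: "(nat \<Rightarrow> real) \<Rightarrow> nat \<Rightarrow> (real poly \<times> nat) list" where
  "leaves wt i = map (\<lambda>a. (factor wt a, deg a + 1)) [0..<i]"

lemma sum_len: "(\<Sum>a<i. deg a + 1) = (\<Sum>a<i. deg a) + i"
  unfolding sum.distrib by simp

lemma sum_leaves: "sum_list (map snd (leaves wt i)) = (\<Sum>a<i. deg a) + i"
  unfolding sum_len[symmetric] leaves_def by (simp add: o_def sum_list_distinct_conv_sum_set atLeast0LessThan)

lemma run_fill_body:
  assumes P: "prepared s" and i: "i < m" "words s ''i'' 0 = i" "words s ''o'' 0 = off i" "words s ''q'' 0 = q"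
    and w: "\<And>s' j. reals s' ''p'' = reals s ''p'' \<Longrightarrow> words s' ''o'' 0 = off i \<Longrightarrow> words s' ''j'' 0 = j \<Longrightarrow>
         j < sz i \<Longrightarrow> rval w s' = wt (off i + j)"
    and cost: "rcost w \<le> 10"
  shows "run (fill_body w) s (100 * (sz i + 1) + 100 * (deg i + 1)) (\<lambda>s'.
     (\<forall>j<deg i + 1. reals s' ''f'' (q + j) = coeff (factor wt i) j) \<and> (\<forall>j<q. reals s' ''f'' j = reals s ''f'' j) \<and>
     words s' ''q'' 0 = q + (deg i + 1) \<and> words s' ''o'' 0 = off (Suc i))" (is "run _ _ _ ?Q")
proof -
  let ?nl = "IGet ''l'' (wv ''i'')" and ?ns = "IGet ''size'' (wv ''i'')"
  let ?c1 = "RSet ''f'' (IAdd (wv ''q'') (wv ''j'')) (ROf (ICon 0))"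
  let ?x = "IAdd (wv ''q'') (IGet ''X'' (IAdd (wv ''o'') (wv ''j'')))"
  let ?c2 = "RSet ''f'' ?x (RAdd (RGet ''f'' ?x) w)"
  let ?tail = "setw ''q'' (IAdd (wv ''q'') (IGet ''l'' (wv ''i''))) ;;
      setw ''o'' (IAdd (wv ''o'') (IGet ''size'' (wv ''i'')))"
  let ?part = "\<lambda>k. \<Sum>j<k. monom (wt (off i + j)) (ex (off i + j))"
  have s: "words s ''size'' i = sz i" "words s ''l'' i = deg i + 1"
    "\<And>j. j < sz i \<Longrightarrow> words s ''X'' (off i + j) = ex (off i + j)"
    using P i off_le[OF i(1)] unfolding prepared_def input_def by auto
  have 1: "run (For ''j'' ?nl ?c1) s (40 * (deg i + 1) + 20) (\<lambda>s'.
      (\<forall>j<deg i + 1. reals s' ''f'' (q + j) = 0) \<and> (\<forall>j<q. reals s' ''f'' j = reals s ''f'' j))"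
  proof (rule run_For[where k = "deg i + 1" and B = "\<lambda>_. 20" and P = "\<lambda>k s'.
      (\<forall>j<k. reals s' ''f'' (q + j) = 0) \<and> (\<forall>j<q. reals s' ''f'' j = reals s ''f'' j)"])
    fix k s' assume k: "words s' ''j'' 0 = k"
      and P: "(\<forall>j<k. reals s' ''f'' (q + j) = 0) \<and> (\<forall>j<q. reals s' ''f'' j = reals s ''f'' j)"
      and fr: "frame (For ''j'' ?nl ?c1) s s'"
    have "words s' ''q'' 0 = q" using frame_words[OF fr] i by simp
    then show "run ?c1 s' 20 (\<lambda>s''. (\<forall>j<Suc k. reals (set_word ''j'' 0 (Suc k) s'') ''f'' (q + j) = 0) \<and>
       (\<forall>j<q. reals (set_word ''j'' 0 (Suc k) s'') ''f'' j = reals s ''f'' j))"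
      using k P by (intro run_loopfree) (auto simp: less_Suc_eq)
  next
    fix k s' assume "frame (For ''j'' ?nl ?c1) s s'"
    from frame_words[OF this] s i show "ival ?nl s' = deg i + 1" by simp
  qed simp_all
  have 2: "run (For ''j'' ?ns ?c2) s1 (80 * (sz i + 1)) (\<lambda>s'.
      (\<forall>j<deg i + 1. reals s' ''f'' (q + j) = coeff (?part (sz i)) j) \<and> (\<forall>j<q. reals s' ''f'' j = reals s ''f'' j))"
    if s1: "\<forall>j<deg i + 1. reals s1 ''f'' (q + j) = 0" "\<forall>j<q. reals s1 ''f'' j = reals s ''f'' j"
      "frame (For ''j'' ?nl ?c1) s s1" for s1
  proof (rule run_For[where k = "sz i" and B = "\<lambda>_. 50" and P = "\<lambda>k s'.
      (\<forall>j<deg i + 1. reals s' ''f'' (q + j) = coeff (?part k) j) \<and> (\<forall>j<q. reals s' ''f'' j = reals s ''f'' j)"])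
    fix k s' assume k: "k < sz i" "words s' ''j'' 0 = k"
      and P: "(\<forall>j<deg i + 1. reals s' ''f'' (q + j) = coeff (?part k) j) \<and> (\<forall>j<q. reals s' ''f'' j = reals s ''f'' j)"
      and fr: "frame (For ''j'' ?ns ?c2) s1 s'"
    have f: "words s' ''q'' 0 = q" "words s' ''o'' 0 = off i" "words s' ''X'' (off i + k) = ex (off i + k)"
      using frame_words[OF fr] frame_words[OF s1(3)] i s(3)[OF k(1)] by simp_all
    have "reals s' ''p'' = reals s ''p''" using frame_reals[OF fr] frame_reals[OF s1(3)] by simp
    note v = w[OF this f(2) k(2,1)]
    have "ex (off i + k) < deg i + 1" using deg_ge[OF k(1)] by simp
    with P have "reals s' ''f'' (q + ex (off i + k)) = coeff (?part k) (ex (off i + k))" by blast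
    then show "run ?c2 s' 50 (\<lambda>s''. (\<forall>j<deg i + 1. reals (set_word ''j'' 0 (Suc k) s'') ''f'' (q + j) = coeff (?part (Suc k)) j) \<and>
       (\<forall>j<q. reals (set_word ''j'' 0 (Suc k) s'') ''f'' j = reals s ''f'' j))"
      using k P cost f v by (intro run_loopfree) auto
  next
    fix k s' assume "frame (For ''j'' ?ns ?c2) s1 s'"
    from frame_words[OF this] frame_words[OF s1(3)] s i show "ival ?ns s' = sz i" by simp
  qed (use s1 in auto)
  show ?thesis unfolding fill_body_def Let_def
  proof (rule run_then[OF 1])
    fix s1 assume s1: "(\<forall>j<deg i + 1. reals s1 ''f'' (q + j) = 0) \<and> (\<forall>j<q. reals s1 ''f'' j = reals s ''f'' j)"
      "frame (For ''j'' ?nl ?c1) s s1"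
    show "run (For ''j'' ?ns ?c2 ;; ?tail) s1 (80 * (sz i + 1) + 40) ?Q"
    proof (rule run_then[OF 2[OF conjunct1[OF s1(1)] conjunct2[OF s1(1)] s1(2)]])
      fix s2 assume 3: "(\<forall>j<deg i + 1. reals s2 ''f'' (q + j) = coeff (?part (sz i)) j) \<and> (\<forall>j<q. reals s2 ''f'' j = reals s ''f'' j)"
        and fr: "frame (For ''j'' ?ns ?c2) s1 s2"
      have "words s2 ''q'' 0 = q" "words s2 ''o'' 0 = off i" "words s2 ''l'' i = deg i + 1" "words s2 ''size'' i = sz i" "words s2 ''i'' 0 = i"
        using frame_words[OF fr] frame_words[OF s1(2)] s i by simp_all
      then show "run ?tail s2 39 ?Q" using 3
        by (intro run_loopfree) (simp_all add: factor_def off_Suc)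
    qed simp
  qed simp
qed

lemma run_fill:
  assumes P: "prepared s"
    and w: "\<And>s' i j. reals s' ''p'' = reals s ''p'' \<Longrightarrow> words s' ''o'' 0 = off i \<Longrightarrow> words s' ''j'' 0 = j \<Longrightarrow>
         i < m \<Longrightarrow> j < sz i \<Longrightarrow> rval w s' = wt (off i + j)"
    and cost: "rcost w \<le> 10"
  shows "run (fill_prog w) s (200 * (off m + D + 2 * m + 1)) (\<lambda>s'.
     queue s' 0 0 (leaves wt m) m (D + m) \<and> words s' ''i'' 0 = 0 \<and> words s' ''o'' 0 = 0 \<and>
     words s' ''t'' 0 = m \<and> words s' ''q'' 0 = D + m)" (is "run _ _ _ ?Q")
proof -
  let ?s0 = "effect (setw ''o'' (ICon 0) ;; setw ''q'' (ICon 0)) s"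
  let ?q = "\<lambda>i. (\<Sum>a<i. deg a) + i"
  let ?P = "\<lambda>i s'. words s' ''o'' 0 = off i \<and> words s' ''q'' 0 = ?q i \<and> queue s' 0 0 (leaves wt i) i (?q i)"
  let ?F = "For ''i'' (wv ''m'') (fill_body w)"
  let ?tail = "setw ''i'' (ICon 0) ;; setw ''t'' (wv ''m'') ;; setw ''o'' (ICon 0)"
  have prep: "prepared s'" if "frame ?F ?s0 s'" for s'
    using P frame_words[OF that] frame_reals[OF that] by (simp add: prepared_def input_def)
  have 1: "run ?F ?s0 (150 * (off m + D + 2 * m + 1)) (?P m)"
  proof (rule run_For[where P = ?P and k = m and B = "\<lambda>i. 100 * (sz i + 1) + 100 * (deg i + 1)"])
    show "?P 0 (set_word ''i'' 0 0 ?s0)" by (simp add: off_def leaves_def)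
  next
    fix i s' assume i: "i < m" "words s' ''i'' 0 = i" and P': "?P i s'" and fr: "frame ?F ?s0 s'"
    have p: "reals s' ''p'' = reals s ''p''" using frame_reals[OF fr] by simp
    have l: "words s' ''l'' i = deg i + 1" using prep[OF fr] i by (simp add: prepared_def)
    have o: "words s' ''o'' 0 = off i" "words s' ''q'' 0 = ?q i" using P' by auto
    show "run (fill_body w) s' (100 * (sz i + 1) + 100 * (deg i + 1)) (\<lambda>s''. ?P (Suc i) (set_word ''i'' 0 (Suc i) s''))"
    proof (rule run_weaken[OF run_fill_body[where wt = wt, OF prep[OF fr] i o _ cost] order_refl])
      fix s2 :: store and j assume "reals s2 ''p'' = reals s' ''p''" "words s2 ''o'' 0 = off i" "words s2 ''j'' 0 = j" "j < sz i"
      then show "rval w s2 = wt (off i + j)" using w i p by simp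
    next
      fix s2 :: store assume Q: "(\<forall>j<deg i + 1. reals s2 ''f'' (?q i + j) = coeff (factor wt i) j) \<and> (\<forall>j<?q i. reals s2 ''f'' j = reals s' ''f'' j) \<and>
          words s2 ''q'' 0 = ?q i + (deg i + 1) \<and> words s2 ''o'' 0 = off (Suc i)"
        and fr2: "frame (fill_body w) s' s2"
      let ?s3 = "set_word ''i'' 0 (Suc i) s2"
      have l3: "words ?s3 ''l'' = words s' ''l''" using frame_words[OF fr2] by simp
      have "queue ?s3 0 0 (leaves wt i @ [(factor wt i, deg i + 1)]) (Suc i) (?q i + (deg i + 1))"
      proof (rule queue_append)
        show "queue ?s3 0 0 (leaves wt i) i (?q i)"
          by (rule queue_cong[OF P'[THEN conjunct2, THEN conjunct2]]) (use Q l3 in auto)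
        show "words ?s3 ''l'' i = deg i + 1" unfolding l3 by (rule l)
        show "degree (factor wt i) < deg i + 1" using degree_factor[of wt i] by simp
      qed (use Q in simp)
      moreover have "leaves wt i @ [(factor wt i, deg i + 1)] = leaves wt (Suc i)" by (simp add: leaves_def)
      moreover have "?q i + (deg i + 1) = ?q (Suc i)" by simp
      ultimately show "?P (Suc i) ?s3" using Q by (simp add: add_ac)
    qed
  next
    fix i s' assume "frame ?F ?s0 s'"
    from prep[OF this] show "ival (wv ''m'') s' = m" by (simp add: input_def prepared_def)
  next
    have "(\<Sum>i<m. 100 * (sz i + 1) + 100 * (deg i + 1) + (11 + icost (wv ''m''))) = 100 * (off m + m) + 100 * (D + m) + 13 * m"
      unfolding sum.distrib[of _ "\<lambda>_. 11 + _"] sum.distrib[of "\<lambda>i. 100 * _ i"] sum_sz sum_distrib_left[symmetric] sum_len D_def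
      using sum_sz[of 1] by simp
    then show "(\<Sum>i<m. 100 * (sz i + 1) + 100 * (deg i + 1) + (11 + icost (wv ''m''))) + (11 + icost (wv ''m'')) \<le> 150 * (off m + D + 2 * m + 1)"
      by simp
  qed simp
  show ?thesis unfolding fill_prog_def
  proof (rule run_loopfree_Seq[where B = "150 * (off m + D + 2 * m + 1) + 21", OF _ run_then[OF 1]])
    fix s1 assume P1: "?P m s1" and fr: "frame ?F ?s0 s1"
    have "words s1 ''m'' 0 = m" using prep[OF fr] by (simp add: prepared_def input_def)
    moreover have "queue (effect ?tail s1) 0 0 (leaves wt m) m (D + m)"
      by (rule queue_cong) (use P1 in \<open>auto simp: D_def\<close>)
    ultimately show "run ?tail s1 20 ?Q"
      using P1 by (intro run_loopfree) (auto simp: D_def)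
  qed simp_all
qed

text \<open>The initial blocks have total length \<open>D + m\<close>, so every transform fits into
  a heap of size \<open>4 * (D + m)\<close> and one \<open>L\<close> bounds all logarithms. One
  factor \<open>L + 1\<close> comes from the transforms, the other from the passes over the
  queue.\<close>

lemma run_poly:
  assumes P: "prepared s" and m: "m > 0"
    and w: "\<And>s' i j. reals s' ''p'' = reals s ''p'' \<Longrightarrow> words s' ''o'' 0 = off i \<Longrightarrow> words s' ''j'' 0 = j \<Longrightarrow>
         i < m \<Longrightarrow> j < sz i \<Longrightarrow> rval w s' = wt (off i + j)"
    and cost: "rcost w \<le> 10"
    and heap: "sqrt_heap (tw s) (4 * (D + m))"
    and L: "2 * (D + m) \<le> 2^L"
  shows "run (fill_prog w ;; tree_prog) s (12000 * (L + 1) * (L + 1) * (off m + D + 2 * m + 1)) (\<lambda>s'.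
     prepared s' \<and> tw s' = tw s \<and> (\<forall>j\<le>D. reals s' ''f'' (words s' ''o'' 0 + j) = coeff (\<Prod>i<m. factor wt i) j))"
    (is "run _ _ _ ?Q")
proof (rule run_then[OF run_fill[where wt = wt, OF P w cost]])
  let ?U = "off m + D + 2 * m + 1"
  fix s1 assume 1: "queue s1 0 0 (leaves wt m) m (D + m) \<and> words s1 ''i'' 0 = 0 \<and> words s1 ''o'' 0 = 0 \<and>
     words s1 ''t'' 0 = m \<and> words s1 ''q'' 0 = D + m" and fr: "frame (fill_prog w) s s1"
  have S: "sum_list (map snd (leaves wt m)) = D + m" using sum_leaves D_def by simp
  have t1: "tw s1 = tw s" using tw_frame[OF fr] by simp
  have mc: "merge_cost (map snd (leaves wt m)) \<le> L * ?U"
  proof -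
    have "merge_cost (map snd (leaves wt m)) \<le> L * sum_list (map snd (leaves wt m))"
      by (rule merge_cost_le) (use L in \<open>simp add: leaves_def\<close>)
    also have "\<dots> \<le> L * ?U" unfolding S by (intro mult_le_mono) auto
    finally show ?thesis .
  qed
  note tree = run_tree[where ps = "leaves wt m" and M = "4 * (D + m)" and L = L and s = s1 and i = 0 and b = 0 and t = m and q = "D + m"]
  show "run tree_prog s1 (11000 * (L + 1) * (L * ?U) + 20) ?Q"
  proof (rule run_weaken[OF tree])
    show "11000 * (L + 1) * merge_cost (map snd (leaves wt m)) + 20 \<le> 11000 * (L + 1) * (L * ?U) + 20"
      using mult_le_mono2[OF mc, of "11000 * (L + 1)"] by simp
  next
    fix s2 assume 2: "(\<forall>j\<le>\<Sum>l\<leftarrow>map snd (leaves wt m). l - 1. reals s2 ''f'' (words s2 ''o'' 0 + j) = coeff (prod_list (map fst (leaves wt m))) j) \<and>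
       (\<forall>j<m. words s2 ''l'' j = words s1 ''l'' j)" and fr2: "frame tree_prog s1 s2"
    have "prepared s2"
      using P frame_words[OF fr] frame_words[OF fr2] frame_reals[OF fr] frame_reals[OF fr2] 2
      by (simp add: prepared_def input_def)
    moreover have "tw s2 = tw s" using tw_frame[OF fr2] t1 by simp
    moreover have "(\<Sum>l\<leftarrow>map snd (leaves wt m). l - 1) = D"
      by (simp add: leaves_def o_def sum_list_distinct_conv_sum_set atLeast0LessThan D_def)
    moreover have "prod_list (map fst (leaves wt m)) = (\<Prod>i<m. factor wt i)"
      by (simp add: leaves_def o_def prod.distinct_set_conv_list[symmetric] atLeast0LessThan)
    ultimately show "?Q s2" using 2 by simp
  qed (use 1 m heap L t1 in \<open>simp_all add: S\<close>, simp add: leaves_def)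
next
  let ?U = "off m + D + 2 * m + 1"
  have arith: "1 + 200 * u + (11000 * t + 20) \<le> 12000 * y" if "t + x = y" "u \<le> x" "0 < u" for t x y u :: nat
    using that by linarith
  have "(L + 1) * (L * ?U) + (L + 1) * ?U = (L + 1) * (L + 1) * ?U" by (simp add: algebra_simps)
  from arith[OF this, of ?U]
  show "1 + 200 * ?U + (11000 * (L + 1) * (L * ?U) + 20) \<le> 12000 * (L + 1) * (L + 1) * ?U"
    by (simp add: mult.assoc del: mult_Suc mult_Suc_right distrib_left_numeral)
qed

end

section \<open>Averages of powers over an interval of ranks\<close>

lemma powr_Suc_diff_le:
  fixes \<rho> :: real
  assumes "\<rho> > 0" "r \<ge> (1::nat)"
  shows "real r powr (\<rho> + 1) - real (r - 1) powr (\<rho> + 1) \<le> (\<rho> + 1) * real r powr \<rho>"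
proof (cases "r = 1")
  case True
  then show ?thesis using assms by simp
next
  case False
  with assms have r: "real (r - 1) < real r" "real (r - 1) > 0" by auto
  obtain z where z: "real (r - 1) < z" "z < real r"
    "real r powr (\<rho> + 1) - real (r - 1) powr (\<rho> + 1) = (real r - real (r - 1)) * ((\<rho> + 1) * z powr \<rho>)"
    using MVT2[OF r(1), of "\<lambda>x. x powr (\<rho> + 1)" "\<lambda>x. (\<rho> + 1) * x powr \<rho>"] r
    by (force intro!: derivative_eq_intros)
  then show ?thesis
    using assms r powr_mono2[of \<rho> z "real r"] by (auto simp: of_nat_diff)
qed

text \<open>Telescoping gives b^(\<rho>+1) - a^(\<rho>+1) on the left; replacing a^(\<rho>+1) by the
  larger a b^\<rho> leaves (b - a) b^\<rho>, so the same constant works for every lower end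
  \<open>a\<close>.\<close>

lemma power_sum_ge:
  fixes \<rho> :: real
  assumes "\<rho> > 0" "a \<le> b"
  shows "(real b - real a) * real b powr \<rho> / (1 + \<rho>) \<le> (\<Sum>r=a+1..b. real r powr \<rho>)"
proof -
  have "real b powr (\<rho> + 1) - real a powr (\<rho> + 1) \<le> (\<rho> + 1) * (\<Sum>r=a+1..b. real r powr \<rho>)"
    using assms(2)
  proof (induction b rule: dec_induct)
    case (step b)
    then show ?case using powr_Suc_diff_le[OF assms(1), of "Suc b"] by (simp add: algebra_simps)
  qed simp
  moreover have "real a powr (\<rho> + 1) \<le> real a * real b powr \<rho>"
    using assms by (simp add: powr_add powr_mono2 mult.commute[of _ "real a"] mult_left_mono)
  ultimately have "(real b - real a) * real b powr \<rho> \<le> (\<rho> + 1) * (\<Sum>r=a+1..b. real r powr \<rho>)"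
    by (simp add: powr_add algebra_simps)
  then show ?thesis using assms by (simp add: field_simps)
qed

lemma power_sum_le:
  fixes \<rho> :: real
  assumes "\<rho> > 0"
  shows "(\<Sum>r=a+1..b. real r powr \<rho>) \<le> real (b - a) * real b powr \<rho>"
proof -
  have "(\<Sum>r=a+1..b. real r powr \<rho>) \<le> (\<Sum>r=a+1..b. real b powr \<rho>)"
    using assms by (intro sum_mono powr_mono2) auto
  then show ?thesis by simp
qed

lemma power_sum_eq_iff:
  fixes \<rho> :: real
  assumes "\<rho> > 0" "a < b"
  shows "(\<Sum>r=a+1..b. real r powr \<rho>) = real (b - a) * real b powr \<rho> \<longleftrightarrow> b - a = 1"
proof
  assume eq: "(\<Sum>r=a+1..b. real r powr \<rho>) = real (b - a) * real b powr \<rho>"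
  show "b - a = 1"
  proof (rule ccontr)
    assume "b - a \<noteq> 1"
    with assms(2) have a1: "a + 1 \<in> {a+1..b}" "a + 1 < b" by auto
    have "(\<Sum>r=a+1..b. real r powr \<rho>) < (\<Sum>r=a+1..b. real b powr \<rho>)"
      using a1 assms by (intro sum_strict_mono_ex1 bexI[OF _ a1(1)] ballI powr_mono2 powr_less_mono2) auto
    with eq show False by simp
  qed
next
  assume "b - a = 1"
  then have "b = Suc a" using assms(2) by simp
  then show "(\<Sum>r=a+1..b. real r powr \<rho>) = real (b - a) * real b powr \<rho>" by simp
qed

text \<open>With \<open>x = sqrt (r + 1)\<close> and \<open>y = sqrt r\<close> one has \<open>x\<^sup>2 - y\<^sup>2 = 1\<close>, and \<open>x\<^sup>3 - y\<^sup>3\<close> lies between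
  \<open>3/2 * y * (x\<^sup>2 - y\<^sup>2)\<close> and \<open>3/2 * x * (x\<^sup>2 - y\<^sup>2)\<close>.\<close>

lemma sqrt_cube_diff:
  fixes r :: nat
  shows "sqrt r \<le> 2/3 * (real (Suc r) * sqrt (Suc r) - real r * sqrt (real r))"
    and "2/3 * (real (Suc r) * sqrt (Suc r) - real r * sqrt (real r)) \<le> sqrt (Suc r)"
proof -
  define x y where "x = sqrt (Suc r)" and "y = sqrt r"
  have xy: "0 \<le> y" "y \<le> x" "x * x = real (Suc r)" "y * y = real r" by (simp_all add: x_def y_def)
  then have xy1: "x * x - y * y = 1" by simp
  have "y * 1 \<le> 2/3 * (x * x * x - y * y * y)" "2/3 * (x * x * x - y * y * y) \<le> x * 1"
  proof -
    have "2 * (x * x * x - y * y * y) - 3 * y * (x * x - y * y) = (x - y) * (x - y) * (2 * x + y)"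
      "3 * x * (x * x - y * y) - 2 * (x * x * x - y * y * y) = (x - y) * (x - y) * (x + 2 * y)"
      by (simp_all add: algebra_simps)
    moreover have "0 \<le> (x - y) * (x - y) * (2 * x + y)" "0 \<le> (x - y) * (x - y) * (x + 2 * y)"
      using xy by simp_all
    ultimately show "y * 1 \<le> 2/3 * (x * x * x - y * y * y)" "2/3 * (x * x * x - y * y * y) \<le> x * 1"
      unfolding xy1 by simp_all
  qed
  then show "sqrt r \<le> 2/3 * (real (Suc r) * sqrt (Suc r) - real r * sqrt (real r))"
    and "2/3 * (real (Suc r) * sqrt (Suc r) - real r * sqrt (real r)) \<le> sqrt (Suc r)"
    unfolding xy(3,4) x_def[symmetric] y_def[symmetric] by simp_all
qed

text \<open>The error at rank r + 1 lies between 0 and sqrt(r + 1) - sqrt r, so the errors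
  telescope.\<close>

lemma sqrt_sum_integral:
  assumes "c \<le> b"
  shows "0 \<le> (\<Sum>r=c+1..b. sqrt (real r)) - 2/3 * (real b * sqrt b - real c * sqrt c)"
    and "(\<Sum>r=c+1..b. sqrt (real r)) - 2/3 * (real b * sqrt b - real c * sqrt c) \<le> sqrt b - sqrt c"
proof -
  have "0 \<le> (\<Sum>r=c+1..b. sqrt (real r)) - 2/3 * (real b * sqrt b - real c * sqrt c) \<and>
    (\<Sum>r=c+1..b. sqrt (real r)) - 2/3 * (real b * sqrt b - real c * sqrt c) \<le> sqrt b - sqrt c"
    using assms
  proof (induction b rule: dec_induct)
    case (step b)
    then show ?case using sqrt_cube_diff[of b] by (simp add: algebra_simps)
  qed simp
  then show "0 \<le> (\<Sum>r=c+1..b. sqrt (real r)) - 2/3 * (real b * sqrt b - real c * sqrt c)"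
    and "(\<Sum>r=c+1..b. sqrt (real r)) - 2/3 * (real b * sqrt b - real c * sqrt c) \<le> sqrt b - sqrt c"
    by blast+
qed

text \<open>
  The average of the square roots is computed by summing the first \<open>M\<close> terms and replacing the rest
  by an integral.  Since an expression cannot branch, the condition \<open>j \<le> b - a\<close> is encoded by
  differences of positive parts, where the absolute value is a square root.
\<close>

definition pos_exp :: "rexp \<Rightarrow> rexp" where
  "pos_exp x = RDiv (RAdd x (RSqrt (RMul x x))) (ROf (ICon 2))"

definition ind_exp :: "nat \<Rightarrow> rexp \<Rightarrow> rexp" where
  "ind_exp j d = RSub (pos_exp (RSub (RAdd d (ROf (ICon 1))) (ROf (ICon j)))) (pos_exp (RSub d (ROf (ICon j))))"

fun count_exp :: "nat \<Rightarrow> rexp \<Rightarrow> rexp" where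
  "count_exp 0 d = ROf (ICon 0)"
| "count_exp (Suc j) d = RAdd (count_exp j d) (ind_exp (Suc j) d)"

fun head_exp :: "nat \<Rightarrow> rexp \<Rightarrow> rexp \<Rightarrow> rexp" where
  "head_exp 0 a d = ROf (ICon 0)"
| "head_exp (Suc j) a d = RAdd (head_exp j a d) (RMul (ind_exp (Suc j) d) (RSqrt (RAdd a (ROf (ICon (Suc j))))))"

definition lo_exp :: rexp where "lo_exp = RMul (rv ''N'') (rv ''lo'')"
definition hi_exp :: rexp where "hi_exp = RMul (rv ''N'') (rv ''hi'')"

definition half_exp :: "nat \<Rightarrow> rexp" where
  "half_exp M =
     (let d = RSub hi_exp lo_exp; c = RAdd lo_exp (count_exp M d)
      in RDiv (RAdd (head_exp M lo_exp d)
           (RMul (RDiv (ROf (ICon 2)) (ROf (ICon 3))) (RSub (RMul hi_exp (RSqrt hi_exp)) (RMul c (RSqrt c))))) d)"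

definition one_exp :: rexp where
  "one_exp = RDiv (RAdd (RAdd lo_exp hi_exp) (ROf (ICon 1))) (ROf (ICon 2))"

definition evaluator :: "nat \<Rightarrow> real \<Rightarrow> real \<Rightarrow> real \<Rightarrow> real \<Rightarrow> real" where
  "evaluator M \<rho> N u v = rval (if \<rho> = 1 then one_exp else half_exp M) (level_input N u v)"

section \<open>Values and precision of the evaluator\<close>

lemma rval_pos_exp: "rval (pos_exp x) s = max 0 (rval x s)"
  by (simp add: pos_exp_def max_def)

lemma rval_ind_exp:
  assumes "rval d s = real k" "j \<ge> 1"
  shows "rval (ind_exp j d) s = (if j \<le> k then 1 else 0)"
  using assms of_nat_le_iff[of "Suc k" j, where 'a = real]
  by (auto simp: ind_exp_def rval_pos_exp max_def)

lemma rval_count_exp: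
  assumes "rval d s = real k"
  shows "rval (count_exp M d) s = real (min M k)"
  by (induction M) (auto simp: rval_ind_exp[OF assms])

lemma rval_head_exp:
  assumes "rval d s = real k" "rval a s = real n"
  shows "rval (head_exp M a d) s = (\<Sum>r=n+1..n + min M k. sqrt (real r))"
proof (induction M)
  case (Suc M)
  show ?case
  proof (cases "Suc M \<le> k")
    case True
    then have "min (Suc M) k = Suc M" "min M k = M" by auto
    then show ?thesis using Suc True by (simp add: rval_ind_exp[OF assms(1)] assms add.commute)
  next
    case False
    then have "min (Suc M) k = k" "min M k = k" by auto
    then show ?thesis using Suc False by (simp add: rval_ind_exp[OF assms(1)])
  qed
qed simp

text \<open>The expressions read only \<open>N\<close>, \<open>lo\<close> and \<open>hi\<close>.
  Placed inside the main program they therefore have the same value as in the stand-alone program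
  that starts from \<open>level_input\<close>.\<close>

lemma rval_evaluator:
  "rval one_exp s = evaluator M 1 (reals s ''N'' 0) (reals s ''lo'' 0) (reals s ''hi'' 0)"
  "rval (half_exp M) s = evaluator M (1/2) (reals s ''N'' 0) (reals s ''lo'' 0) (reals s ''hi'' 0)"
proof -
  let ?s = "level_input (reals s ''N'' 0) (reals s ''lo'' 0) (reals s ''hi'' 0)"
  have e: "rval lo_exp s = rval lo_exp ?s" "rval hi_exp s = rval hi_exp ?s"
    by (simp_all add: lo_exp_def hi_exp_def level_input_def)
  have i: "rval (ind_exp j d) s = rval (ind_exp j d) ?s" if "rval d s = rval d ?s" for j d
    using that by (simp add: ind_exp_def pos_exp_def)
  have c: "rval (count_exp M d) s = rval (count_exp M d) ?s" if "rval d s = rval d ?s" for d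
    by (induction M) (simp_all add: i[OF that])
  have h: "rval (head_exp M a d) s = rval (head_exp M a d) ?s" if "rval d s = rval d ?s" "rval a s = rval a ?s" for a d
    by (induction M) (simp_all add: i[OF that(1)] that(2))
  show "rval one_exp s = evaluator M 1 (reals s ''N'' 0) (reals s ''lo'' 0) (reals s ''hi'' 0)"
    by (simp add: evaluator_def one_exp_def e)
  have d: "rval (RSub hi_exp lo_exp) s = rval (RSub hi_exp lo_exp) ?s" by (simp add: e)
  show "rval (half_exp M) s = evaluator M (1/2) (reals s ''N'' 0) (reals s ''lo'' 0) (reals s ''hi'' 0)"
    by (simp add: evaluator_def half_exp_def Let_def e c[OF d] h[OF d])
qed

lemma evaluator_1:
  assumes "a < b" "b \<le> N"
  shows "evaluator M 1 (real N) (real a / real N) (real b / real N) = (\<Sum>r=a+1..b. real r powr 1) / (real b - real a)"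
proof -
  have N: "real N \<noteq> 0" using assms by simp
  have "2 * (\<Sum>r=a+1..b. real r) = (real b - real a) * (real a + real b + 1)"
    using less_imp_le[OF assms(1)] by (induction b rule: dec_induct) (simp_all add: algebra_simps)
  then have "(\<Sum>r=a+1..b. real r) = (real b - real a) * ((real a + real b + 1) / 2)" by simp
  then show ?thesis using N assms(1)
    by (simp add: evaluator_def one_exp_def lo_exp_def hi_exp_def level_input_def)
qed

lemma evaluator_half:
  assumes "a < b" "b \<le> N"
  shows "evaluator M (1/2) (real N) (real a / real N) (real b / real N) =
    ((\<Sum>r=a+1..a + min M (b - a). sqrt (real r))
      + 2/3 * (real b * sqrt b - real (a + min M (b - a)) * sqrt (real (a + min M (b - a))))) / (real b - real a)"
proof -
  let ?s = "level_input (real N) (real a / real N) (real b / real N)"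
  have N: "real N \<noteq> 0" using assms by simp
  have e: "rval lo_exp ?s = real a" "rval hi_exp ?s = real b"
    using N by (simp_all add: lo_exp_def hi_exp_def level_input_def)
  then have d: "rval (RSub hi_exp lo_exp) ?s = real (b - a)" using assms(1) by simp
  show ?thesis
    unfolding evaluator_def half_exp_def Let_def
    using rval_count_exp[OF d] rval_head_exp[OF d e(1)] d e assms(1) by simp
qed

text \<open>A level of at most \<open>M\<close> ranks is summed completely, without error. On a
  longer one the integral is off by at most sqrt b, while the sum is at least (b - a) sqrt b /
  (3/2); so b - a at least 3 / (2 \<delta>) is enough, and this is where the bound on
  \<open>M\<close> comes from.\<close>

lemma evaluator_half_precision:
  assumes ab: "a < b" "b \<le> N" and M: "real M \<ge> 3 / (2 * \<delta>)" and \<delta>: "\<delta> > 0"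
  defines "av \<equiv> (\<Sum>r=a+1..b. real r powr (1/2)) / (real b - real a)"
  shows "\<bar>evaluator M (1/2) (real N) (real a / real N) (real b / real N) - av\<bar> \<le> \<delta> * av"
proof -
  define c where "c = a + min M (b - a)"
  have c: "a \<le> c" "c \<le> b" using ab by (auto simp: c_def)
  define I where "I = 2/3 * (real b * sqrt b - real c * sqrt c)"
  define A where "A = (\<Sum>r=a+1..b. sqrt (real r))"
  have d: "real b - real a > 0" using ab by simp
  have av: "av = A / (real b - real a)" by (simp add: av_def A_def powr_half_sqrt)
  have split: "A = (\<Sum>r=a+1..c. sqrt (real r)) + (\<Sum>r=c+1..b. sqrt (real r))"
    unfolding A_def using c(2) by (induction b rule: dec_induct) (use c(1) in simp_all)
  have E: "evaluator M (1/2) (real N) (real a / real N) (real b / real N) = ((\<Sum>r=a+1..c. sqrt (real r)) + I) / (real b - real a)"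
    unfolding evaluator_half[OF ab] c_def[symmetric] I_def ..
  have "\<bar>(\<Sum>r=a+1..c. sqrt (real r)) + I - A\<bar> \<le> \<delta> * A"
  proof (cases "b - a \<le> M")
    case True
    then have "c = b" using ab by (simp add: c_def)
    moreover have "0 \<le> A" unfolding A_def by (intro sum_nonneg) simp
    ultimately show ?thesis using \<delta> by (simp add: I_def A_def)
  next
    case False
    have "real M \<le> real b - real a" using False by simp
    then have "3 / (2 * \<delta>) \<le> real b - real a" using M by linarith
    then have "1 \<le> \<delta> * ((real b - real a) / (3/2))" using \<delta> by (simp add: field_simps)
    then have "1 * sqrt b \<le> \<delta> * ((real b - real a) / (3/2)) * sqrt b"
      by (intro mult_right_mono) auto
    also have "\<dots> = \<delta> * ((real b - real a) * sqrt b / (3/2))" by simp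
    also have "\<dots> \<le> \<delta> * A"
      using power_sum_ge[of "1/2" a b] ab \<delta> unfolding A_def powr_half_sqrt[OF of_nat_0_le_iff]
      by (intro mult_left_mono) simp_all
    finally have "sqrt b \<le> \<delta> * A" by simp
    moreover have "\<bar>(\<Sum>r=a+1..c. sqrt (real r)) + I - A\<bar> \<le> sqrt b"
    proof -
      have "0 \<le> sqrt (real c)" "0 \<le> sqrt (real b)" by simp_all
      with sqrt_sum_integral[OF c(2)] show ?thesis unfolding split I_def by linarith
    qed
    ultimately show ?thesis by simp
  qed
  then have "\<bar>(\<Sum>r=a+1..c. sqrt (real r)) + I - A\<bar> / (real b - real a) \<le> \<delta> * A / (real b - real a)"
    using d by (intro divide_right_mono) auto
  then show ?thesis unfolding E av diff_divide_distrib[symmetric] using d by simp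
qed

lemma level_evaluator_evaluator:
  assumes \<delta>: "\<delta> > 0" and M: "real M \<ge> 3 / (2 * \<delta>)"
  shows "level_evaluator \<delta> (1/2) (evaluator M (1/2))" "level_evaluator \<delta> 1 (evaluator M 1)"
proof -
  have out: "\<exists>c (C::nat). \<forall>N a b :: nat. a < b \<and> b \<le> N \<longrightarrow>
        (\<exists>n\<le>C. outputs c (level_input (real N) (real a / real N) (real b / real N)) n
                 (evaluator M \<rho> (real N) (real a / real N) (real b / real N)))" for \<rho>
  proof -
    let ?e = "if \<rho> = 1 then one_exp else half_exp M"
    have "outputs (setr ''out'' ?e) s (1 + icost (ICon 0) + rcost ?e) (rval ?e s)" for s
      unfolding outputs_def using exec_RSet[of "''out''" "ICon 0" ?e s] by (intro exI conjI) auto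
    then show ?thesis unfolding evaluator_def by blast
  qed
  show "level_evaluator \<delta> (1/2) (evaluator M (1/2))"
    unfolding level_evaluator_def Let_def using evaluator_half_precision[OF _ _ M \<delta>] out by blast
  have nonneg: "0 \<le> (\<Sum>r=a+1..b. real r powr 1) / (real b - real a)" if "a < b" for a b :: nat
    using that by (intro divide_nonneg_nonneg sum_nonneg) auto
  have "\<bar>evaluator M 1 (real N) (real a / real N) (real b / real N) - (\<Sum>r=a+1..b. real r powr 1) / (real b - real a)\<bar>
      \<le> \<delta> * ((\<Sum>r=a+1..b. real r powr 1) / (real b - real a))" if "a < b" "b \<le> N" for N a b
    unfolding evaluator_1[OF that] diff_self abs_zero using \<delta> nonneg[OF that(1)]
    by (intro mult_nonneg_nonneg) auto
  then show "level_evaluator \<delta> 1 (evaluator M 1)"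
    unfolding level_evaluator_def Let_def using out by blast
qed

section \<open>The program\<close>

text \<open>\<open>lo\<close> is formed before and \<open>hi\<close> after the count of the level is
  added, so they are the distribution function below and at the level. The expressions multiply by
  \<open>N\<close> again to obtain the rank bounds.\<close>

definition level_body :: "nat \<Rightarrow> com" where
  "level_body M = (let w = RGet ''f'' (IAdd (wv ''o'') (wv ''j'')) in
     setr ''lo'' (RDiv (rv ''s'') (rv ''N'')) ;;
     setr ''s'' (RAdd (rv ''s'') (RGet ''c'' (wv ''j''))) ;;
     setr ''hi'' (RDiv (rv ''s'') (rv ''N'')) ;;
     setr ''S'' (RAdd (rv ''S'') (RMul w (RDiv one_exp (rv ''N'')))) ;;
     setr ''H'' (RAdd (rv ''H'') (RMul w (RDiv (half_exp M) (RSqrt (rv ''N''))))))"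

definition final_prog :: "nat \<Rightarrow> com" where
  "final_prog M = (setr ''N'' (ROf (ICon 1)) ;;
     For ''i'' (wv ''m'') (setr ''N'' (RMul (rv ''N'') (ROf (IGet ''size'' (wv ''i''))))) ;;
     (setr ''s'' (ROf (ICon 0)) ;; setr ''S'' (ROf (ICon 0)) ;; setr ''H'' (ROf (ICon 0))) ;;
     For ''j'' (IAdd (wv ''D'') (ICon 1)) (level_body M) ;;
     setr ''out'' (RDiv (RAdd (RLn (rv ''N'')) (RLn (rv ''S''))) (RAdd (RDiv (RLn (rv ''N'')) (ROf (ICon 2))) (RLn (rv ''H'')))))"

text \<open>The counting coefficients are copied to \<open>c\<close>, since the second product is
  built in the same array \<open>f\<close>. The heap of roots is built once and shared.\<close>

definition main_prog :: "nat \<Rightarrow> com" where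
  "main_prog M = (pre_prog ;;
     (let x = IAdd (wv ''D'') (wv ''m'') in setw ''r'' (IAdd (IAdd x x) (IAdd x x))) ;;
     heap_prog ;;
     (fill_prog (ROf (ICon 1)) ;; tree_prog) ;;
     For ''j'' (IAdd (wv ''D'') (ICon 1)) (RSet ''c'' (wv ''j'') (RGet ''f'' (IAdd (wv ''o'') (wv ''j'')))) ;;
     (fill_prog (RGet ''p'' (IAdd (wv ''o'') (wv ''j''))) ;; tree_prog) ;;
     final_prog M)"

definition level_cost :: "nat \<Rightarrow> nat" where
  "level_cost M = rcost one_exp + rcost (half_exp M) + 200"

lemma level_body_props [simp]: "loopfree (level_body M)" "cost (level_body M) \<le> level_cost M"
  "word_names (level_body M) = {}" "real_names (level_body M) = {''lo'', ''hi'', ''s'', ''S'', ''H''}"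
  by (auto simp: level_body_def level_cost_def Let_def)

context level_data
begin

definition count_coeff :: "nat \<Rightarrow> real" where "count_coeff = coeff (\<Prod>i<m. factor (\<lambda>_. 1) i)"
definition prob_coeff :: "nat \<Rightarrow> real" where "prob_coeff = coeff (\<Prod>i<m. factor pt i)"
definition key_total :: real where "key_total = (\<Prod>i<m. real (sz i))"
definition cum :: "nat \<Rightarrow> real" where "cum j = (\<Sum>i<j. count_coeff i)"

definition level_sum :: "nat \<Rightarrow> real \<Rightarrow> nat \<Rightarrow> real" where
  "level_sum M \<rho> n = (\<Sum>j<n. prob_coeff j *
     (evaluator M \<rho> key_total (cum j / key_total) (cum (Suc j) / key_total) / key_total powr \<rho>))"

lemma level_body_effect:
  assumes "words s ''j'' 0 = j" "reals s ''N'' 0 = key_total" "reals s ''s'' 0 = cum j"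
    "reals s ''c'' j = count_coeff j" "reals s ''f'' (words s ''o'' 0 + j) = prob_coeff j"
    "reals s ''S'' 0 = level_sum M 1 j" "reals s ''H'' 0 = level_sum M (1/2) j" "key_total > 0"
  shows "reals (effect (level_body M) s) ''s'' 0 = cum (Suc j)"
    "reals (effect (level_body M) s) ''S'' 0 = level_sum M 1 (Suc j)"
    "reals (effect (level_body M) s) ''H'' 0 = level_sum M (1/2) (Suc j)"
  using assms
  by (simp_all add: level_body_def Let_def rval_evaluator(1)[where M = M] rval_evaluator(2) cum_def level_sum_def
      powr_half_sqrt)

lemma key_total_pos: "key_total > 0"
  unfolding key_total_def using sz by (intro prod_pos) auto

lemma run_final:
  assumes P: "prepared s" and c: "\<forall>j\<le>D. reals s ''c'' j = count_coeff j"
    and f: "\<forall>j\<le>D. reals s ''f'' (words s ''o'' 0 + j) = prob_coeff j"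
  shows "run (final_prog M) s ((level_cost M + 100) * (D + m + 3)) (\<lambda>s'. reals s' ''out'' 0 =
     (ln key_total + ln (level_sum M 1 (Suc D))) / (1/2 * ln key_total + ln (level_sum M (1/2) (Suc D))))"
    (is "run _ _ _ ?Q")
proof -
  have s: "words s ''m'' 0 = m" "\<And>i. i < m \<Longrightarrow> words s ''size'' i = sz i" "words s ''D'' 0 = D"
    using P by (auto simp: prepared_def input_def)
  let ?s0 = "effect (setr ''N'' (ROf (ICon 1))) s"
  let ?c1 = "setr ''N'' (RMul (rv ''N'') (ROf (IGet ''size'' (wv ''i''))))"
  let ?init = "setr ''s'' (ROf (ICon 0)) ;; setr ''S'' (ROf (ICon 0)) ;; setr ''H'' (ROf (ICon 0))"
  let ?out = "setr ''out'' (RDiv (RAdd (RLn (rv ''N'')) (RLn (rv ''S''))) (RAdd (RDiv (RLn (rv ''N'')) (ROf (ICon 2))) (RLn (rv ''H''))))"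
  let ?F2 = "For ''j'' (IAdd (wv ''D'') (ICon 1)) (level_body M)"
  have 1: "run (For ''i'' (wv ''m'') ?c1) ?s0 (50 * (m + 1)) (\<lambda>s'. reals s' ''N'' 0 = key_total)"
    unfolding key_total_def
  proof (rule run_For[where k = m and B = "\<lambda>_. 20" and P = "\<lambda>k s'. reals s' ''N'' 0 = (\<Prod>i<k. real (sz i))"])
    fix k s' assume k: "k < m" "words s' ''i'' 0 = k" and P: "reals s' ''N'' 0 = (\<Prod>i<k. real (sz i))"
      and fr: "frame (For ''i'' (wv ''m'') ?c1) ?s0 s'"
    have "words s' ''size'' k = sz k" using frame_words[OF fr] s(2)[OF k(1)] by simp
    then show "run ?c1 s' 20 (\<lambda>s''. reals (set_word ''i'' 0 (Suc k) s'') ''N'' 0 = (\<Prod>i<Suc k. real (sz i)))"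
      using k P by (intro run_loopfree) auto
  next
    fix k s' assume "frame (For ''i'' (wv ''m'') ?c1) ?s0 s'"
    from frame_words[OF this] s(1) show "ival (wv ''m'') s' = m" by simp
  qed simp_all
  let ?P = "\<lambda>k s'. reals s' ''s'' 0 = cum k \<and> reals s' ''S'' 0 = level_sum M 1 k \<and> reals s' ''H'' 0 = level_sum M (1/2) k"
  have 2: "run ?F2 s1 ((level_cost M + 40) * (D + 2)) (?P (Suc D))"
    if s1: "reals s1 ''N'' 0 = key_total" "reals s1 ''c'' = reals s ''c''" "reals s1 ''f'' = reals s ''f''"
       "words s1 ''o'' = words s ''o''" "words s1 ''D'' = words s ''D''" "?P 0 s1" for s1
  proof (rule run_For[where k = "Suc D" and B = "\<lambda>_. level_cost M" and P = ?P])
    fix k s' assume k: "k < Suc D" "words s' ''j'' 0 = k" and P: "?P k s'" and fr: "frame ?F2 s1 s'"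
    have w: "reals s' ''N'' 0 = key_total" "reals s' ''c'' k = count_coeff k" "reals s' ''f'' (words s' ''o'' 0 + k) = prob_coeff k"
      using frame_words[OF fr] frame_reals[OF fr] s1 c f k(1) by simp_all
    note eff = level_body_effect[where M = M, OF k(2) w(1) _ w(2,3) _ _ key_total_pos]
    show "run (level_body M) s' (level_cost M) (\<lambda>s''. ?P (Suc k) (set_word ''j'' 0 (Suc k) s''))"
      by (rule run_loopfree) (use eff P in simp_all)
  next
    fix k s' assume "frame ?F2 s1 s'"
    from frame_words[OF this] s(3) s1(5) show "ival (IAdd (wv ''D'') (ICon 1)) s' = Suc D" by simp
  qed (use s1 in \<open>simp_all add: algebra_simps\<close>)
  show ?thesis unfolding final_prog_def
  proof (rule run_loopfree_Seq[where B = "50 * (m + 1) + (level_cost M + 40) * (D + 2) + 60", OF _ run_then[OF 1]])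
    fix s1 assume N: "reals s1 ''N'' 0 = key_total" and fr1: "frame (For ''i'' (wv ''m'') ?c1) ?s0 s1"
    have fin: "run ?F2 (effect ?init s1) ((level_cost M + 40) * (D + 2)) (?P (Suc D))"
      by (rule 2) (use N frame_words[OF fr1] frame_reals[OF fr1] in \<open>simp_all add: cum_def level_sum_def\<close>)
    show "run (?init ;; ?F2 ;; ?out) s1 ((level_cost M + 40) * (D + 2) + 59) ?Q"
    proof (rule run_loopfree_Seq[where B = "(level_cost M + 40) * (D + 2) + 41", OF _ run_then[OF fin]])
      fix s2 assume P: "?P (Suc D) s2" and fr2: "frame ?F2 (effect ?init s1) s2"
      have "reals s2 ''N'' 0 = key_total" using frame_reals[OF fr2] N by simp
      then show "run ?out s2 40 ?Q" using P by (intro run_loopfree) auto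
    qed simp_all
  qed (simp_all add: algebra_simps)
qed

lemma run_main:
  assumes inp: "input s" and m: "m > 0" and L: "2 * (D + m) \<le> 2^L"
  shows "run (main_prog M) s ((30000 + 2 * level_cost M) * ((L + 1) * (L + 1) * (off m + D + 2 * m + 1))) (\<lambda>s'. reals s' ''out'' 0 =
     (ln key_total + ln (level_sum M 1 (Suc D))) / (1/2 * ln key_total + ln (level_sum M (1/2) (Suc D))))"
    (is "run _ _ _ ?Q")
proof -
  let ?U = "off m + D + 2 * m + 1"
  define T where "T = (L + 1) * (L + 1) * ?U"
  have U1: "?U \<le> (L + 1) * ?U" by simp
  have U2: "(L + 1) * ?U \<le> T" unfolding T_def mult.assoc by (rule mult_le_mono2[OF U1])
  have U: "?U \<le> T" by (rule order.trans[OF U1 U2])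
  \<comment> \<open>The part of the cost that depends on \<open>M\<close> is kept apart, so that the
    bounds along the program are linear in \<open>T\<close> and \<open>W\<close>.\<close>
  define W where "W = 2 * level_cost M * T"
  have T0: "0 < T" using U by simp
  have U3: "(L + 1) * (off m + m + 1) \<le> T" by (rule order.trans[OF mult_le_mono2 U2]) simp
  let ?set = "let x = IAdd (wv ''D'') (wv ''m'') in setw ''r'' (IAdd (IAdd x x) (IAdd x x))"
  let ?p1 = "fill_prog (ROf (ICon 1)) ;; tree_prog" and ?p2 = "fill_prog (RGet ''p'' (IAdd (wv ''o'') (wv ''j''))) ;; tree_prog"
  let ?c = "RSet ''c'' (wv ''j'') (RGet ''f'' (IAdd (wv ''o'') (wv ''j'')))"
  let ?copy = "For ''j'' (IAdd (wv ''D'') (ICon 1)) ?c"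
  have prepD: "prepared s' \<Longrightarrow> words s' ''D'' 0 = D" "prepared s' \<Longrightarrow> words s' ''m'' 0 = m" for s'
    by (auto simp: prepared_def input_def)
  have prep_cong: "prepared s'" if "prepared s" "frame c s s'"
     "''m'' \<notin> word_names c" "''size'' \<notin> word_names c" "''X'' \<notin> word_names c" "''l'' \<notin> word_names c" "''D'' \<notin> word_names c"
     "''h'' \<notin> real_names c" "''p'' \<notin> real_names c" for s s' c
    using that(1) frame_words[OF that(2)] frame_reals[OF that(2)] that(3-) by (simp add: prepared_def input_def)
  have DL: "D < 2^L" by (rule less_le_trans[OF _ L]) (use m in simp)
  have le1: "500 * (L + 1) * (off m + m + 1) \<le> 500 * T"
    using mult_le_mono2[OF U3, of 500] by (simp only: mult.assoc)
  have le2: "200 * (4 * (D + m) + 1) \<le> 800 * T" using mult_le_mono2[OF U, of 800] by simp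
  have le3: "12000 * (L + 1) * (L + 1) * ?U \<le> 12000 * T" unfolding T_def mult.assoc by (rule order_refl)
  have le4: "100 * (D + 2) \<le> 200 * T" using mult_le_mono2[OF U, of 200] m by simp
  have le5: "(level_cost M + 100) * (D + m + 3) \<le> 200 * T + W"
  proof -
    have "D + m + 3 \<le> 2 * T" using mult_le_mono2[OF U, of 2] m by simp
    from mult_le_mono2[OF this, of "level_cost M + 100"] show ?thesis by (simp add: W_def algebra_simps)
  qed
  have "run (main_prog M) s (28000 * T + W) ?Q" unfolding main_prog_def
  proof (rule run_then[OF run_mono[OF run_pre[OF inp DL] le1]])
    fix s1 assume 1: "prepared s1"
    show "run (?set ;; heap_prog ;; ?p1 ;; ?copy ;; ?p2 ;; final_prog M) s1 (26000 * T + W) ?Q"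
    proof (rule run_loopfree_Seq)
      let ?s2 = "effect ?set s1"
      have r: "words ?s2 ''r'' 0 = 4 * (D + m)" using prepD[OF 1] by (simp add: Let_def)
      have 2: "prepared ?s2" using 1 by (simp add: prepared_def input_def Let_def)
      show "run (heap_prog ;; ?p1 ;; ?copy ;; ?p2 ;; final_prog M) ?s2 (25900 * T + W) ?Q"
      proof (rule run_then[OF run_mono[OF run_heap[OF r] le2]])
        fix s3 assume h3: "sqrt_heap (tw s3) (4 * (D + m))" and fr: "frame heap_prog ?s2 s3"
        have 3: "prepared s3" by (rule prep_cong[OF 2 fr]) simp_all
        show "run (?p1 ;; ?copy ;; ?p2 ;; final_prog M) s3 (25000 * T + W) ?Q"
        proof (rule run_then[OF run_mono[OF run_poly[where wt = "\<lambda>_. 1", OF 3 m _ _ h3 L] le3]])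
          fix s4 assume 4: "prepared s4 \<and> tw s4 = tw s3 \<and> (\<forall>j\<le>D. reals s4 ''f'' (words s4 ''o'' 0 + j) = coeff (\<Prod>i<m. factor (\<lambda>_. 1) i) j)"
          have copy: "run ?copy s4 (100 * (D + 2)) (\<lambda>s'. \<forall>j<D+1. reals s' ''c'' j = count_coeff j)"
          proof (rule run_For[where k = "D+1" and B = "\<lambda>_. 20" and P = "\<lambda>k s'. \<forall>j<k. reals s' ''c'' j = count_coeff j"])
            fix k s' assume k: "k < D+1" "words s' ''j'' 0 = k" and P: "\<forall>j<k. reals s' ''c'' j = count_coeff j" and fr: "frame ?copy s4 s'"
            have "reals s' ''f'' (words s' ''o'' 0 + k) = count_coeff k"
              using 4 k(1) frame_words[OF fr] frame_reals[OF fr] by (simp add: count_coeff_def)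
            then show "run ?c s' 20 (\<lambda>s''. \<forall>j<Suc k. reals (set_word ''j'' 0 (Suc k) s'') ''c'' j = count_coeff j)"
              using k P by (intro run_loopfree) (auto simp: less_Suc_eq)
          next
            fix k s' assume "frame ?copy s4 s'"
            from frame_words[OF this] prepD 4 show "ival (IAdd (wv ''D'') (ICon 1)) s' = D+1" by simp
          qed simp_all
          show "run (?copy ;; ?p2 ;; final_prog M) s4 (12900 * T + W) ?Q"
          proof (rule run_then[OF run_mono[OF copy le4]])
            fix s5 assume 5: "\<forall>j<D+1. reals s5 ''c'' j = count_coeff j" and fr5: "frame ?copy s4 s5"
            have p5: "prepared s5" by (rule prep_cong[OF _ fr5]) (use 4 in simp_all)
            have h5: "sqrt_heap (tw s5) (4 * (D + m))" using h3 4 tw_frame[OF fr5] by simp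
            have inp5: "input s5" using p5 by (simp add: prepared_def)
            show "run (?p2 ;; final_prog M) s5 (12600 * T + W) ?Q"
            proof (rule run_then[OF run_mono[OF run_weaken[OF run_poly[where wt = pt, OF p5 m _ _ h5 L] order_refl] le3]])
              fix s' :: store and i j assume "reals s' ''p'' = reals s5 ''p''" "words s' ''o'' 0 = off i" "words s' ''j'' 0 = j" "i < m" "j < sz i"
              then show "rval (RGet ''p'' (IAdd (wv ''o'') (wv ''j''))) s' = pt (off i + j)"
                using inp5 off_le[of i] by (simp add: input_def)
            next
              fix s6 assume "prepared s6 \<and> tw s6 = tw s5 \<and> (\<forall>j\<le>D. reals s6 ''f'' (words s6 ''o'' 0 + j) = coeff (\<Prod>i<m. factor pt i) j)"
                "frame ?p2 s5 s6"
              then show "prepared s6 \<and> (\<forall>j\<le>D. reals s6 ''c'' j = count_coeff j) \<and> (\<forall>j\<le>D. reals s6 ''f'' (words s6 ''o'' 0 + j) = prob_coeff j)"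
                using 5 by (simp add: frame_reals prob_coeff_def)
            next
              fix s6 assume "prepared s6 \<and> (\<forall>j\<le>D. reals s6 ''c'' j = count_coeff j) \<and> (\<forall>j\<le>D. reals s6 ''f'' (words s6 ''o'' 0 + j) = prob_coeff j)"
              then show "run (final_prog M) s6 (200 * T + W) ?Q"
                by (intro run_mono[OF run_final le5]) auto
            qed (use T0 in \<open>(simp; fail | linarith | presburger)+\<close>)
          qed (use T0 in \<open>(simp; fail | linarith | presburger)+\<close>)
        qed (use T0 in \<open>(simp; fail | linarith | presburger)+\<close>)
      qed (use T0 in \<open>(simp; fail | linarith | presburger)+\<close>)
    qed (use T0 in \<open>simp_all add: Let_def\<close>)
  qed (use T0 in \<open>(simp; fail | linarith | presburger)+\<close>)
  then show ?thesis unfolding T_def[symmetric]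
    by (rule run_mono) (simp_all add: W_def add_mult_distrib)
qed

end

section \<open>Levels of a source\<close>

locale source =
  fixes m :: nat and p :: "nat \<Rightarrow> 'a pmf" and h :: real
  assumes commensurate: "commensurate_source m p h"
begin

definition count_lt :: "real \<Rightarrow> nat" where "count_lt t = card {x \<in> keys m p. surprisal m p x < t}"
definition count_le :: "real \<Rightarrow> nat" where "count_le t = card {x \<in> keys m p. surprisal m p x \<le> t}"

lemma finite_letters: "i < m \<Longrightarrow> finite (set_pmf (p i))"
  and key_count: "key_count m p \<ge> 2"
  and h_pos: "h > 0"
  and letter_grid: "i < m \<Longrightarrow> a \<in> set_pmf (p i) \<Longrightarrow> letter_surprisal (p i) a \<in> grid h"
  using commensurate unfolding commensurate_source_def by auto

lemma finite_keys: "finite (keys m p)"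
  unfolding keys_def using finite_letters by (intro finite_PiE) auto

lemma keys_nonempty: "keys m p \<noteq> {}"
  using key_count unfolding key_count_def by auto

lemma m_pos: "m > 0"
  using key_count by (cases m) (auto simp: key_count_def keys_def)

lemma key_count_prod: "key_count m p = (\<Prod>i<m. card (set_pmf (p i)))"
  unfolding key_count_def keys_def by (simp add: card_PiE)

lemma pmf_key:
  assumes "x \<in> keys m p"
  shows "pmf (key_pmf m p) x = (\<Prod>i<m. pmf (p i) (x i))"
  unfolding key_pmf_def
  by (rule pmf_Pi') (use assms in \<open>auto simp: keys_def PiE_def extensional_def\<close>)

lemma letter_pos: "x \<in> keys m p \<Longrightarrow> i < m \<Longrightarrow> pmf (p i) (x i) > 0"
  by (auto simp: keys_def PiE_def Pi_def pmf_positive)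

lemma pmf_key_pos: "x \<in> keys m p \<Longrightarrow> pmf (key_pmf m p) x > 0"
  using pmf_key letter_pos by (auto intro!: prod_pos)

lemma set_key_pmf: "set_pmf (key_pmf m p) = keys m p"
  unfolding key_pmf_def keys_def by (auto simp: set_Pi_pmf PiE_dflt_def PiE_def extensional_def)

lemma surprisal_sum: "x \<in> keys m p \<Longrightarrow> surprisal m p x = (\<Sum>i<m. letter_surprisal (p i) (x i))"
  unfolding surprisal_def pmf_key letter_surprisal_def sum_negf
  by (subst ln_prod) (auto dest: letter_pos)

lemma pmf_key_exp: "x \<in> keys m p \<Longrightarrow> pmf (key_pmf m p) x = exp (- surprisal m p x)"
  using pmf_key_pos by (simp add: surprisal_def)

lemma finite_levels: "finite (levels m p)"
  unfolding levels_def using finite_keys by simp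

lemma grid_sum: "(\<And>i. i \<in> A \<Longrightarrow> f i \<in> grid h) \<Longrightarrow> (\<Sum>i\<in>A. f i) \<in> grid h"
proof (induction A rule: infinite_finite_induct)
  case (insert i A)
  obtain k where k: "f i = h * of_int k" using insert.prems[of i] by (auto simp: grid_def)
  have "(\<Sum>i\<in>A. f i) \<in> grid h" using insert by auto
  then obtain l where l: "(\<Sum>i\<in>A. f i) = h * of_int l" by (auto simp: grid_def)
  then have "(\<Sum>i\<in>insert i A. f i) = h * of_int (k + l)" using insert k l by (simp add: algebra_simps)
  then show ?case unfolding grid_def by blast
qed (auto simp: grid_def intro: range_eqI[of _ _ 0])

lemma levels_grid: "levels m p \<subseteq> grid h"
  unfolding levels_def
  by (auto simp: surprisal_sum keys_def PiE_def Pi_def intro!: grid_sum letter_grid)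

section \<open>Counts, distribution function and ranks of a level\<close>

lemma count_le_key_count: "count_le t \<le> key_count m p"
  unfolding count_le_def key_count_def using finite_keys by (auto intro!: card_mono)

lemma prob_unif: "measure_pmf.prob (unif_pmf m p) {x. Q x} = card {x \<in> keys m p. Q x} / key_count m p"
proof -
  have "keys m p \<inter> {x. Q x} = {x \<in> keys m p. Q x}" by auto
  then show ?thesis
    unfolding unif_pmf_def key_count_def using measure_pmf_of_set[OF keys_nonempty finite_keys, of "{x. Q x}"] by simp
qed

lemma cdf_eq: "cdf_S m p t = count_le t / key_count m p" "cdf_S_left m p t = count_lt t / key_count m p"
  unfolding cdf_S_def cdf_S_left_def prob_unif count_le_def count_lt_def by simp_all

lemma card_level: "card {x \<in> keys m p. surprisal m p x = t} = count_le t - count_lt t"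
proof -
  have "{x \<in> keys m p. surprisal m p x \<le> t} = {x \<in> keys m p. surprisal m p x < t} \<union> {x \<in> keys m p. surprisal m p x = t}"
    by auto
  then have "count_le t = count_lt t + card {x \<in> keys m p. surprisal m p x = t}"
    unfolding count_le_def count_lt_def using finite_keys by (simp add: card_Un_disjoint disjoint_iff)
  then show ?thesis by simp
qed

lemma level_size_eq: "level_size m p t = real (count_le t - count_lt t)"
  unfolding level_size_def prob_unif card_level using key_count by simp

lemma level_ranks_eq: "level_ranks m p t = {count_lt t + 1..count_le t}"
proof -
  have "real (key_count m p) * cdf_S_left m p t = real (count_lt t)" "real (key_count m p) * cdf_S m p t = real (count_le t)"
    using key_count by (simp_all add: cdf_eq)
  then show ?thesis unfolding level_ranks_def by (auto simp flip: of_nat_Suc)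
qed

lemma count_lt_less:
  assumes "t \<in> levels m p"
  shows "count_lt t < count_le t"
proof -
  have "{x \<in> keys m p. surprisal m p x = t} \<noteq> {}" using assms by (auto simp: levels_def)
  then have "card {x \<in> keys m p. surprisal m p x = t} > 0" using finite_keys by (simp add: card_gt_0_iff)
  then show ?thesis unfolding card_level by simp
qed

lemma level_avg_eq:
  "level_avg m p \<rho> t = (\<Sum>r=count_lt t+1..count_le t. real r powr \<rho>) / real (count_le t - count_lt t)"
  unfolding level_avg_def level_size_eq level_ranks_eq by simp

lemma level_prob_eq: "level_prob m p t = real (count_le t - count_lt t) * exp (- t)"
proof -
  have "level_prob m p t = (\<Sum>x\<in>{x. surprisal m p x = t} \<inter> keys m p. pmf (key_pmf m p) x)"
    unfolding level_prob_def using finite_keys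
    by (subst measure_Int_set_pmf[symmetric]) (simp add: set_key_pmf measure_measure_pmf_finite)
  also have "{x. surprisal m p x = t} \<inter> keys m p = {x \<in> keys m p. surprisal m p x = t}" by auto
  also have "(\<Sum>x\<in>{x \<in> keys m p. surprisal m p x = t}. pmf (key_pmf m p) x) = (\<Sum>x\<in>{x \<in> keys m p. surprisal m p x = t}. exp (- t))"
    by (intro sum.cong) (auto simp: pmf_key_exp)
  finally show ?thesis by (simp add: card_level)
qed

text \<open>N F_S(t) is the last rank b of the level. Hence the quotient is the power sum over its
  ranks a+1, ..., b divided by (b - a) b^\<rho>, and the bounds for power sums apply.\<close>

lemma level_avg_ratio:
  assumes t: "t \<in> levels m p" and \<rho>: "\<rho> > 0"
  defines "q \<equiv> level_avg m p \<rho> t / (real (key_count m p) * cdf_S m p t) powr \<rho>"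
  shows "1 / (1 + \<rho>) \<le> q" "q \<le> 1" "q = 1 \<longleftrightarrow> level_size m p t = 1"
proof -
  let ?a = "count_lt t" and ?b = "count_le t"
  have ab: "?a < ?b" by (rule count_lt_less[OF t])
  have pos: "real (?b - ?a) * real ?b powr \<rho> > 0" using ab by simp
  have q: "q = (\<Sum>r=?a+1..?b. real r powr \<rho>) / (real (?b - ?a) * real ?b powr \<rho>)"
    unfolding q_def level_avg_eq cdf_eq using key_count by simp
  show "1 / (1 + \<rho>) \<le> q"
    unfolding q using power_sum_ge[OF \<rho> less_imp_le[OF ab]] pos \<rho> ab
    by (simp add: pos_le_divide_eq of_nat_diff field_simps)
  show "q \<le> 1"
    unfolding q divide_le_eq_1_pos[OF pos] by (rule power_sum_le[OF \<rho>])
  show "q = 1 \<longleftrightarrow> level_size m p t = 1"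
    unfolding q level_size_eq using power_sum_eq_iff[OF \<rho> ab] pos by (auto simp: divide_eq_1_iff)
qed

lemma level_term_range:
  assumes t: "t \<in> levels m p" and \<rho>: "\<rho> > 0"
  shows "level_prob m p t * (level_avg m p \<rho> t / real (key_count m p) powr \<rho>) \<in> {0..1}"
proof -
  have nn: "0 \<le> level_avg m p \<rho> t" unfolding level_avg_eq by (intro divide_nonneg_nonneg sum_nonneg) auto
  have up: "count_le t > 0" using count_lt_less[OF t] by simp
  have "level_avg m p \<rho> t \<le> real (count_le t) powr \<rho>"
    using level_avg_ratio(2)[OF t \<rho>] key_count up by (simp add: cdf_eq divide_le_eq)
  also have "\<dots> \<le> real (key_count m p) powr \<rho>" using count_le_key_count \<rho> by (intro powr_mono2) auto
  finally have "level_avg m p \<rho> t / real (key_count m p) powr \<rho> \<le> 1" using key_count by (simp add: divide_le_eq)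
  moreover have "level_prob m p t \<le> 1" "0 \<le> level_prob m p t" unfolding level_prob_def by simp_all
  moreover have "0 \<le> level_avg m p \<rho> t / real (key_count m p) powr \<rho>" using nn by simp
  ultimately show ?thesis unfolding atLeastAtMost_iff by (intro conjI mult_le_one mult_nonneg_nonneg)
qed

text \<open>Sorting the keys by surprisal yields such an order, so statements about all optimal
  orders are not vacuous.\<close>

lemma optimal_order_exists: "\<exists>G. optimal_order m p G"
proof -
  obtain xs where xs: "set xs = keys m p" "distinct xs" using finite_distinct_list[OF finite_keys] by blast
  define ys where "ys = sort_key (surprisal m p) xs"
  have ys: "set ys = keys m p" "distinct ys" "sorted (map (surprisal m p) ys)"
    using xs by (simp_all add: ys_def)
  have len: "length ys = key_count m p"
    using distinct_card[OF ys(2)] ys(1) by (simp add: key_count_def)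
  have bij: "bij_betw ((!) ys) {..<key_count m p} (keys m p)"
    by (rule bij_betw_nth) (use ys len in auto)
  define G where "G x = Suc (the_inv_into {..<key_count m p} ((!) ys) x)" for x
  have "bij_betw (the_inv_into {..<key_count m p} ((!) ys)) (keys m p) {..<key_count m p}"
    by (rule bij_betw_the_inv_into[OF bij])
  moreover have "bij_betw Suc {..<key_count m p} {1..key_count m p}"
    by (rule bij_betwI[of _ _ _ "\<lambda>k. k - 1"]) auto
  ultimately have "bij_betw G (keys m p) {1..key_count m p}"
    using bij_betw_trans unfolding G_def o_def by blast
  moreover have "surprisal m p x \<le> surprisal m p y" if "x \<in> keys m p" "y \<in> keys m p" "G x \<le> G y" for x y
  proof -
    let ?i = "\<lambda>x. the_inv_into {..<key_count m p} ((!) ys) x"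
    have i: "ys ! ?i x = x" "?i x < length ys" if "x \<in> keys m p" for x
      using bij that len f_the_inv_into_f_bij_betw[OF bij] the_inv_into_into[of "(!) ys" "{..<key_count m p}" x "{..<key_count m p}"]
      by (auto simp: bij_betw_def)
    have "?i x \<le> ?i y" using that(3) by (simp add: G_def)
    from sorted_nth_mono[OF ys(3) this] i[OF that(1)] i[OF that(2)] show ?thesis by simp
  qed
  ultimately show ?thesis unfolding optimal_order_def by blast
qed

text \<open>Let a key of the level have rank r. All keys of smaller surprisal come before it, so r
  exceeds their number; the first r ranks belong to keys of surprisal at most t, so r is at most the
  number of those. Equal cardinalities turn this inclusion into a bijection.\<close>

lemma optimal_order_level:
  assumes G: "optimal_order m p G"
  shows "bij_betw G {x \<in> keys m p. surprisal m p x = t} {count_lt t + 1..count_le t}"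
proof -
  let ?L = "{x \<in> keys m p. surprisal m p x = t}" and ?N = "key_count m p"
  have bij: "bij_betw G (keys m p) {1..?N}" and mono: "\<And>x y. x \<in> keys m p \<Longrightarrow> y \<in> keys m p \<Longrightarrow> G x \<le> G y \<Longrightarrow> surprisal m p x \<le> surprisal m p y"
    using G by (auto simp: optimal_order_def)
  have inj: "inj_on G (keys m p)" and img: "G ` keys m p = {1..?N}" using bij by (auto simp: bij_betw_def)
  have "G ` ?L \<subseteq> {count_lt t + 1..count_le t}"
  proof
    fix r assume "r \<in> G ` ?L"
    then obtain x where x: "x \<in> keys m p" "surprisal m p x = t" "r = G x" by auto
    have r: "1 \<le> r" "r \<le> ?N" using img x by auto
    have "G ` {y \<in> keys m p. surprisal m p y < t} \<subseteq> {1..<r}"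
    proof
      fix k assume "k \<in> G ` {y \<in> keys m p. surprisal m p y < t}"
      then obtain y where y: "y \<in> keys m p" "surprisal m p y < t" "k = G y" by auto
      then show "k \<in> {1..<r}" using mono[OF x(1) y(1)] x img by (auto simp: not_le[symmetric])
    qed
    then have "card (G ` {y \<in> keys m p. surprisal m p y < t}) \<le> r - 1"
      using card_mono[of "{1..<r}"] by fastforce
    moreover have "card (G ` {y \<in> keys m p. surprisal m p y < t}) = count_lt t"
      unfolding count_lt_def by (rule card_image) (rule inj_on_subset[OF inj], auto)
    ultimately have 1: "count_lt t + 1 \<le> r" using r by simp
    have "{1..r} \<subseteq> G ` {y \<in> keys m p. surprisal m p y \<le> t}"
    proof
      fix k assume k: "k \<in> {1..r}"
      then have "k \<in> G ` keys m p" using img r by auto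
      then obtain y where y: "y \<in> keys m p" "k = G y" by auto
      then show "k \<in> G ` {y \<in> keys m p. surprisal m p y \<le> t}" using mono[OF y(1) x(1)] x k by auto
    qed
    then have "r \<le> card (G ` {y \<in> keys m p. surprisal m p y \<le> t})"
      using card_mono[of "G ` {y \<in> keys m p. surprisal m p y \<le> t}" "{1..r}"] finite_keys by simp
    also have "\<dots> \<le> count_le t" unfolding count_le_def using finite_keys by (intro card_image_le) simp
    finally show "r \<in> {count_lt t + 1..count_le t}" using 1 by simp
  qed
  moreover have injL: "inj_on G ?L" by (rule inj_on_subset[OF inj]) auto
  moreover have "card (G ` ?L) = card {count_lt t + 1..count_le t}"
    using card_image[OF injL] by (simp add: card_level)
  ultimately show ?thesis by (simp add: bij_betw_def card_subset_eq)
qed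

lemma guess_log_moment_eq:
  assumes G: "optimal_order m p G" and \<rho>: "\<rho> > 0"
  shows "guess_log_moment m p G \<rho> = level_log_moment m p (level_avg m p) \<rho>"
proof -
  let ?N = "real (key_count m p)"
  let ?S = "\<Sum>t\<in>levels m p. level_prob m p t * level_avg m p \<rho> t"
  have "measure_pmf.expectation (key_pmf m p) (\<lambda>x. real (G x) powr \<rho>) = (\<Sum>x\<in>keys m p. real (G x) powr \<rho> * pmf (key_pmf m p) x)"
    by (rule integral_measure_pmf_real) (auto simp: finite_keys set_key_pmf)
  also have "\<dots> = (\<Sum>x\<in>keys m p. real (G x) powr \<rho> * exp (- surprisal m p x))"
    by (intro sum.cong) (auto simp: pmf_key_exp)
  also have "\<dots> = (\<Sum>t\<in>levels m p. \<Sum>x\<in>{x \<in> keys m p. surprisal m p x = t}. real (G x) powr \<rho> * exp (- surprisal m p x))"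
    unfolding levels_def by (rule sum.image_gen[OF finite_keys])
  also have "\<dots> = ?S"
  proof (rule sum.cong)
    fix t assume t: "t \<in> levels m p"
    have "(\<Sum>x\<in>{x \<in> keys m p. surprisal m p x = t}. real (G x) powr \<rho> * exp (- surprisal m p x))
        = (\<Sum>x\<in>{x \<in> keys m p. surprisal m p x = t}. real (G x) powr \<rho>) * exp (- t)"
      by (simp add: sum_distrib_right)
    also have "(\<Sum>x\<in>{x \<in> keys m p. surprisal m p x = t}. real (G x) powr \<rho>) = (\<Sum>r=count_lt t+1..count_le t. real r powr \<rho>)"
      by (rule sum.reindex_bij_betw[OF optimal_order_level[OF G]])
    finally show "(\<Sum>x\<in>{x \<in> keys m p. surprisal m p x = t}. real (G x) powr \<rho> * exp (- surprisal m p x))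
        = level_prob m p t * level_avg m p \<rho> t"
      using count_lt_less[OF t] by (simp add: level_prob_eq level_avg_eq)
  qed simp
  finally have E: "measure_pmf.expectation (key_pmf m p) (\<lambda>x. real (G x) powr \<rho>) = ?S" .
  \<comment> \<open>Positivity allows the logarithm of the quotient by N^\<rho> to be split; it
    follows from the lower bound on the level averages.\<close>
  have pos: "?S > 0"
  proof (rule sum_pos[OF finite_levels])
    show "levels m p \<noteq> {}" using keys_nonempty by (simp add: levels_def)
    fix t assume t: "t \<in> levels m p"
    have "level_avg m p \<rho> t > 0"
    proof -
      have "0 < 1 / (1 + \<rho>)" using \<rho> by simp
      also have "\<dots> \<le> level_avg m p \<rho> t / (?N * cdf_S m p t) powr \<rho>" by (rule level_avg_ratio(1)[OF t \<rho>])
      finally show ?thesis by (simp add: zero_less_divide_iff)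
    qed
    then show "level_prob m p t * level_avg m p \<rho> t > 0"
      using count_lt_less[OF t] by (simp add: level_prob_eq)
  qed
  have N: "?N > 0" using key_count by simp
  have "(\<Sum>t\<in>levels m p. level_prob m p t * (level_avg m p \<rho> t / ?N powr \<rho>)) = ?S / ?N powr \<rho>"
    by (simp add: sum_divide_distrib)
  then have "level_log_moment m p (level_avg m p) \<rho> = \<rho> * ln ?N + ln (?S / ?N powr \<rho>)"
    by (simp add: level_log_moment_def)
  also have "\<dots> = ln ?S" using pos N by (simp add: ln_div ln_powr)
  finally show ?thesis by (simp add: guess_log_moment_def E)
qed

end

section \<open>The program on a source\<close>

lemma nth_concat_map:
  assumes "i < m" "j < length (xs i)"
  shows "concat (map (\<lambda>i. map (f i) (xs i)) [0..<m]) ! ((\<Sum>a<i. length (xs a)) + j) = f i (xs i ! j)"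
  using assms
proof (induction m)
  case (Suc m)
  have len: "length (concat (map (\<lambda>i. map (f i) (xs i)) [0..<m])) = (\<Sum>a<m. length (xs a))" for m
    by (induction m) simp_all
  show ?case
  proof (cases "i = m")
    case True
    then show ?thesis using Suc.prems by (simp add: nth_append len)
  next
    case False
    then have i: "i < m" using Suc.prems by simp
    have "(\<Sum>a<i. length (xs a)) + j < (\<Sum>a<Suc i. length (xs a))" using Suc.prems by simp
    also have "\<dots> \<le> (\<Sum>a<m. length (xs a))" using i by (intro sum_mono2) auto
    finally show ?thesis using Suc.IH[OF i Suc.prems(2)] by (simp add: nth_append len)
  qed
qed simp

lemma length_concat_map: "length (concat (map (\<lambda>i. map (f i) (xs i)) [0..<m])) = (\<Sum>a<m. length (xs a))"
  by (induction m) simp_all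

lemma prod_monom: "finite A \<Longrightarrow> (\<Prod>i\<in>A. monom (w i) (k i)) = monom (\<Prod>i\<in>A. w i :: real) (\<Sum>i\<in>A. k i)"
  by (induction A rule: finite_induct) (simp_all add: mult_monom monom_0 one_pCons)

locale listed_source = source m p h for m and p :: "nat \<Rightarrow> 'a pmf" and h +
  fixes xs :: "nat \<Rightarrow> 'a list"
  assumes enumerates: "enumerates m p xs"
begin

definition smin :: "nat \<Rightarrow> real" where "smin i = Min (letter_surprisal (p i) ` set_pmf (p i))"
definition smax :: "nat \<Rightarrow> real" where "smax i = Max (letter_surprisal (p i) ` set_pmf (p i))"
text \<open>For letters of the alphabet the quotient already is a non-negative integer, so the floor
  changes only the type.\<close>

definition steps :: "nat \<Rightarrow> 'a \<Rightarrow> nat" where "steps i a = nat \<lfloor>(letter_surprisal (p i) a - smin i) / h\<rfloor>"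
definition sz :: "nat \<Rightarrow> nat" where "sz i = length (xs i)"
definition pt :: "nat \<Rightarrow> real" where "pt j = prob_table m p xs ! j"
definition ex :: "nat \<Rightarrow> nat" where "ex j = concat (map (\<lambda>i. map (steps i) (xs i)) [0..<m]) ! j"

lemma xs: "i < m \<Longrightarrow> distinct (xs i)" "i < m \<Longrightarrow> set (xs i) = set_pmf (p i)"
  using enumerates by (auto simp: enumerates_def)

lemma smin_attained:
  assumes "i < m"
  obtains a where "a \<in> set_pmf (p i)" "letter_surprisal (p i) a = smin i"
proof -
  have "smin i \<in> letter_surprisal (p i) ` set_pmf (p i)"
    unfolding smin_def using finite_letters[OF assms] by (intro Min_in) (auto simp: set_pmf_not_empty)
  then show ?thesis using that by auto
qed

lemma smax_attained:
  assumes "i < m"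
  obtains a where "a \<in> set_pmf (p i)" "letter_surprisal (p i) a = smax i"
proof -
  have "smax i \<in> letter_surprisal (p i) ` set_pmf (p i)"
    unfolding smax_def using finite_letters[OF assms] by (intro Max_in) (auto simp: set_pmf_not_empty)
  then show ?thesis using that by auto
qed

lemma smin_le: "i < m \<Longrightarrow> a \<in> set_pmf (p i) \<Longrightarrow> smin i \<le> letter_surprisal (p i) a"
  and smax_ge: "i < m \<Longrightarrow> a \<in> set_pmf (p i) \<Longrightarrow> letter_surprisal (p i) a \<le> smax i"
  unfolding smin_def smax_def using finite_letters by auto

lemma letter_surprisal_steps:
  assumes i: "i < m" and a: "a \<in> set_pmf (p i)"
  shows "letter_surprisal (p i) a = smin i + h * real (steps i a)"
proof -
  obtain b where b: "b \<in> set_pmf (p i)" "letter_surprisal (p i) b = smin i" by (rule smin_attained[OF i])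
  obtain k l where kl: "letter_surprisal (p i) a = h * of_int k" "smin i = h * of_int l"
    using letter_grid[OF i a] letter_grid[OF i b(1)] b(2) by (auto simp: grid_def)
  have "l \<le> k" using smin_le[OF i a] kl h_pos by simp
  moreover have "(letter_surprisal (p i) a - smin i) / h = of_int (k - l)"
    using kl h_pos by (simp add: field_simps)
  ultimately have "real (steps i a) = of_int (k - l)" by (simp add: steps_def)
  then show ?thesis unfolding kl by (simp add: right_diff_distrib)
qed

lemma ex_nth: "i < m \<Longrightarrow> j < sz i \<Longrightarrow> ex ((\<Sum>a<i. sz a) + j) = steps i (xs i ! j)"
  unfolding ex_def sz_def by (rule nth_concat_map)

lemma pt_nth: "i < m \<Longrightarrow> j < sz i \<Longrightarrow> pt ((\<Sum>a<i. sz a) + j) = pmf (p i) (xs i ! j)"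
  unfolding pt_def sz_def prob_table_def by (rule nth_concat_map)

lemma nth_letter: "i < m \<Longrightarrow> j < sz i \<Longrightarrow> xs i ! j \<in> set_pmf (p i)"
  using xs(2)[of i] by (metis nth_mem sz_def)

lemma sz_pos: "i < m \<Longrightarrow> sz i > 0"
  using xs(2)[of i] set_pmf_not_empty[of "p i"] by (auto simp: sz_def)

lemma letter_index: "i < m \<Longrightarrow> a \<in> set_pmf (p i) \<Longrightarrow> \<exists>j<sz i. xs i ! j = a"
  using xs(2)[of i] by (metis in_set_conv_nth sz_def)

lemma pmf_letter: "a \<in> set_pmf (p i) \<Longrightarrow> pmf (p i) a = exp (- letter_surprisal (p i) a)"
  by (simp add: letter_surprisal_def pmf_positive)

lemma running_max_pt:
  assumes i: "i < m"
  shows "running_max 0 (\<lambda>j. pt ((\<Sum>a<i. sz a) + j)) (sz i) = exp (- smin i)"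
  unfolding running_max_eq
proof (rule Max_eqI)
  obtain a where a: "a \<in> set_pmf (p i)" "letter_surprisal (p i) a = smin i" by (rule smin_attained[OF i])
  from letter_index[OF i a(1)] obtain j where "j < sz i" "xs i ! j = a" by blast
  then show "exp (- smin i) \<in> insert 0 ((\<lambda>j. pt ((\<Sum>a<i. sz a) + j)) ` {..<sz i})"
    using a pt_nth[OF i] pmf_letter by (auto intro!: image_eqI[of _ _ j])
next
  fix y assume "y \<in> insert 0 ((\<lambda>j. pt ((\<Sum>a<i. sz a) + j)) ` {..<sz i})"
  then show "y \<le> exp (- smin i)"
    using pt_nth[OF i] nth_letter[OF i] smin_le[OF i] pmf_letter by fastforce
qed simp

text \<open>Connects the numerical tables, which are all the program sees, with the source: the
  logarithm of the largest probability minus that of a letter is the surprisal of the letter above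
  the minimum.\<close>

sublocale L: level_data m sz pt h ex
proof
  fix i j assume ij: "i < m" "j < sz i"
  note a = nth_letter[OF ij]
  show "ln (running_max 0 (\<lambda>j. pt ((\<Sum>a<i. sz a) + j)) (sz i)) - ln (pt ((\<Sum>a<i. sz a) + j)) = h * real (ex ((\<Sum>a<i. sz a) + j))"
    using letter_surprisal_steps[OF ij(1) a]
    by (simp add: running_max_pt[OF ij(1)] pt_nth[OF ij] ex_nth[OF ij] pmf_letter[OF a])
qed (use h_pos sz_pos in auto)

lemma deg_eq:
  assumes i: "i < m"
  shows "h * real (L.deg i) = smax i - smin i"
proof -
  obtain a where a: "a \<in> set_pmf (p i)" "letter_surprisal (p i) a = smax i" by (rule smax_attained[OF i])
  have "L.deg i = steps i a"
    unfolding L.deg_def running_max_eq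
  proof (rule Max_eqI)
    from letter_index[OF i a(1)] obtain j where "j < sz i" "xs i ! j = a" by blast
    then show "steps i a \<in> insert 0 ((\<lambda>j. ex (L.off i + j)) ` {..<sz i})"
      using ex_nth[OF i] by (auto simp: L.off_def intro!: image_eqI[of _ _ j])
  next
    fix y assume "y \<in> insert 0 ((\<lambda>j. ex (L.off i + j)) ` {..<sz i})"
    then consider "y = 0" | j where "j < sz i" "y = steps i (xs i ! j)"
      using ex_nth[OF i] by (auto simp: L.off_def)
    then show "y \<le> steps i a"
    proof cases
      case 2
      have "h * real (steps i (xs i ! j)) \<le> h * real (steps i a)"
        using smax_ge[OF i nth_letter[OF i 2(1)]] letter_surprisal_steps[OF i a(1)] letter_surprisal_steps[OF i nth_letter[OF i 2(1)]] a(2)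
        by simp
      then show ?thesis using 2(2) h_pos by simp
    qed simp
  qed simp
  then show ?thesis using letter_surprisal_steps[OF i a(1)] a(2) by simp
qed

lemma D_eq: "real L.D = surprisal_range m p / h"
proof -
  have "h * real L.D = surprisal_range m p"
    by (simp add: L.D_def surprisal_range_def sum_distrib_left deg_eq smin_def smax_def)
  then show ?thesis using h_pos by (simp add: field_simps)
qed

lemma sz_card: "i < m \<Longrightarrow> sz i = card (set_pmf (p i))"
  using xs[of i] by (metis distinct_card sz_def)

lemma off_eq: "L.off m = input_size m p"
  by (simp add: L.off_def input_size_def sz_card)

lemma key_total_eq: "L.key_total = real (key_count m p)"
  by (simp add: L.key_total_def key_count_prod sz_card)

definition key_steps :: "(nat \<Rightarrow> 'a) \<Rightarrow> nat" where "key_steps x = (\<Sum>i<m. steps i (x i))"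
definition level :: "nat \<Rightarrow> real" where "level n = (\<Sum>i<m. smin i) + h * real n"

lemma letter_key: "x \<in> keys m p \<Longrightarrow> i < m \<Longrightarrow> x i \<in> set_pmf (p i)"
  by (auto simp: keys_def)

lemma surprisal_level: "x \<in> keys m p \<Longrightarrow> surprisal m p x = level (key_steps x)"
  by (simp add: surprisal_sum letter_surprisal_steps letter_key level_def key_steps_def sum.distrib sum_distrib_left)

lemma level_less_iff [simp]: "level i < level j \<longleftrightarrow> i < j"
  and level_le_iff [simp]: "level i \<le> level j \<longleftrightarrow> i \<le> j"
  and level_eq_iff [simp]: "level i = level j \<longleftrightarrow> i = j"
  using h_pos by (auto simp: level_def)

lemma key_steps_le:
  assumes x: "x \<in> keys m p"
  shows "key_steps x \<le> L.D"
  unfolding key_steps_def L.D_def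
proof (rule sum_mono)
  fix i assume i: "i \<in> {..<m}"
  from letter_index[OF _ letter_key[OF x]] i obtain j where j: "j < sz i" "xs i ! j = x i" by auto
  then show "steps i (x i) \<le> L.deg i" using L.deg_ge[OF j(1)] ex_nth[of i j] i by (simp add: L.off_def)
qed

lemma factor_eq:
  assumes i: "i < m" and w: "\<And>j. j < sz i \<Longrightarrow> wt (L.off i + j) = w (xs i ! j)"
  shows "L.factor wt i = (\<Sum>a\<in>set_pmf (p i). monom (w a) (steps i a))"
proof -
  have "L.factor wt i = (\<Sum>j<sz i. monom (w (xs i ! j)) (steps i (xs i ! j)))"
    unfolding L.factor_def using w ex_nth[OF i] by (intro sum.cong) (auto simp: L.off_def)
  also have "\<dots> = (\<Sum>a\<in>set_pmf (p i). monom (w a) (steps i a))"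
    by (rule sum.reindex_bij_betw[OF bij_betw_nth]) (use xs[OF i] in \<open>auto simp: sz_def\<close>)
  finally show ?thesis .
qed

text \<open>Expanding the product chooses one letter per coordinate, that is, a key; the exponents
  add up to its number of grid steps and the weights multiply.\<close>

lemma coeff_factors:
  assumes w: "\<And>i j. i < m \<Longrightarrow> j < sz i \<Longrightarrow> wt (L.off i + j) = w i (xs i ! j)"
  shows "coeff (\<Prod>i<m. L.factor wt i) n = (\<Sum>x | x \<in> keys m p \<and> key_steps x = n. \<Prod>i<m. w i (x i))"
proof -
  have "(\<Prod>i<m. L.factor wt i) = (\<Prod>i<m. \<Sum>a\<in>set_pmf (p i). monom (w i a) (steps i a))"
    using w by (intro prod.cong factor_eq) auto
  also have "\<dots> = (\<Sum>x\<in>keys m p. \<Prod>i<m. monom (w i (x i)) (steps i (x i)))"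
    unfolding keys_def by (rule prod_sum_PiE) (auto intro: finite_letters)
  also have "\<dots> = (\<Sum>x\<in>keys m p. monom (\<Prod>i<m. w i (x i)) (key_steps x))"
    by (simp add: prod_monom key_steps_def)
  finally have "coeff (\<Prod>i<m. L.factor wt i) n = (\<Sum>x\<in>keys m p. if key_steps x = n then \<Prod>i<m. w i (x i) else 0)"
    by (simp add: coeff_sum)
  also have "\<dots> = (\<Sum>x | x \<in> keys m p \<and> key_steps x = n. \<Prod>i<m. w i (x i))"
    by (rule sum.inter_filter[symmetric, OF finite_keys])
  finally show ?thesis .
qed

lemma count_coeff_eq: "L.count_coeff n = real (card {x \<in> keys m p. key_steps x = n})"
  unfolding L.count_coeff_def by (subst coeff_factors[where w = "\<lambda>_ _. 1"]) simp_all

lemma prob_coeff_eq: "L.prob_coeff n = level_prob m p (level n)"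
proof -
  have "L.prob_coeff n = (\<Sum>x | x \<in> keys m p \<and> key_steps x = n. \<Prod>i<m. pmf (p i) (x i))"
    unfolding L.prob_coeff_def using pt_nth by (intro coeff_factors) (simp add: L.off_def)
  also have "\<dots> = (\<Sum>x\<in>{x \<in> keys m p. surprisal m p x = level n}. exp (- level n))"
    by (intro sum.cong) (auto simp: surprisal_level pmf_key_exp pmf_key[symmetric])
  finally show ?thesis by (simp add: card_level level_prob_eq)
qed

lemma cum_eq: "L.cum n = real (card {x \<in> keys m p. key_steps x < n})"
proof (induction n)
  case (Suc n)
  have "{x \<in> keys m p. key_steps x < Suc n} = {x \<in> keys m p. key_steps x < n} \<union> {x \<in> keys m p. key_steps x = n}" by auto
  then have "card {x \<in> keys m p. key_steps x < Suc n} = card {x \<in> keys m p. key_steps x < n} + card {x \<in> keys m p. key_steps x = n}"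
    using finite_keys by (simp add: card_Un_disjoint disjoint_iff)
  then show ?case using Suc by (simp add: L.cum_def count_coeff_eq)
qed (simp add: L.cum_def)

lemma cum_cdf:
  "L.cum n / L.key_total = cdf_S_left m p (level n)" "L.cum (Suc n) / L.key_total = cdf_S m p (level n)"
proof -
  have "{x \<in> keys m p. surprisal m p x < level n} = {x \<in> keys m p. key_steps x < n}"
    "{x \<in> keys m p. surprisal m p x \<le> level n} = {x \<in> keys m p. key_steps x < Suc n}"
    by (auto simp: surprisal_level)
  then show "L.cum n / L.key_total = cdf_S_left m p (level n)" "L.cum (Suc n) / L.key_total = cdf_S m p (level n)"
    by (simp_all add: cdf_eq cum_eq key_total_eq count_lt_def count_le_def)
qed

lemma level_sum_eq:
  "L.level_sum M \<rho> (Suc L.D) = (\<Sum>t\<in>levels m p. level_prob m p t *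
     (evaluator M \<rho> (real (key_count m p)) (cdf_S_left m p t) (cdf_S m p t) / real (key_count m p) powr \<rho>))"
    (is "_ = sum ?g (levels m p)")
proof -
  have "L.level_sum M \<rho> (Suc L.D) = (\<Sum>n<Suc L.D. ?g (level n))"
    unfolding L.level_sum_def prob_coeff_eq cum_cdf(2) unfolding cum_cdf(1) unfolding key_total_eq ..
  also have "\<dots> = sum ?g (level ` {..<Suc L.D})"
    by (subst sum.reindex) (auto simp: inj_on_def)
  also have "\<dots> = sum ?g (levels m p)"
  proof (rule sum.mono_neutral_right)
    show "levels m p \<subseteq> level ` {..<Suc L.D}"
      using key_steps_le by (auto simp: levels_def surprisal_level less_Suc_eq_le)
    \<comment> \<open>The program visits all D + 1 grid points. A point that carries no key has
      probability zero, so whatever the evaluator returns for its empty interval of ranks is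
      multiplied by zero.\<close>
    show "\<forall>t\<in>level ` {..<Suc L.D} - levels m p. ?g t = 0"
    proof
      fix t assume "t \<in> level ` {..<Suc L.D} - levels m p"
      then have "t \<notin> surprisal m p ` keys m p" by (simp add: levels_def)
      then have "{x \<in> keys m p. surprisal m p x = t} = {}" by blast
      then have "count_le t - count_lt t = 0" using card_level[of t] by (metis card.empty)
      then show "?g t = 0" by (simp add: level_prob_eq)
    qed
  qed simp
  finally show ?thesis .
qed

lemma input_source: "L.input (source_input m p h xs)"
proof -
  have "length (prob_table m p xs) = L.off m"
    unfolding prob_table_def length_concat_map L.off_def sz_def ..
  then show ?thesis by (simp add: L.input_def source_input_def sz_def pt_def)
qed

lemma main_prog_outputs:
  assumes L: "2 * (L.D + m) \<le> 2^l"
  shows "\<exists>n. outputs (main_prog M) (source_input m p h xs) n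
      (level_ratio m p (\<lambda>\<rho> t. evaluator M \<rho> (real (key_count m p)) (cdf_S_left m p t) (cdf_S m p t))) \<and>
      n \<le> (30000 + 2 * level_cost M) * ((l + 1) * (l + 1) * (L.off m + L.D + 2 * m + 1))"
proof -
  obtain n s' where n: "exec (main_prog M) (source_input m p h xs) n s'"
    "n \<le> (30000 + 2 * level_cost M) * ((l + 1) * (l + 1) * (L.off m + L.D + 2 * m + 1))"
    "reals s' ''out'' 0 = (ln L.key_total + ln (L.level_sum M 1 (Suc L.D))) / (1/2 * ln L.key_total + ln (L.level_sum M (1/2) (Suc L.D)))"
    using L.run_main[OF input_source m_pos L, of M] unfolding run_def by blast
  moreover have "(ln L.key_total + ln (L.level_sum M 1 (Suc L.D))) / (1/2 * ln L.key_total + ln (L.level_sum M (1/2) (Suc L.D)))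
     = level_ratio m p (\<lambda>\<rho> t. evaluator M \<rho> (real (key_count m p)) (cdf_S_left m p t) (cdf_S m p t))"
    unfolding level_ratio_def level_log_moment_def level_sum_eq key_total_eq mult_1 ..
  ultimately show ?thesis unfolding outputs_def by auto
qed

lemma off_ge: "m \<le> L.off m"
proof -
  have "(\<Sum>i<m. 1) \<le> (\<Sum>i<m. sz i)" using sz_pos by (intro sum_mono) (simp add: Suc_le_eq)
  then show ?thesis by (simp add: L.off_def)
qed

text \<open>The constant 36 is 3 * 3 * 4: each of the two factors l + 1 is at most 3 (1 + ln (1 +
  X)), and the linear size term is at most 4 X.\<close>

lemma main_prog_time:
  defines "X \<equiv> surprisal_range m p / h + real (input_size m p)"
  shows "\<exists>n. outputs (main_prog M) (source_input m p h xs) n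
      (level_ratio m p (\<lambda>\<rho> t. evaluator M \<rho> (real (key_count m p)) (cdf_S_left m p t) (cdf_S m p t))) \<and>
      real n \<le> 36 * (30000 + 2 * real (level_cost M)) * X * (1 + ln (1 + X))^2"
proof -
  define x where "x = L.D + L.off m"
  have X: "X = real x" by (simp add: X_def x_def D_eq off_eq)
  have x1: "x \<ge> 1" "L.D + m \<le> x" using m_pos off_ge by (auto simp: x_def)
  define l where "l = (LEAST l. 2 * x \<le> 2^l)"
  have l: "2 * x \<le> 2^l"
    unfolding l_def by (rule LeastI[of _ "2 * x"]) (simp add: less_imp_le)
  have "2 * (L.D + m) \<le> 2^l" by (rule le_trans[OF _ l]) (use x1 in simp)
  then obtain n where n: "outputs (main_prog M) (source_input m p h xs) n
      (level_ratio m p (\<lambda>\<rho> t. evaluator M \<rho> (real (key_count m p)) (cdf_S_left m p t) (cdf_S m p t)))"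
      "n \<le> (30000 + 2 * level_cost M) * ((l + 1) * (l + 1) * (L.off m + L.D + 2 * m + 1))"
    using main_prog_outputs by blast
  have l_le: "real (l + 1) \<le> 3 * (1 + ln (1 + X))"
  proof -
    have "l > 0" using l x1 by (cases l) auto
    then have "\<not> 2 * x \<le> 2^(l-1)"
      unfolding l_def by (intro not_less_Least) (simp add: l_def)
    then have "(2::nat)^(l-1) \<le> 2 * x" by simp
    then have "real (2^(l-1)) \<le> real (2 * x)" by (rule of_nat_mono)
    then have "ln (2^(l-1)) \<le> ln (2 * real x)" using x1 by (subst ln_le_cancel_iff) auto
    then have "real (l - 1) * ln 2 \<le> ln 2 + ln (real x)" using x1 by (simp add: ln_realpow ln_mult)
    moreover have "ln (real x) \<le> ln (1 + X)" using x1 by (simp add: X)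
    ultimately have 1: "(real l - 2) * ln 2 \<le> ln (1 + X)" using \<open>l > 0\<close> by (simp add: of_nat_diff algebra_simps)
    have "ln (1 + X) \<ge> 0" using X by simp
    then have "real l - 2 \<le> 2 * ln (1 + X)"
    proof (cases "real l \<le> 2")
      case False
      have "(real l - 2) * (1/2) \<le> (real l - 2) * ln 2"
        using False ln2_ge_two_thirds by (intro mult_left_mono) auto
      then show ?thesis using 1 by simp
    qed simp
    then show ?thesis using \<open>ln (1 + X) \<ge> 0\<close> by simp
  qed
  have "L.off m + L.D + 2 * m + 1 \<le> 4 * x" using x1 off_ge by (simp add: x_def)
  then have u: "real (L.off m + L.D + 2 * m + 1) \<le> 4 * X" unfolding X by linarith
  have "real n \<le> real ((30000 + 2 * level_cost M) * ((l + 1) * (l + 1) * (L.off m + L.D + 2 * m + 1)))"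
    using n(2) by (rule of_nat_mono)
  also have "\<dots> = (30000 + 2 * real (level_cost M)) * (real (l + 1) * real (l + 1) * real (L.off m + L.D + 2 * m + 1))"
    by (simp only: of_nat_mult of_nat_add of_nat_numeral)
  also have "\<dots> \<le> (30000 + 2 * real (level_cost M)) * ((3 * (1 + ln (1 + X))) * (3 * (1 + ln (1 + X))) * (4 * X))"
    by (intro mult_left_mono mult_mono l_le u) (use X in auto)
  also have "\<dots> = 36 * (30000 + 2 * real (level_cost M)) * X * (1 + ln (1 + X))^2"
    by (simp add: power2_eq_square algebra_simps)
  finally show ?thesis using n(1) by blast
qed

end

section \<open>Running time in terms of the number of coordinates\<close>

context source
begin

text \<open>At least two keys force a coordinate with at least two letters. Its probabilities are
  below 1, so its surprisals are positive multiples of \<open>h\<close> and its probabilities are at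
  most exp(-h); as they sum to 1, there are at least exp h letters.\<close>

lemma exp_h_le_input_size: "exp h \<le> real (input_size m p)"
proof -
  have "\<exists>i<m. card (set_pmf (p i)) \<noteq> 1"
  proof (rule ccontr)
    assume "\<not> (\<exists>i<m. card (set_pmf (p i)) \<noteq> 1)"
    then have "key_count m p = 1" by (simp add: key_count_prod)
    then show False using key_count by simp
  qed
  then obtain i where i: "i < m" "card (set_pmf (p i)) \<noteq> 1" by blast
  let ?A = "set_pmf (p i)"
  have le: "pmf (p i) a \<le> exp (- h)" if a: "a \<in> ?A" for a
  proof -
    obtain b where b: "b \<in> ?A" "b \<noteq> a"
    proof (rule ccontr)
      assume "\<not> thesis"
      then have "?A = {a}" using a that by auto
      then show False using i(2) by simp
    qed
    have "pmf (p i) a + pmf (p i) b = (\<Sum>x\<in>{a, b}. pmf (p i) x)" using b by simp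
    also have "\<dots> \<le> (\<Sum>x\<in>?A. pmf (p i) x)" using a b finite_letters[OF i(1)] by (intro sum_mono2) auto
    also have "\<dots> = 1" by (rule sum_pmf_eq_1) (use finite_letters[OF i(1)] in auto)
    finally have lt: "pmf (p i) a < 1" using pmf_positive[OF b(1)] by simp
    then have "letter_surprisal (p i) a > 0" using pmf_positive[OF a] by (simp add: letter_surprisal_def)
    moreover obtain k where "letter_surprisal (p i) a = h * of_int k" using letter_grid[OF i(1) a] by (auto simp: grid_def)
    ultimately have "h * 1 \<le> letter_surprisal (p i) a" using h_pos by (simp add: zero_less_mult_iff)
    then have "ln (pmf (p i) a) \<le> - h" by (simp add: letter_surprisal_def)
    then show ?thesis using pmf_positive[OF a] by (metis exp_le_cancel_iff exp_ln)
  qed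
  have "1 = (\<Sum>x\<in>?A. pmf (p i) x)" by (rule sum_pmf_eq_1[symmetric]) (use finite_letters[OF i(1)] in auto)
  also have "\<dots> \<le> real (card ?A) * exp (- h)" using le sum_bounded_above[of ?A "pmf (p i)" "exp (- h)"] by simp
  finally have "exp h \<le> real (card ?A)" by (simp add: exp_minus field_simps)
  also have "\<dots> \<le> real (input_size m p)"
    unfolding input_size_def using i(1) by (intro of_nat_mono member_le_sum) auto
  finally show ?thesis .
qed

text \<open>Here m = Y h, so the bound on the input size reads B_in \<le> c Y (1 + h), and it
  remains to see that h is logarithmic in Y. This follows from exp h \<le> B_in, which also forces c
  > 0.\<close>

lemma extensive_size:
  fixes c :: real
  assumes R: "surprisal_range m p \<le> c * real m" and B: "real (input_size m p) \<le> c * (real m + real m / h)"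
  defines "Y \<equiv> real m / h" and "K \<equiv> 2 + 2 * \<bar>ln (2 * c)\<bar>"
  shows "c > 0" and "surprisal_range m p / h + real (input_size m p) \<le> c * (2 + K) * Y * (1 + ln (1 + Y))"
proof -
  have m: "real m > 0" using m_pos by simp
  have Y: "Y > 0" "real m = Y * h" using m h_pos by (simp_all add: Y_def)
  have Bpos: "exp h \<le> c * (real m + Y)" using exp_h_le_input_size B unfolding Y_def by linarith
  have "0 < c * (real m + Y)" using Bpos by (rule less_le_trans[OF exp_gt_zero])
  then show c: "c > 0" using m Y by (simp add: zero_less_mult_iff)
  have h_le: "h \<le> K * (1 + ln (1 + Y))"
  proof -
    have "exp (h/2) * exp (h/2) = exp h" by (simp add: exp_add[symmetric])
    also have "\<dots> \<le> c * Y * (1 + h)" using Bpos by (simp add: Y algebra_simps)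
    \<comment> \<open>Trading 1 + h for an exponential of h/2 lets one factor exp(h/2) cancel, which
      leaves h \<le> 2 ln (2 c Y); this explains the constant \<open>K\<close>.\<close>
    also have "1 + h \<le> 2 * exp (h/2)" using exp_ge_add_one_self[of "h/2"] by linarith
    also have "c * Y * (2 * exp (h/2)) = 2 * c * Y * exp (h/2)" by simp
    finally have "exp (h/2) * exp (h/2) \<le> 2 * c * Y * exp (h/2)"
      using c Y by simp
    then have "exp (h/2) \<le> 2 * c * Y" by simp
    then have "h / 2 \<le> ln (2 * c * Y)" using c Y by (subst ln_ge_iff) auto
    also have "\<dots> = ln (2 * c) + ln Y" using c Y by (simp add: ln_mult)
    finally have "h \<le> 2 * ln (2 * c) + 2 * ln Y" by simp
    also have "\<dots> \<le> 2 * \<bar>ln (2 * c)\<bar> + 2 * ln (1 + Y)"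
    proof -
      have "ln Y \<le> ln (1 + Y)" using Y by simp
      then show ?thesis by linarith
    qed
    also have "\<dots> \<le> K * (1 + ln (1 + Y))"
    proof -
      have "0 \<le> \<bar>ln (2 * c)\<bar> * ln (1 + Y)" using Y by simp
      then show ?thesis unfolding K_def by (simp add: algebra_simps)
    qed
    finally show ?thesis .
  qed
  have l1: "1 \<le> 1 + ln (1 + Y)" using Y by simp
  have "surprisal_range m p / h \<le> c * Y"
    using R h_pos by (simp add: Y_def divide_right_mono)
  moreover have "real (input_size m p) \<le> c * (Y * h + Y)" using B Y unfolding Y_def by simp
  ultimately have "surprisal_range m p / h + real (input_size m p) \<le> c * Y * (2 + h)" by (simp add: algebra_simps)
  also have "\<dots> \<le> c * Y * (2 * (1 + ln (1 + Y)) + K * (1 + ln (1 + Y)))"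
  proof (rule mult_left_mono)
    show "2 + h \<le> 2 * (1 + ln (1 + Y)) + K * (1 + ln (1 + Y))"
      using l1 by (intro add_mono h_le) simp
  qed (use c Y in simp)
  finally show "surprisal_range m p / h + real (input_size m p) \<le> c * (2 + K) * Y * (1 + ln (1 + Y))"
    by (simp add: algebra_simps)
qed

end

text \<open>The bound on X brings one logarithm of Y and the polylogarithmic factor two more, hence
  the cube. The latter is controlled by 1 + X \<le> (1 + C)(1 + Y)^2, which uses 1 + ln (1 + Y)
  \<le> 1 + Y.\<close>

lemma soft_O_compose:
  fixes X Y C :: real
  assumes "0 \<le> X" "0 < Y" "0 \<le> C" "X \<le> C * Y * (1 + ln (1 + Y))"
  shows "X * (1 + ln (1 + X))^2 \<le> C * (3 + ln (1 + C))^2 * Y * (1 + ln (1 + Y))^3"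
proof -
  let ?l = "1 + ln (1 + Y)"
  have l1: "1 \<le> ?l" using assms by simp
  have lY: "?l \<le> 1 + Y" using ln_add_one_self_le_self[of Y] assms by simp
  have "1 + X \<le> 1 + C * Y * (1 + Y)"
    using assms mult_left_mono[OF lY, of "C * Y"] by simp
  also have "\<dots> \<le> (1 + C) * (1 + Y)^2"
    using assms by (simp add: power2_eq_square algebra_simps)
  finally have "ln (1 + X) \<le> ln ((1 + C) * (1 + Y)^2)" using assms by (subst ln_le_cancel_iff) auto
  also have "\<dots> = ln (1 + C) + 2 * ln (1 + Y)" using assms by (simp add: ln_mult ln_realpow)
  finally have "1 + ln (1 + X) \<le> 1 + ln (1 + C) + 2 * ln (1 + Y)" by simp
  also have "\<dots> \<le> (3 + ln (1 + C)) * ?l"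
  proof -
    have "0 \<le> ln (1 + C) * ln (1 + Y)" "0 \<le> ln (1 + Y)" using assms by simp_all
    then show ?thesis by (simp add: algebra_simps)
  qed
  finally have l: "1 + ln (1 + X) \<le> (3 + ln (1 + C)) * ?l" .
  have "X * (1 + ln (1 + X))^2 \<le> (C * Y * ?l) * ((3 + ln (1 + C)) * ?l)^2"
    using assms l l1 by (intro mult_mono power_mono) auto
  also have "\<dots> = C * (3 + ln (1 + C))^2 * Y * ?l^3" by (simp add: power_mult_distrib power2_eq_square power3_eq_cube)
  finally show ?thesis .
qed

lemma main_prog_solves:
  "solves_in_soft_O (main_prog M) (evaluator M) (\<lambda>m (p :: nat \<Rightarrow> 'a pmf) h. True)
     (\<lambda>m p h. surprisal_range m p / h + real (input_size m p))"
  unfolding solves_in_soft_O_def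
proof (rule exI[of _ "36 * (30000 + 2 * real (level_cost M))"], rule exI[of _ 2], intro allI impI, elim conjE)
  fix m h xs and p :: "nat \<Rightarrow> 'a pmf"
  assume "commensurate_source m p h" "enumerates m p xs"
  then interpret listed_source m p h xs by unfold_locales
  show "\<exists>n. outputs (main_prog M) (source_input m p h xs) n
      (level_ratio m p (\<lambda>\<rho> t. evaluator M \<rho> (real (key_count m p)) (cdf_S_left m p t) (cdf_S m p t))) \<and>
      real n \<le> 36 * (30000 + 2 * real (level_cost M)) * (surprisal_range m p / h + real (input_size m p)) *
        (1 + ln (1 + (surprisal_range m p / h + real (input_size m p))))^2"
    by (rule main_prog_time)
qed

text \<open>The program does not depend on \<open>c\<close>, which only enters the constant of the
  time bound.\<close>

lemma main_prog_solves_extensive: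
  "solves_in_soft_O (main_prog M) (evaluator M)
     (\<lambda>m (p :: nat \<Rightarrow> 'a pmf) h. surprisal_range m p \<le> c * real m \<and> real (input_size m p) \<le> c * (real m + real m / h))
     (\<lambda>m p h. real m / h)"
proof -
  define K where "K = 2 + 2 * \<bar>ln (2 * c)\<bar>"
  define C0 where "C0 = 36 * (30000 + 2 * real (level_cost M))"
  define C where "C = c * (2 + K)"
  show ?thesis unfolding solves_in_soft_O_def
  proof (rule exI[of _ "C0 * (C * (3 + ln (1 + C))^2)"], rule exI[of _ 3], intro allI impI, elim conjE)
    fix m h xs and p :: "nat \<Rightarrow> 'a pmf"
    assume "commensurate_source m p h" "enumerates m p xs"
      and Q: "surprisal_range m p \<le> c * real m" "real (input_size m p) \<le> c * (real m + real m / h)"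
    then interpret listed_source m p h xs by unfold_locales auto
    let ?X = "surprisal_range m p / h + real (input_size m p)" and ?Y = "real m / h"
    have X: "?X \<le> C * ?Y * (1 + ln (1 + ?Y))" and c: "c > 0"
      using extensive_size[OF Q] by (simp_all add: C_def K_def)
    have X0: "0 \<le> ?X" using D_eq by (metis add_nonneg_nonneg of_nat_0_le_iff)
    have Y0: "0 < ?Y" using m_pos h_pos by simp
    have C: "0 \<le> C" using c by (simp add: C_def K_def)
    obtain n where n: "outputs (main_prog M) (source_input m p h xs) n
      (level_ratio m p (\<lambda>\<rho> t. evaluator M \<rho> (real (key_count m p)) (cdf_S_left m p t) (cdf_S m p t)))"
      "real n \<le> C0 * ?X * (1 + ln (1 + ?X))^2"
      using main_prog_time[of M] unfolding C0_def by blast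
    note n(2)
    also have "C0 * ?X * (1 + ln (1 + ?X))^2 \<le> C0 * (C * (3 + ln (1 + C))^2 * ?Y * (1 + ln (1 + ?Y))^3)"
      unfolding mult.assoc[of C0] by (intro mult_left_mono soft_O_compose X0 Y0 C X) (simp add: C0_def)
    finally show "\<exists>n. outputs (main_prog M) (source_input m p h xs) n
      (level_ratio m p (\<lambda>\<rho> t. evaluator M \<rho> (real (key_count m p)) (cdf_S_left m p t) (cdf_S m p t))) \<and>
      real n \<le> C0 * (C * (3 + ln (1 + C))^2) * ?Y * (1 + ln (1 + ?Y))^3"
      using n(1) by (auto simp: mult.assoc)
  qed
qed

theorem theorem4p1:
  shows
    "(\<forall>m (p :: nat \<Rightarrow> 'a pmf) h. commensurate_source m p h \<longrightarrow>
        finite (levels m p) \<and> levels m p \<subseteq> grid h \<and>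
        (\<exists>G. optimal_order m p G) \<and>
        (\<forall>G. optimal_order m p G \<longrightarrow>
           (\<forall>\<rho>>0. guess_log_moment m p G \<rho> = level_log_moment m p (level_avg m p) \<rho>) \<and>
           guess_log_moment m p G 1 / guess_log_moment m p G (1/2) =
             level_ratio m p (level_avg m p)) \<and>
        (\<forall>\<rho>>0. \<forall>t\<in>levels m p.
           level_prob m p t * (level_avg m p \<rho> t / real (key_count m p) powr \<rho>) \<in> {0..1} \<and>
           1 / (1 + \<rho>) \<le> level_avg m p \<rho> t / (real (key_count m p) * cdf_S m p t) powr \<rho> \<and>
           level_avg m p \<rho> t / (real (key_count m p) * cdf_S m p t) powr \<rho> \<le> 1 \<and>
           (level_avg m p \<rho> t / (real (key_count m p) * cdf_S m p t) powr \<rho> = 1 \<longleftrightarrow>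
              level_size m p t = 1))) \<and>
     (\<forall>\<delta>>0. \<exists>E. level_evaluator \<delta> (1/2) (E (1/2)) \<and> level_evaluator \<delta> 1 (E 1) \<and>
        (\<exists>prog.
           solves_in_soft_O prog E (\<lambda>m (p :: nat \<Rightarrow> 'a pmf) h. True)
             (\<lambda>m p h. surprisal_range m p / h + real (input_size m p)) \<and>
           (\<forall>c. solves_in_soft_O prog E
             (\<lambda>m (p :: nat \<Rightarrow> 'a pmf) h.
                surprisal_range m p \<le> c * real m \<and>
                real (input_size m p) \<le> c * (real m + real m / h))
             (\<lambda>m p h. real m / h))))"
proof (intro conjI allI impI)
  fix m h and p :: "nat \<Rightarrow> 'a pmf"
  assume "commensurate_source m p h"
  then interpret source m p h by unfold_locales
  show "finite (levels m p)" by (rule finite_levels)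
  show "levels m p \<subseteq> grid h" by (rule levels_grid)
  show "\<exists>G. optimal_order m p G" by (rule optimal_order_exists)
  show "guess_log_moment m p G \<rho> = level_log_moment m p (level_avg m p) \<rho>"
    if "optimal_order m p G" "\<rho> > 0" for G \<rho>
    using that by (rule guess_log_moment_eq)
  show "guess_log_moment m p G 1 / guess_log_moment m p G (1/2) = level_ratio m p (level_avg m p)"
    if "optimal_order m p G" for G
    using guess_log_moment_eq[OF that] by (simp add: level_ratio_def)
  show "\<forall>t\<in>levels m p.
         level_prob m p t * (level_avg m p \<rho> t / real (key_count m p) powr \<rho>) \<in> {0..1} \<and>
         1 / (1 + \<rho>) \<le> level_avg m p \<rho> t / (real (key_count m p) * cdf_S m p t) powr \<rho> \<and>
         level_avg m p \<rho> t / (real (key_count m p) * cdf_S m p t) powr \<rho> \<le> 1 \<and>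
         (level_avg m p \<rho> t / (real (key_count m p) * cdf_S m p t) powr \<rho> = 1 \<longleftrightarrow> level_size m p t = 1)"
    if "\<rho> > 0" for \<rho>
    using level_term_range[OF _ that] level_avg_ratio[OF _ that] by blast
next
  fix \<delta> :: real
  assume \<delta>: "\<delta> > 0"
  \<comment> \<open>The precision determines only the number \<open>M\<close> of leading terms
    summed for \<rho> = 1/2; both the evaluator and the program are then fixed for all
    sources.\<close>
  obtain M :: nat where M: "real M \<ge> 3 / (2 * \<delta>)" using real_arch_simple by blast
  show "\<exists>E. level_evaluator \<delta> (1/2) (E (1/2)) \<and> level_evaluator \<delta> 1 (E 1) \<and>
        (\<exists>prog.
           solves_in_soft_O prog E (\<lambda>m (p :: nat \<Rightarrow> 'a pmf) h. True)
             (\<lambda>m p h. surprisal_range m p / h + real (input_size m p)) \<and>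
           (\<forall>c. solves_in_soft_O prog E
             (\<lambda>m (p :: nat \<Rightarrow> 'a pmf) h.
                surprisal_range m p \<le> c * real m \<and>
                real (input_size m p) \<le> c * (real m + real m / h))
             (\<lambda>m p h. real m / h)))"
    using level_evaluator_evaluator[OF \<delta> M] main_prog_solves[of M] main_prog_solves_extensive[of M] by blast
qed

end
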